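(* Let $H$ be an $n\times n$ GUE matrix and let $M$ be an $n\times n$ Hermitian random matrix, independent of $H$, whose eigenvalues $x_1,\ldots,x_n$ follow the polynomial ensemble on $\mathbb R$ with density $\frac{1}{Z_n}\Delta_n(x)\det[f_{k-1}(x_j)]_{j,k=1}^n$ for given functions $f_0,\ldots,f_{n-1}$. Then the density of the eigenvalues $y_1,\ldots,y_n$ of $H+M$ is given by $$\frac{1}{Z_n'}\,\Delta_n(y)\,\det\left[F_{k-1}(y_j)\right]_{j,k=1}^n$$ for some constant $Z_n'$, where $$F_k(y)=\int_{-\infty}^{\infty} f_k(t)\,e^{-\frac12 (y-t)^2}\,dt,\qquad k=0,\ldots,n-1.$$
   Context: $\Delta_n(x)=\prod_{1\le j<k\le n}(x_k-x_j)$ is the Vandermonde determinant. A polynomial ensemble is a probability density for $n$ particles $x_1,\ldots,x_n$ on $\mathbb R$ of the form $\frac1{Z_n}\Delta_n(x)\det[f_{k-1}(x_j)]_{j,k=1}^n$, with $Z_n$ a normalization constant. A GUE matrix is a Hermitian random matrix whose diagonal entries are standard real normal, whose strictly upper-triangular entries are standard complex normal ($\mathbb E|H_{jk}|^2=1$), and whose diagonal and upper-triangular entries are all independent; equivalently it has density proportional to $e^{-\frac12\operatorname{Tr}H^2}$. Densities are for unordered eigenvalues (symmetric densities on $\mathbb R^n$). *)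

theory Defs
  imports "HOL-Probability.Probability"
begin

text \<open>
  An n-by-n matrix is indexed by a finite linearly ordered type \<open>'n\<close> with \<open>CARD('n) = n\<close>; its
  elements, in increasing order, play the role of the indices 1, ..., n (for particles, rows and
  columns) and 0, ..., n-1 (for the functions of a polynomial ensemble).
\<close>

definition hermitian :: "complex ^ 'n ^ 'n \<Rightarrow> bool" where
  "hermitian A \<longleftrightarrow> (\<forall>i j. A $ i $ j = cnj (A $ j $ i))"

text \<open>
  The eigenvalues of a Hermitian matrix in nondecreasing order, repeated according to their
  multiplicity as zeros of the characteristic polynomial. The value is meaningless for matrices
  whose characteristic polynomial does not split over the reals.
\<close>

definition eigenvalues ::
  "complex ^ ('n::{finite,linorder}) ^ ('n::{finite,linorder}) \<Rightarrow> real ^ ('n::{finite,linorder})" where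
  "eigenvalues A = (THE x. (\<forall>i j. i \<le> j \<longrightarrow> x $ i \<le> x $ j) \<and>
     (\<forall>z. det (mat z - A) = (\<Prod>i\<in>UNIV. z - complex_of_real (x $ i))))"

text \<open>
  Density of the \<^emph>\<open>unordered\<close> eigenvalues of a random Hermitian matrix: the eigenvalues are listed
  in a uniformly random order, drawn independently of the matrix. Nonnegativity is required
  separately because \<^const>\<open>ennreal\<close> sends negative numbers to 0.
\<close>

definition has_eigenvalue_density ::
  "'a measure \<Rightarrow> ('a \<Rightarrow> complex ^ ('n::{finite,linorder}) ^ ('n::{finite,linorder})) \<Rightarrow>
    (real ^ ('n::{finite,linorder}) \<Rightarrow> real) \<Rightarrow> bool" where
  "has_eigenvalue_density P A \<rho> \<longleftrightarrow>
     (AE x in lborel. 0 \<le> \<rho> x) \<and>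
     distributed (P \<Otimes>\<^sub>M uniform_count_measure {\<pi>. \<pi> permutes (UNIV :: 'n set)}) lborel
       (\<lambda>(\<omega>, \<pi>). \<chi> i. eigenvalues (A \<omega>) $ \<pi> i) (\<lambda>x. ennreal (\<rho> x))"

definition standard_complex_normal :: "'a measure \<Rightarrow> ('a \<Rightarrow> complex) \<Rightarrow> bool" where
  "standard_complex_normal P X \<longleftrightarrow>
     prob_space.indep_var P borel (\<lambda>\<omega>. Re (X \<omega>)) borel (\<lambda>\<omega>. Im (X \<omega>)) \<and>
     distributed P lborel (\<lambda>\<omega>. Re (X \<omega>)) (normal_density 0 (sqrt (1/2))) \<and>
     distributed P lborel (\<lambda>\<omega>. Im (X \<omega>)) (normal_density 0 (sqrt (1/2)))"

definition GUE ::
  "'a measure \<Rightarrow> ('a \<Rightarrow> complex ^ ('n::{finite,linorder}) ^ ('n::{finite,linorder})) \<Rightarrow> bool" where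
  "GUE P H \<longleftrightarrow>
     (\<forall>\<omega>\<in>space P. hermitian (H \<omega>)) \<and>
     (\<forall>i. distributed P lborel (\<lambda>\<omega>. Re (H \<omega> $ i $ i)) std_normal_density) \<and>
     (\<forall>i j. i < j \<longrightarrow> standard_complex_normal P (\<lambda>\<omega>. H \<omega> $ i $ j)) \<and>
     prob_space.indep_vars P (\<lambda>_. borel) (\<lambda>(i, j) \<omega>. H \<omega> $ i $ j) {(i, j). i \<le> j}"

definition vandermonde :: "real ^ ('n::{finite,linorder}) \<Rightarrow> real" where
  "vandermonde x = (\<Prod>(j, k)\<in>{(j, k). j < k}. x $ k - x $ j)"

text \<open>
  The expression defining a polynomial ensemble; that it is a probability density, i.e. that \<open>Z\<close> is
  the normalization constant, is part of \<^const>\<open>has_eigenvalue_density\<close>. \<open>Z\<close> may be negative.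
\<close>

definition polynomial_ensemble ::
  "real \<Rightarrow> ('n \<Rightarrow> real \<Rightarrow> real) \<Rightarrow> real ^ ('n::{finite,linorder}) \<Rightarrow> real" where
  "polynomial_ensemble Z f x = 1 / Z * vandermonde x * det (\<chi> j k. f k (x $ j))"

end

theory Submission
  imports Defs "HOL-Computational_Algebra.Fundamental_Theorem_Algebra"
begin

text \<open>
  The law of \<open>H + M\<close> is tested against the products \<open>\<Prod>l. 1 / det (z l - Y)\<close> with one pole per particle, the
  imaginary parts of the poles being distinct and nonzero.  On the Vandermonde product of \<open>w\<close> times
  \<open>\<Prod>l. 1 / det (w l - Y)\<close> the Laplacian in the Hermitian matrix \<open>Y\<close> equals the flat Laplacian in \<open>w\<close>, so
  interpolating \<open>cos \<theta> \<cdot> \<eta>\<close>, \<open>sin \<theta> \<cdot> H\<close> between Gaussian perturbations of \<open>w\<close> and of \<open>Y\<close> trades the noise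
  \<open>H\<close> for independent real Gaussian shifts \<open>\<eta>\<close> of the poles.  By Cauchy's formula, that product times the
  Vandermonde product of the eigenvalues \<open>x\<close> of \<open>M\<close> is, up to sign, the determinant of \<open>1 / (w l - x j)\<close>,
  whose rows involve one shift each, and averaging over a shift convolves with the Gaussian kernel.

  Conversely these expectations determine a symmetric law: the Lagrange identity and a limit give
  all products of at least \<open>n\<close> poles, repetitions allowed, hence \<open>\<Prod>j. 1 / Q (y j)\<close> for positive polynomials \<open>Q\<close>
  of large degree.  Their limits include \<open>\<Prod>j. r (y j)\<close> for step functions \<open>r\<close>, and polarization yields
  the symmetrized indicators of boxes.
\<close>

subsection \<open>Vandermonde and Cauchy determinants\<close>

text \<open>The matrix \<open>H + M\<close> is never diagonalized by a change of variables: no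
  integration over the unitary group occurs, only determinants of \<open>z - Y\<close>, which are
  polynomials in the entries and symmetric in the eigenvalues. There are as many poles as particles
  because the Cauchy determinant has to be square. The imaginary parts, not merely the poles, must
  differ: the shifts are real, so the shifted poles then never collide and all logarithmic
  derivatives stay bounded along the interpolation. The two Laplacians enter because Gaussian
  integration by parts turns the derivative of the interpolated expectation into sin \<theta> cos
  \<theta> times the expected difference of the Laplacians. Integrability of the \<open>f k\<close>
  is not given; the existence of the density forces
  \<open>(1 + \<bar>t\<bar>) ^ (CARD('n) - 1) * f k t\<close> to be integrable, and the Gaussian
  transform preserves this weight. Nor is the sign of the candidate density known; nonnegativity
  follows at the end, from agreement with a probability law. Each of the n unnormalized kernels is
  \<open>sqrt (2 * pi)\<close> times a normal density, whence
  \<open>Z' = Z * sqrt (2 * pi) ^ CARD('n)\<close>.\<close>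

definition vdm :: "('n::{finite,linorder} \<Rightarrow> 'a::comm_ring_1) \<Rightarrow> 'a" where
  "vdm x = (\<Prod>(j, k)\<in>{(j, k). j < k}. x k - x j)"

text \<open>The least moved point would be sent to a smaller, hence fixed, point, against
  injectivity. In a triangular determinant this leaves only the identity permutation.\<close>

lemma permutes_le_imp_id:
  fixes p :: "'n::{finite,linorder} \<Rightarrow> 'n"
  assumes p: "p permutes UNIV" and le: "\<And>i. p i \<le> i"
  shows "p = id"
proof (rule ccontr)
  assume "p \<noteq> id"
  then have ne: "{i. p i \<noteq> i} \<noteq> {}" by auto
  define m where "m = Min {i. p i \<noteq> i}"
  have m: "p m \<noteq> m" using Min_in[OF _ ne] by (auto simp: m_def)
  then have "p m < m" using le[of m] by simp
  have "p m \<notin> {i. p i \<noteq> i}"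
  proof
    assume "p m \<in> {i. p i \<noteq> i}"
    then have "m \<le> p m" unfolding m_def by (intro Min_le) auto
    with \<open>p m < m\<close> show False by simp
  qed
  then have "p (p m) = p m" by simp
  then have "p m = m" using permutes_inj[OF p] by (simp add: inj_eq)
  with m show False by simp
qed

lemma det_lower_triangular:
  fixes A :: "'a::comm_ring_1^('n::{finite,linorder})^('n::{finite,linorder})"
  assumes "\<And>i j. i < j \<Longrightarrow> A $ i $ j = 0"
  shows "det A = (\<Prod>i\<in>UNIV. A $ i $ i)"
proof -
  have "det A = (\<Sum>p\<in>{p. p permutes (UNIV::'n set)}. if p = id then (\<Prod>i\<in>UNIV. A $ i $ i) else 0)"
    unfolding det_def
  proof (rule sum.cong[OF refl])
    fix p :: "'n \<Rightarrow> 'n" assume p: "p \<in> {p. p permutes UNIV}"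
    show "of_int (sign p) * (\<Prod>i\<in>UNIV. A $ i $ p i) = (if p = id then \<Prod>i\<in>UNIV. A $ i $ i else 0)"
    proof (cases "p = id")
      case False
      then obtain i where "i < p i" using permutes_le_imp_id[of p] p not_le by blast
      then have "A $ i $ p i = 0" by (rule assms)
      then have "(\<Prod>i\<in>UNIV. A $ i $ p i) = 0" by (intro prod_zero) auto
      then show ?thesis using False by simp
    qed simp
  qed
  also have "\<dots> = (\<Prod>i\<in>UNIV. A $ i $ i)"
    by (simp add: sum.delta permutes_id finite_permutations)
  finally show ?thesis .
qed

lemma det_upper_triangular:
  fixes A :: "'a::comm_ring_1^('n::{finite,linorder})^('n::{finite,linorder})"
  assumes "\<And>i j. j < i \<Longrightarrow> A $ i $ j = 0"
  shows "det A = (\<Prod>i\<in>UNIV. A $ i $ i)"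
proof -
  have "det (transpose A) = (\<Prod>i\<in>UNIV. transpose A $ i $ i)"
    by (rule det_lower_triangular) (simp add: transpose_def assms)
  then show ?thesis by (simp only: det_transpose) (simp add: transpose_def)
qed

text \<open>The rank \<open>card {..<k}\<close> turns the abstract ordered index type into the
  exponents 0, ..., n-1; it is used wherever powers or list positions are indexed by
  particles.\<close>

lemma bij_betw_rank:
  "bij_betw (\<lambda>k::'n::{finite,linorder}. card {..<k}) UNIV {..<CARD('n)}"
proof -
  have lt: "card {..<j} < card {..<k}" if "j < k" for j k :: 'n
    using that by (intro psubset_card_mono) auto
  have inj: "inj (\<lambda>k::'n. card {..<k})"
    by (rule injI) (metis lt less_irrefl linorder_neqE)
  have "card {..<k} < CARD('n)" for k :: 'n
    by (intro psubset_card_mono) auto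
  then have "range (\<lambda>k::'n. card {..<k}) \<subseteq> {..<CARD('n)}" by auto
  then have "range (\<lambda>k::'n. card {..<k}) = {..<CARD('n)}"
    by (intro card_subset_eq) (auto simp: card_image[OF inj])
  with inj show ?thesis by (simp add: bij_betw_def)
qed

text \<open>Evaluation of a polynomial of degree below n as a row of powers times a column of
  coefficients, the form in which it becomes an entry of a matrix product.\<close>

lemma poly_eq_sum_rank:
  fixes p :: "'a::comm_ring_1 poly"
  assumes "degree p < CARD('n::{finite,linorder})"
  shows "poly p t = (\<Sum>m\<in>(UNIV::'n set). t ^ card {..<m} * coeff p (card {..<m}))"
proof -
  have "poly p t = (\<Sum>i\<le>degree p. coeff p i * t ^ i)" by (rule poly_altdef)
  also have "\<dots> = (\<Sum>i<CARD('n). coeff p i * t ^ i)"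
    using assms by (intro sum.mono_neutral_left) (auto simp: coeff_eq_0)
  also have "\<dots> = (\<Sum>m\<in>(UNIV::'n set). coeff p (card {..<m}) * t ^ card {..<m})"
    by (rule sum.reindex_bij_betw[OF bij_betw_rank, symmetric])
  finally show ?thesis by (simp add: mult.commute)
qed

lemma lead_coeff_prod_linear:
  fixes x :: "'i \<Rightarrow> 'a::idom"
  assumes "finite A"
  shows "degree (\<Prod>i\<in>A. [:- x i, 1:]) = card A" "coeff (\<Prod>i\<in>A. [:- x i, 1:]) (card A) = 1"
proof -
  show "degree (\<Prod>i\<in>A. [:- x i, 1:]) = card A"
    by (subst degree_prod_eq_sum_degree) auto
  then show "coeff (\<Prod>i\<in>A. [:- x i, 1:]) (card A) = 1"
    using lead_coeff_prod[of "\<lambda>i. [:- x i, 1:]" A] by simp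
qed

lemma vdm_eq_prod: "vdm x = (\<Prod>k\<in>UNIV. \<Prod>j\<in>{..<k}. x k - x j)"
proof -
  have "vdm x = (\<Prod>(k, j)\<in>(SIGMA k:UNIV. {..<k}). x k - x j)"
    unfolding vdm_def
    by (rule prod.reindex_bij_witness[of _ "\<lambda>(a,b). (b,a)" "\<lambda>(a,b). (b,a)"]) auto
  then show ?thesis by (simp add: prod.Sigma)
qed

text \<open>Multiplying by the unitriangular coefficient matrix \<open>T\<close> of the Newton
  polynomials \<open>N k\<close> does not change the determinant. The product has the entries
  \<open>poly (N k) (x j)\<close>, which vanish for j < k, and its diagonal gives the product of
  differences.\<close>

lemma det_vandermonde:
  fixes x :: "'n::{finite,linorder} \<Rightarrow> 'a::idom"
  shows "det (\<chi> j m. x j ^ card {..<m}) = vdm x"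
proof -
  define N where "N k = (\<Prod>i\<in>{..<k}. [:- x i, 1:])" for k
  define T :: "'a^('n::{finite,linorder})^('n::{finite,linorder})" where "T = (\<chi> m k. coeff (N k) (card {..<m}))"
  define V :: "'a^('n::{finite,linorder})^('n::{finite,linorder})" where "V = (\<chi> j m. x j ^ card {..<m})"
  have card_lt: "card {..<j} < card {..<k}" if "j < k" for j k :: 'n
    using that by (intro psubset_card_mono) auto
  have deg: "degree (N k) = card {..<k}" and lc: "coeff (N k) (card {..<k}) = 1" for k
    unfolding N_def by (simp_all add: lead_coeff_prod_linear)
  have "det T = (\<Prod>i\<in>UNIV. T $ i $ i)"
    by (rule det_upper_triangular) (simp add: T_def coeff_eq_0 deg card_lt)
  then have T: "det T = 1" by (simp add: T_def lc)
  have "card {..<k} < CARD('n)" for k :: 'n by (intro psubset_card_mono) auto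
  then have VT: "(V ** T) $ j $ k = poly (N k) (x j)" for j k
    by (subst poly_eq_sum_rank[where 'n='n]) (simp_all add: matrix_matrix_mult_def V_def T_def deg)
  have "det (V ** T) = (\<Prod>i\<in>UNIV. (V ** T) $ i $ i)"
    by (rule det_lower_triangular) (auto simp: VT N_def poly_prod intro!: prod_zero)
  also have "\<dots> = vdm x"
    by (simp add: VT N_def poly_prod vdm_eq_prod)
  finally show ?thesis by (simp add: det_mul T flip: V_def)
qed

lemma vdm_eq_0_iff:
  fixes x :: "'n::{finite,linorder} \<Rightarrow> 'a::idom"
  shows "vdm x = 0 \<longleftrightarrow> \<not> inj x"
proof
  assume "vdm x = 0"
  then show "\<not> inj x" by (auto simp: vdm_def inj_def)
next
  assume "\<not> inj x"
  then obtain i j where "x i = x j" "i < j" by (metis injI linorder_neqE)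
  then show "vdm x = 0" unfolding vdm_def by (intro prod_zero bexI[of _ "(i,j)"]) auto
qed

text \<open>Every unordered pair occurs twice on the left, once with each sign.\<close>

lemma prod_neq_eq_vdm_squared:
  fixes x :: "'n::{finite,linorder} \<Rightarrow> 'a::comm_ring_1"
  shows "(\<Prod>j\<in>UNIV. \<Prod>i\<in>UNIV - {j}. x j - x i) = (- 1) ^ card {(j, k). j < (k::'n)} * (vdm x)\<^sup>2"
proof -
  let ?D = "{(j, k). j < (k::'n)}"
  have "(\<Prod>j\<in>UNIV. \<Prod>i\<in>UNIV - {j}. x j - x i) = (\<Prod>(j, i)\<in>(SIGMA j:UNIV. UNIV - {j}). x j - x i)"
    by (simp add: prod.Sigma)
  also have "(SIGMA j:UNIV. UNIV - {j}) = ?D \<union> prod.swap ` ?D"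
    by (auto simp: image_iff)
  also have "(\<Prod>(j, i)\<in>?D \<union> prod.swap ` ?D. x j - x i) = (\<Prod>(j, i)\<in>?D. x j - x i) * (\<Prod>(j, i)\<in>prod.swap ` ?D. x j - x i)"
    by (rule prod.union_disjoint) (auto)
  also have "(\<Prod>(j, i)\<in>prod.swap ` ?D. x j - x i) = vdm x"
    by (subst prod.reindex) (auto simp: vdm_def case_prod_unfold)
  also have "(\<Prod>(j, i)\<in>?D. x j - x i) = (\<Prod>(j, i)\<in>?D. - 1 * (x i - x j))"
    by (rule prod.cong) auto
  also have "\<dots> = (- 1) ^ card ?D * vdm x"
    unfolding case_prod_unfold by (subst prod.distrib) (simp add: vdm_def case_prod_unfold)
  finally show ?thesis by (simp add: power2_eq_square mult.assoc)
qed

text \<open>With \<open>c\<close> the coefficient matrix of the polynomials \<open>L j\<close> (the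
  product over all nodes except \<open>x j\<close>), the product of the Vandermonde matrix of
  \<open>w\<close> with \<open>c\<close> is the Cauchy matrix with row l scaled by
  \<open>p l\<close>. The same product at the nodes \<open>x\<close> is diagonal, which yields
  \<open>det c\<close> after division by \<open>vdm x\<close>. If two nodes coincide, both sides are
  0.\<close>

lemma det_cauchy:
  fixes w x :: "'n::{finite,linorder} \<Rightarrow> 'a::field"
  assumes ne: "\<And>l j. w l \<noteq> x j"
  shows "det (\<chi> l j. 1 / (w l - x j)) =
    (- 1) ^ card {(j, k). j < (k::'n)} * (vdm w * vdm x * (\<Prod>l\<in>UNIV. \<Prod>j\<in>UNIV. 1 / (w l - x j)))"
proof (cases "inj x")
  case False
  then obtain i j where ij: "x i = x j" "i \<noteq> j" by (auto simp: inj_def)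
  have "det (\<chi> l j. 1 / (w l - x j)) = 0"
    by (rule det_identical_columns[of i j]) (use ij in \<open>auto simp: column_def\<close>)
  with False show ?thesis by (simp add: vdm_eq_0_iff)
next
  case True
  let ?s = "(- 1 :: 'a) ^ card {(j, k). j < (k::'n)}"
  define L where "L j = (\<Prod>i\<in>UNIV - {j}. [:- x i, 1:])" for j
  define c :: "'a^('n::{finite,linorder})^('n::{finite,linorder})" where "c = (\<chi> m j. coeff (L j) (card {..<m}))"
  define V :: "('n \<Rightarrow> 'a) \<Rightarrow> 'a^('n::{finite,linorder})^('n::{finite,linorder})" where "V = (\<lambda>y. \<chi> j m. y j ^ card {..<m})"
  have "degree (L j) = card (UNIV - {j})" for j
    unfolding L_def by (rule lead_coeff_prod_linear) simp
  then have deg: "degree (L j) < CARD('n)" for j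
    by (simp add: card_gt_0_iff)
  have Vc: "(V y ** c) $ l $ j = poly (L j) (y l)" for y l j
    by (subst poly_eq_sum_rank[where 'n='n, OF deg]) (simp_all add: matrix_matrix_mult_def V_def c_def)
  have V: "det (V y) = vdm y" for y by (simp add: V_def det_vandermonde)
  have "det (V x ** c) = (\<Prod>i\<in>UNIV. (V x ** c) $ i $ i)"
    by (rule det_lower_triangular) (auto simp: Vc L_def poly_prod intro!: prod_zero)
  also have "\<dots> = (\<Prod>j\<in>UNIV. \<Prod>i\<in>UNIV - {j}. x j - x i)"
    by (simp add: Vc L_def poly_prod)
  finally have "vdm x * det c = ?s * (vdm x)\<^sup>2"
    by (simp add: det_mul V prod_neq_eq_vdm_squared)
  then have c: "det c = ?s * vdm x"
    using True by (simp add: power2_eq_square vdm_eq_0_iff)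
  define C :: "'a^('n::{finite,linorder})^('n::{finite,linorder})" where "C = (\<chi> l j. 1 / (w l - x j))"
  define p where "p l = (\<Prod>j\<in>UNIV. w l - x j)" for l
  have p0: "p l \<noteq> 0" for l using ne by (simp add: p_def)
  have "V w ** c = (\<chi> l. p l *s C $ l)"
  proof -
    have "poly (L j) (w l) = p l * (1 / (w l - x j))" for l j
      unfolding L_def p_def poly_prod using ne[of l j] by (subst prod.remove[of UNIV j]) auto
    then show ?thesis by (simp add: vec_eq_iff Vc C_def)
  qed
  then have "det (V w ** c) = (\<Prod>l\<in>UNIV. p l) * det C"
    by (simp only: det_rows_mul) simp
  then have "vdm w * det c = (\<Prod>l\<in>UNIV. p l) * det C"
    by (simp only: det_mul V)
  moreover have "(\<Prod>l\<in>UNIV. p l) * (\<Prod>l\<in>UNIV. \<Prod>j\<in>UNIV. 1 / (w l - x j)) = 1"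
  proof -
    have "p l * (\<Prod>j\<in>UNIV. 1 / (w l - x j)) = 1" for l
      using p0[of l] unfolding p_def by (simp add: prod_dividef)
    then show ?thesis by (simp flip: prod.distrib)
  qed
  ultimately have "det C = vdm w * (?s * vdm x) * (\<Prod>l\<in>UNIV. \<Prod>j\<in>UNIV. 1 / (w l - x j))"
    unfolding c by (metis (no_types, lifting) mult.commute mult.left_commute mult_1)
  then show ?thesis
    unfolding C_def by (simp only: ac_simps)
qed

subsection \<open>Resolvents and eigenvalues of Hermitian matrices\<close>

text \<open>The real inner product on complex vectors is the real part of the Hermitian one, so
  pairing with \<i> times \<open>u\<close> extracts an imaginary part. The quadratic form of
  \<open>A\<close> is real and drops out.\<close>

lemma hermitian_inner_resolvent:
  fixes A :: "complex^'n^'n"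
  assumes "hermitian A"
  shows "inner (\<i> *s u) ((mat z - A) *v u) = Im z * (norm u)\<^sup>2"
proof -
  define S where "S = (\<Sum>i\<in>UNIV. \<Sum>j\<in>UNIV. cnj (u$i) * (A$i$j * u$j))"
  have h: "cnj (A$i$j) = A$j$i" for i j
    using assms by (metis hermitian_def)
  have "cnj S = (\<Sum>i\<in>UNIV. \<Sum>j\<in>UNIV. u$i * (A$j$i * cnj (u$j)))"
    unfolding S_def by (simp add: h)
  also have "\<dots> = S"
    unfolding S_def by (subst sum.swap) (simp add: ac_simps)
  finally have S: "Im S = 0" by (metis Reals_cnj_iff complex_is_Real_iff)
  have ent: "((mat z - A) *v u) $ i = z * u$i - (\<Sum>j\<in>UNIV. A$i$j * u$j)" for i
  proof -
    have "(mat z - A) $ i $ j * u $ j = (if i = j then z * u $ j else 0) - A$i$j * u$j" for j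
      by (simp add: mat_def left_diff_distrib)
    then show ?thesis by (simp add: matrix_vector_mult_def sum_subtractf)
  qed
  have inn: "inner (\<i> * a) b = Im (cnj a * b)" for a b
    by (simp add: inner_complex_def)
  have "inner (\<i> *s u) ((mat z - A) *v u) = (\<Sum>i\<in>UNIV. Im (cnj (u$i) * ((mat z - A) *v u) $ i))"
    by (simp only: inner_vec_def vector_smult_component inn)
  also have "\<dots> = Im (\<Sum>i\<in>UNIV. z * (u$i * cnj (u$i))) - Im S"
  proof -
    have "cnj (u$i) * ((mat z - A) *v u) $ i =
        z * (u$i * cnj (u$i)) - (\<Sum>j\<in>UNIV. cnj (u$i) * (A$i$j * u$j))" for i
      unfolding ent sum_distrib_left[symmetric] by (simp only: right_diff_distrib ac_simps)
    then show ?thesis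
      by (simp only: S_def Im_sum minus_complex.sel sum_subtractf)
  qed
  also have "\<dots> = (\<Sum>i\<in>UNIV. Im z * (norm (u$i))\<^sup>2)"
    unfolding S by (simp flip: complex_norm_square)
  also have "\<dots> = Im z * (norm u)\<^sup>2"
    by (simp add: norm_vec_def L2_set_def sum_nonneg sum_distrib_left)
  finally show ?thesis .
qed

lemma norm_smult_complex: "norm (c *s (u :: complex^'n)) = norm c * norm u"
  by (simp add: norm_vec_def L2_set_def norm_mult power_mult_distrib real_sqrt_mult flip: sum_distrib_left)

text \<open>Cauchy-Schwarz applied to the preceding identity. Both the invertibility of
  \<open>mat z - A\<close> off the real axis and the bound on the resolvent entries come from
  here.\<close>

lemma hermitian_resolvent_lower_bound:
  fixes A :: "complex^'n^'n"
  assumes "hermitian A"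
  shows "\<bar>Im z\<bar> * norm u \<le> norm ((mat z - A) *v u)"
proof (cases "u = 0")
  case False
  have "\<bar>Im z\<bar> * (norm u)\<^sup>2 = \<bar>inner (\<i> *s u) ((mat z - A) *v u)\<bar>"
    by (simp add: hermitian_inner_resolvent[OF assms] abs_mult)
  also have "\<dots> \<le> norm (\<i> *s u) * norm ((mat z - A) *v u)"
    by (rule Cauchy_Schwarz_ineq2)
  finally have "\<bar>Im z\<bar> * (norm u)\<^sup>2 \<le> norm u * norm ((mat z - A) *v u)"
    by (simp add: norm_smult_complex)
  with False show ?thesis by (simp add: power2_eq_square mult.left_commute)
qed simp

lemma hermitian_det_resolvent_nonzero:
  fixes A :: "complex^'n^'n"
  assumes "hermitian A" "Im z \<noteq> 0"
  shows "det (mat z - A) \<noteq> 0"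
proof -
  have "x = 0" if "(mat z - A) *v x = 0" for x
    using hermitian_resolvent_lower_bound[OF assms(1), of z x] that assms(2)
    by (simp add: mult_le_0_iff)
  then have "invertible (mat z - A)"
    by (simp add: invertible_left_inverse matrix_left_invertible_ker)
  then show ?thesis by (simp add: invertible_det_nz)
qed

lemma matrix_inv_det_nonzero:
  fixes A :: "'a::field^'n^'n"
  assumes "det A \<noteq> 0"
  shows "A ** matrix_inv A = mat 1" "matrix_inv A ** A = mat 1"
  using assms someI_ex[of "\<lambda>A'. A ** A' = mat 1 \<and> A' ** A = mat 1"]
  by (auto simp: invertible_det_nz[symmetric] invertible_def matrix_inv_def)

lemma hermitian_resolvent_bound:
  fixes A :: "complex^'n^'n"
  assumes "hermitian A" "Im z \<noteq> 0"
  shows "norm (matrix_inv (mat z - A) $ i $ j) \<le> 1 / \<bar>Im z\<bar>"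
proof -
  define u where "u = matrix_inv (mat z - A) *v axis j 1"
  have "(mat z - A) *v u = axis j 1"
    using matrix_inv_det_nonzero(1)[OF hermitian_det_resolvent_nonzero[OF assms]]
    by (simp add: u_def matrix_vector_mul_assoc)
  then have "\<bar>Im z\<bar> * norm u \<le> 1"
    using hermitian_resolvent_lower_bound[OF assms(1), of z u] by (simp add: norm_axis_1)
  then have "norm u \<le> 1 / \<bar>Im z\<bar>" using assms(2) by (simp add: field_simps)
  moreover have "norm (u $ i) \<le> norm u" by (rule Finite_Cartesian_Product.norm_nth_le)
  moreover have "u $ i = matrix_inv (mat z - A) $ i $ j"
    by (simp add: u_def matrix_vector_mult_def axis_def if_distrib cong: if_cong)
  ultimately show ?thesis by simp
qed

text \<open>The determinant is taken over the polynomial ring. Only the identity permutation reaches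
  degree n; any other one picks at least one constant off-diagonal entry.\<close>

lemma exists_monic_charpoly:
  fixes A :: "complex^'n^'n"
  shows "\<exists>p. (\<forall>z. poly p z = det (mat z - A)) \<and> degree p = CARD('n) \<and> lead_coeff p = 1"
proof -
  define M :: "complex poly^'n^'n" where "M = (\<chi> i j. if i = j then [:- A$i$j, 1:] else [:- A$i$j:])"
  define q where "q p = of_int (sign p) * (\<Prod>i\<in>UNIV. M $ i $ p i)" for p
  have det: "det M = q id + (\<Sum>p\<in>{p. p permutes UNIV} - {id}. q p)"
    unfolding det_def q_def by (rule sum.remove) (auto simp: permutes_id finite_permutations)
  have qid: "degree (q id) = CARD('n)" "coeff (q id) (CARD('n)) = 1"
    using lead_coeff_prod_linear[of UNIV "\<lambda>i. A$i$i"] by (simp_all add: q_def M_def)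
  have lt: "degree (q p) < CARD('n)" if p: "p \<in> {p. p permutes UNIV} - {id}" for p
  proof -
    obtain i where i: "i \<noteq> p i" using p by (metis DiffD2 eq_id_iff insertCI)
    have "degree (q p) \<le> degree (\<Prod>i\<in>UNIV. M $ i $ p i)"
      unfolding q_def by (metis degree_mult_le degree_of_int add_0)
    also have "\<dots> \<le> (\<Sum>i\<in>UNIV. degree (M $ i $ p i))"
      using degree_prod_sum_le[of UNIV "\<lambda>i. M $ i $ p i"] by (simp add: o_def)
    also have "\<dots> < (\<Sum>i\<in>(UNIV::'n set). 1)"
      by (rule sum_strict_mono_ex1) (use i in \<open>auto simp: M_def\<close>)
    finally show ?thesis by simp
  qed
  have rest: "degree (\<Sum>p\<in>{p. p permutes UNIV} - {id}. q p) < CARD('n)"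
    by (rule degree_sum_less[OF lt]) auto
  have deg: "degree (det M) = CARD('n)"
    unfolding det using rest qid(1) by (simp add: degree_add_eq_left)
  moreover have "coeff (det M) (CARD('n)) = 1"
    unfolding det using rest qid(2) by (simp add: coeff_eq_0)
  moreover have "poly (det M) z = det (mat z - A)" for z
  proof -
    have "poly (M $ i $ j) z = (mat z - A) $ i $ j" for i j
      by (simp add: M_def mat_def)
    then show ?thesis by (simp add: det_def poly_sum poly_prod)
  qed
  ultimately show ?thesis by (intro exI[of _ "det M"] conjI allI) simp_all
qed

lemma mset_eq_of_prod_eq:
  fixes x y :: "'n::finite \<Rightarrow> real"
  assumes "\<And>z. (\<Prod>i\<in>UNIV. z - complex_of_real (x i)) = (\<Prod>i\<in>UNIV. z - complex_of_real (y i))"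
  shows "image_mset x (mset_set UNIV) = image_mset y (mset_set UNIV)"
proof -
  have pr: "proots (\<Prod>i\<in>UNIV. [:- complex_of_real (w i), 1:]) =
      image_mset complex_of_real (image_mset w (mset_set UNIV))" for w :: "'n \<Rightarrow> real"
    by (subst proots_prod) (auto simp: sum_unfold_sum_mset multiset.map_comp o_def)
  have "(\<Prod>i\<in>UNIV. [:- complex_of_real (x i), 1:]) = (\<Prod>i\<in>UNIV. [:- complex_of_real (y i), 1:])"
    using assms by (subst poly_eq_poly_eq_iff[symmetric]) (auto simp: fun_eq_iff poly_prod)
  then have "image_mset complex_of_real (image_mset x (mset_set UNIV)) =
      image_mset complex_of_real (image_mset y (mset_set UNIV))"
    by (simp flip: pr)
  then have "image_mset Re (image_mset complex_of_real (image_mset x (mset_set UNIV))) =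
      image_mset Re (image_mset complex_of_real (image_mset y (mset_set UNIV)))" by simp
  then show ?thesis by (simp add: multiset.map_comp o_def)
qed

lemma mono_eq_of_mset_eq:
  fixes x y :: "'n::{finite,linorder} \<Rightarrow> real"
  assumes "mono x" "mono y" "image_mset x (mset_set UNIV) = image_mset y (mset_set UNIV)"
  shows "x = y"
proof -
  define L where "L = sorted_list_of_set (UNIV :: 'n set)"
  have L: "set L = UNIV" "sorted L" "mset L = mset_set UNIV"
    by (simp_all add: L_def) (metis mset_sorted_list_of_multiset sorted_list_of_mset_set)
  have sorted: "sorted (map w L)" if "mono w" for w :: "'n \<Rightarrow> real"
    using L(2) that by (auto simp: sorted_map mono_def intro: sorted_wrt_mono_rel)
  have "mset (map x L) = mset (map y L)" using assms(3) L(3) by simp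
  then have "map x L = map y L"
    using properties_for_sort[of "map x L" "map y L"] properties_for_sort[of "map y L" "map y L"]
      sorted[OF assms(1)] sorted[OF assms(2)] by metis
  then show "x = y" using L(1) by (auto simp: fun_eq_iff)
qed

text \<open>This justifies the definite description. Existence: the characteristic polynomial splits
  over the complex numbers, its roots are real because \<open>mat z - A\<close> is invertible off
  the real axis, and sorting them by rank gives a monotone vector. Uniqueness: the polynomial
  determines the multiset of roots, and a monotone enumeration of it is unique.\<close>

lemma eigenvalues_spec:
  fixes A :: "complex ^ ('n::{finite,linorder}) ^ ('n::{finite,linorder})"
  assumes "hermitian A"
  shows "mono (\<lambda>i. eigenvalues A $ i)"
    "det (mat z - A) = (\<Prod>i\<in>UNIV. z - complex_of_real (eigenvalues A $ i))"
proof -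
  let ?P = "\<lambda>x::real^('n::{finite,linorder}). (\<forall>i j. i \<le> j \<longrightarrow> x $ i \<le> x $ j) \<and>
     (\<forall>z. det (mat z - A) = (\<Prod>i\<in>UNIV. z - complex_of_real (x $ i)))"
  obtain p where p: "\<And>z. poly p z = det (mat z - A)" "degree p = CARD('n)" "lead_coeff p = 1"
    using exists_monic_charpoly[of A] by metis
  obtain B where B: "size B = CARD('n)" "p = (\<Prod>x\<in>#B. [:-x, 1:])"
    using alg_closed_imp_factorization[of p] p by fastforce
  have real: "r = of_real (Re r)" if "r \<in># B" for r
  proof -
    have "det (mat r - A) = 0"
      unfolding p(1)[symmetric] B(2) poly_prod_mset using that by (auto simp: image_iff intro!: bexI[of _ r])
    then have "Im r = 0" using hermitian_det_resolvent_nonzero[OF assms] by blast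
    then show ?thesis by (simp add: complex_eq_iff)
  qed
  define xs where "xs = sorted_list_of_multiset (image_mset Re B)"
  have xs: "mset xs = image_mset Re B" "sorted xs" by (simp_all add: xs_def)
  have len: "length xs = CARD('n)" by (metis B(1) size_image_mset size_mset xs(1))
  define x :: "real^('n::{finite,linorder})" where "x = (\<chi> i. xs ! card {..<i})"
  have lt: "card {..<k} < length xs" for k :: 'n
    unfolding len by (intro psubset_card_mono) auto
  have "?P x"
  proof (intro conjI allI impI)
    fix i j :: 'n assume "i \<le> j"
    then have "card {..<i} \<le> card {..<j}" by (intro card_mono) auto
    then show "x $ i \<le> x $ j" using xs(2) lt by (simp add: x_def sorted_nth_mono)
  next
    fix z
    have "(\<Prod>i\<in>(UNIV::'n set). z - complex_of_real (x $ i)) = (\<Prod>k<length xs. z - complex_of_real (xs ! k))"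
      unfolding len by (simp add: x_def prod.reindex_bij_betw[OF bij_betw_rank, where g="\<lambda>k. z - complex_of_real (xs ! k)"])
    also have "\<dots> = prod_list (map (\<lambda>t. z - complex_of_real t) xs)"
      by (simp add: prod.list_conv_set_nth atLeast0LessThan)
    also have "\<dots> = (\<Prod>t\<in>#image_mset Re B. z - complex_of_real t)"
      by (simp add: xs(1)[symmetric] prod_mset_prod_list[symmetric])
    also have "\<dots> = (\<Prod>r\<in>#B. z - r)"
      using real by (auto simp: multiset.map_comp o_def intro!: arg_cong[of _ _ prod_mset] image_mset_cong)
    also have "\<dots> = det (mat z - A)"
      by (simp add: p(1)[symmetric] B(2) poly_prod_mset)
    finally show "det (mat z - A) = (\<Prod>i\<in>UNIV. z - complex_of_real (x $ i))" by simp
  qed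
  moreover have "y = x" if "?P y" for y
  proof -
    have "($) y = ($) x"
    proof (rule mono_eq_of_mset_eq)
      show "mono (($) y)" "mono (($) x)" using that \<open>?P x\<close> by (auto simp: mono_def)
      show "image_mset (($) y) (mset_set UNIV) = image_mset (($) x) (mset_set UNIV)"
        by (rule mset_eq_of_prod_eq) (use that \<open>?P x\<close> in auto)
    qed
    then show ?thesis by (simp add: vec_eq_iff fun_eq_iff)
  qed
  ultimately have "?P (eigenvalues A)"
    unfolding eigenvalues_def by (rule theI)
  then show "mono (\<lambda>i. eigenvalues A $ i)"
    "det (mat z - A) = (\<Prod>i\<in>UNIV. z - complex_of_real (eigenvalues A $ i))"
    by (auto simp: mono_def)
qed

lemma norm_diff_real_ge: "\<bar>Im z\<bar> \<le> norm (z - complex_of_real x)"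
  using abs_Im_le_cmod[of "z - complex_of_real x"] by simp

lemma hermitian_det_resolvent_bound:
  fixes A :: "complex ^ ('n::{finite,linorder}) ^ ('n::{finite,linorder})"
  assumes "hermitian A" "Im z \<noteq> 0"
  shows "norm (1 / det (mat z - A)) \<le> (1 / \<bar>Im z\<bar>) ^ CARD('n)"
proof -
  have "norm (1 / (z - complex_of_real x)) \<le> 1 / \<bar>Im z\<bar>" for x
    using norm_diff_real_ge[of z x] assms(2) by (simp add: norm_divide frac_le)
  then have "(\<Prod>i\<in>(UNIV::'n set). norm (1 / (z - complex_of_real (eigenvalues A $ i)))) \<le> (\<Prod>i\<in>(UNIV::'n set). 1 / \<bar>Im z\<bar>)"
    by (intro prod_mono) auto
  then show ?thesis
    unfolding eigenvalues_spec(2)[OF assms(1)] by (simp add: norm_divide prod_dividef prod_norm)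
qed

subsection \<open>Gaussian integration by parts and interpolation\<close>

definition std_normal :: "real measure" where
  "std_normal = density lborel std_normal_density"

lemma sets_std_normal [simp, measurable_cong]: "sets std_normal = sets borel"
  and space_std_normal [simp]: "space std_normal = UNIV"
  by (simp_all add: std_normal_def)

interpretation std_normal: prob_space std_normal
  unfolding std_normal_def by (rule prob_space_normal_density) simp

interpretation std_normal_prod: product_prob_space "\<lambda>_. std_normal" UNIV
  by unfold_locales

lemma integral_std_normal:
  fixes f :: "real \<Rightarrow> 'b::{banach,second_countable_topology}"
  assumes "f \<in> borel_measurable borel"
  shows "integral\<^sup>L std_normal f = (\<integral>x. std_normal_density x *\<^sub>R f x \<partial>lborel)"
  unfolding std_normal_def using assms by (intro integral_density) auto

lemma integrable_std_normal:
  fixes f :: "real \<Rightarrow> 'b::{banach,second_countable_topology}"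
  assumes "f \<in> borel_measurable borel"
  shows "integrable std_normal f \<longleftrightarrow> integrable lborel (\<lambda>x. std_normal_density x *\<^sub>R f x)"
  unfolding std_normal_def using assms by (intro integrable_density) auto

lemma integrable_std_normal_poly: "integrable std_normal (\<lambda>x. (1 + \<bar>x\<bar>) ^ k)"
proof -
  have "integrable lborel (\<lambda>x. \<Sum>i\<le>k. of_nat (k choose i) * (std_normal_density x * \<bar>x\<bar> ^ (k - i)))"
    by (intro Bochner_Integration.integrable_sum integrable_mult_right integrable_std_normal_moment_abs)
  also have "(\<lambda>x. \<Sum>i\<le>k. of_nat (k choose i) * (std_normal_density x * \<bar>x\<bar> ^ (k - i))) =
      (\<lambda>x. std_normal_density x *\<^sub>R (1 + \<bar>x\<bar>) ^ k)"
    by (simp add: binomial_ring sum_distrib_left ac_simps)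
  finally show ?thesis by (subst integrable_std_normal) auto
qed

lemma poly_times_std_normal_density_tendsto_0:
  "(\<lambda>n. (1 + real n) ^ k * std_normal_density (real n)) \<longlonglongrightarrow> 0"
proof (rule Lim_null_comparison)
  show "(\<lambda>n. exp (3/2) * ((1 + real n) ^ k / exp (1 + real n))) \<longlonglongrightarrow> 0"
  proof -
    have "filterlim (\<lambda>n. 1 + real n) at_top sequentially"
      by (rule filterlim_tendsto_add_at_top[OF tendsto_const filterlim_real_sequentially])
    from filterlim_compose[OF tendsto_power_div_exp_0 this, of k] show ?thesis
      using tendsto_mult_right_zero by blast
  qed
  show "\<forall>\<^sub>F n in sequentially. norm ((1 + real n) ^ k * std_normal_density (real n)) \<le>
      exp (3/2) * ((1 + real n) ^ k / exp (1 + real n))"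
  proof (rule always_eventually, rule allI)
    fix n :: nat
    have sq: "1 / sqrt (2 * pi) \<le> 1" using pi_ge_two by (simp add: field_simps)
    \<comment> \<open>Completing the square (n - 1)^2 compares the Gaussian with a simple
      exponential; this is the origin of \<open>exp (3/2)\<close>.\<close>
    have "- (real n)\<^sup>2 / 2 \<le> 3 / 2 - (1 + real n)"
      using zero_le_power2[of "real n - 1"] by (simp add: power2_eq_square algebra_simps)
    then have "exp (- (real n)\<^sup>2 / 2) \<le> exp (3/2) / exp (1 + real n)"
      by (simp flip: exp_diff)
    then have "1 / sqrt (2 * pi) * exp (- (real n)\<^sup>2 / 2) \<le> 1 * (exp (3/2) / exp (1 + real n))"
      by (intro mult_mono sq) auto
    then have "(1 + real n) ^ k * std_normal_density (real n) \<le> (1 + real n) ^ k * (exp (3/2) / exp (1 + real n))"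
      by (intro mult_left_mono) (auto simp: std_normal_density_def)
    then show "norm ((1 + real n) ^ k * std_normal_density (real n)) \<le>
      exp (3/2) * ((1 + real n) ^ k / exp (1 + real n))"
      by (simp add: abs_mult ac_simps)
  qed
qed

lemma std_normal_density_minus [simp]: "std_normal_density (- x) = std_normal_density x"
  by (simp add: std_normal_density_def)

lemma continuous_on_std_normal_density [continuous_intros]:
  "continuous_on A f \<Longrightarrow> continuous_on A (\<lambda>x. std_normal_density (f x))"
  unfolding std_normal_density_def by (intro continuous_intros) auto

lemma std_normal_density_deriv:
  "(std_normal_density has_real_derivative - x * std_normal_density x) (at x within S)"
  unfolding std_normal_density_def by (auto intro!: derivative_eq_intros simp: field_simps)

lemma integrable_poly_bound:
  fixes f :: "real \<Rightarrow> 'b::{banach,second_countable_topology}"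
  assumes "f \<in> borel_measurable borel" "\<And>x. norm (f x) \<le> K * (1 + \<bar>x\<bar>) ^ k"
  shows "integrable std_normal f"
proof (rule Bochner_Integration.integrable_bound[OF integrable_mult_right[OF integrable_std_normal_poly]])
  show "AE x in std_normal. norm (f x) \<le> norm (K * (1 + \<bar>x\<bar>) ^ k)"
    using assms(2) by (intro AE_I2) (smt (verit) norm_ge_zero real_norm_def)
qed (use assms in simp)

text \<open>Stein's identity: the derivative of the density is \<open>- x\<close> times the density,
  so the difference of the two integrands is the derivative of density times \<open>\<phi>\<close>.
  Its integral over [-n, n] is a boundary term, which polynomial growth sends to 0.\<close>

lemma std_normal_integration_by_parts:
  fixes \<phi> \<phi>' :: "real \<Rightarrow> 'b::euclidean_space"
  assumes deriv: "\<And>x. (\<phi> has_vector_derivative \<phi>' x) (at x)"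
    and cont: "continuous_on UNIV \<phi>'"
    and bd: "\<And>x. norm (\<phi> x) \<le> K * (1 + \<bar>x\<bar>) ^ k" and bd': "\<And>x. norm (\<phi>' x) \<le> K * (1 + \<bar>x\<bar>) ^ k"
  shows "(\<integral>x. x *\<^sub>R \<phi> x \<partial>std_normal) = (\<integral>x. \<phi>' x \<partial>std_normal)"
proof -
  let ?g = std_normal_density
  define f where "f x = ?g x *\<^sub>R \<phi>' x - ?g x *\<^sub>R (x *\<^sub>R \<phi> x)" for x
  define F where "F x = ?g x *\<^sub>R \<phi> x" for x
  have cont\<phi>: "continuous_on UNIV \<phi>"
    using deriv by (meson continuous_on_eq_continuous_within has_vector_derivative_continuous
        has_vector_derivative_at_within)
  have [measurable]: "\<phi> \<in> borel_measurable borel" "\<phi>' \<in> borel_measurable borel"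
    using cont\<phi> cont by (auto intro: borel_measurable_continuous_onI)
  have K: "0 \<le> K" using bd[of 0] by (smt (verit) norm_ge_zero abs_zero mult_cancel_left1 power_one)
  have "norm (x *\<^sub>R \<phi> x) \<le> K * (1 + \<bar>x\<bar>) ^ Suc k" for x
  proof -
    have "norm (x *\<^sub>R \<phi> x) \<le> (1 + \<bar>x\<bar>) * (K * (1 + \<bar>x\<bar>) ^ k)"
      using bd[of x] by (simp del: mult_minus1) (intro mult_mono, auto)
    then show ?thesis by (simp add: ac_simps)
  qed
  then have i1: "integrable std_normal (\<lambda>x. x *\<^sub>R \<phi> x)"
    by (rule integrable_poly_bound[rotated]) simp
  have i2: "integrable std_normal \<phi>'"
    by (rule integrable_poly_bound[OF _ bd']) simp
  have int: "integrable lborel f"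
    unfolding f_def using i1 i2 by (intro Bochner_Integration.integrable_diff) (simp_all add: integrable_std_normal)
  have "(F has_vector_derivative f x) (at x within S)" for x S
    unfolding F_def f_def
    by (rule has_vector_derivative_eq_rhs[OF has_vector_derivative_scaleR[OF std_normal_density_deriv
            has_vector_derivative_at_within[OF deriv]]]) (simp add: algebra_simps)
  then have FTC: "(\<integral>x. indicator {- real n .. real n} x *\<^sub>R f x \<partial>lborel) = F (real n) - F (- real n)" for n
    by (intro integral_FTC_Icc) (auto simp: f_def intro!: continuous_intros continuous_on_subset[OF cont] continuous_on_subset[OF cont\<phi>])
  have lim1: "(\<lambda>n. \<integral>x. indicator {- real n .. real n} x *\<^sub>R f x \<partial>lborel) \<longlonglongrightarrow> (\<integral>x. f x \<partial>lborel)"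
  proof (rule integral_dominated_convergence[where w="\<lambda>x. norm (f x)"])
    show "AE x in lborel. (\<lambda>n. indicator {- real n .. real n} x *\<^sub>R f x) \<longlonglongrightarrow> f x"
    proof (rule AE_I2)
      fix x :: real
      have "\<forall>\<^sub>F n in sequentially. indicator {- real n .. real n} x *\<^sub>R f x = f x"
        using eventually_ge_at_top[of "nat \<lceil>\<bar>x\<bar>\<rceil>"]
        by eventually_elim (auto simp: indicator_def nat_le_iff ceiling_le_iff abs_le_iff)
      then show "(\<lambda>n. indicator {- real n .. real n} x *\<^sub>R f x) \<longlonglongrightarrow> f x"
        by (rule tendsto_eventually)
    qed
    show "integrable lborel (\<lambda>x. norm (f x))" using int by (rule integrable_norm)
  qed (use borel_measurable_integrable[OF int] in \<open>auto simp: indicator_def\<close>)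
  have Fbd: "norm (F x) \<le> K * ((1 + \<bar>x\<bar>) ^ k * ?g x)" for x
    unfolding F_def using mult_right_mono[OF bd, of "?g x" x] by (simp add: ac_simps)
  have z: "(\<lambda>n. K * ((1 + real n) ^ k * ?g (real n))) \<longlonglongrightarrow> 0"
    using tendsto_mult_right_zero[OF poly_times_std_normal_density_tendsto_0] .
  have "(\<lambda>n. F (real n)) \<longlonglongrightarrow> 0" "(\<lambda>n. F (- real n)) \<longlonglongrightarrow> 0"
    by (rule Lim_null_comparison[OF _ z], use Fbd in \<open>auto intro!: always_eventually simp: abs_minus_cancel\<close>; metis Fbd abs_minus_cancel abs_of_nat std_normal_density_minus)+
  then have "(\<lambda>n. F (real n) - F (- real n)) \<longlonglongrightarrow> 0 - 0" by (rule tendsto_diff)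
  with lim1 have "(\<integral>x. f x \<partial>lborel) = 0"
    unfolding FTC by (metis LIMSEQ_unique diff_zero)
  then have "0 = (\<integral>x. ?g x *\<^sub>R \<phi>' x \<partial>lborel) - (\<integral>x. ?g x *\<^sub>R (x *\<^sub>R \<phi> x) \<partial>lborel)"
    unfolding f_def using i1 i2 by (subst (asm) Bochner_Integration.integral_diff) (simp_all add: integrable_std_normal)
  then show ?thesis by (simp add: integral_std_normal)
qed

abbreviation std_normals :: "('e::finite \<Rightarrow> real) measure" where
  "std_normals \<equiv> Pi\<^sub>M UNIV (\<lambda>_. std_normal)"

lemma measurable_std_normals_iff:
  fixes f :: "('e::finite \<Rightarrow> real) \<Rightarrow> 'b"
  shows "f \<in> measurable std_normals M \<longleftrightarrow> f \<in> measurable (Pi\<^sub>M UNIV (\<lambda>_. borel)) M"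
proof -
  have "measurable std_normals M = measurable (Pi\<^sub>M UNIV (\<lambda>_::'e. borel :: real measure)) M"
    by (intro measurable_cong_sets sets_PiM_cong) auto
  then show ?thesis by simp
qed

lemma prob_space_std_normals: "prob_space (std_normals :: ('e::finite \<Rightarrow> real) measure)"
  by (intro prob_space_PiM std_normal.prob_space_axioms)

lemma integrable_std_normals_poly:
  "integrable std_normals (\<lambda>x::'e::finite \<Rightarrow> real. \<Prod>e\<in>UNIV. (1 + \<bar>x e\<bar>) ^ k)"
  by (intro std_normal_prod.product_integrable_prod integrable_std_normal_poly) auto

lemma integrable_std_normals_poly_bound:
  fixes f :: "('e::finite \<Rightarrow> real) \<Rightarrow> 'b::{banach,second_countable_topology}"
  assumes "f \<in> borel_measurable (Pi\<^sub>M UNIV (\<lambda>_. borel))"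
    "\<And>x. norm (f x) \<le> K * (\<Prod>e\<in>UNIV. (1 + \<bar>x e\<bar>) ^ k)"
  shows "integrable std_normals f"
proof (rule Bochner_Integration.integrable_bound[OF integrable_mult_right[OF integrable_std_normals_poly]])
  show "AE x in std_normals. norm (f x) \<le> norm (K * (\<Prod>e\<in>UNIV. (1 + \<bar>x e\<bar>) ^ k))"
    using assms(2) by (intro AE_I2) (smt (verit) norm_ge_zero real_norm_def)
qed (use assms in \<open>simp add: measurable_std_normals_iff\<close>)

text \<open>Stein's identity in one coordinate, the others being frozen by Fubini. The scaling
  \<open>a\<close> is the position on the interpolation path: the chain rule contributes the factor
  \<open>a e\<close>, and since \<open>\<bar>a e\<bar> \<le> 1\<close> the growth bounds hold with
  the same constant at every point of the path.\<close>

lemma std_normals_integration_by_parts: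
  fixes g g' :: "('e::finite \<Rightarrow> real) \<Rightarrow> 'b::euclidean_space"
  assumes deriv: "\<And>x t. ((\<lambda>t. g (x(e := t))) has_vector_derivative g' (x(e := t))) (at t)"
    and cont: "\<And>x. continuous_on UNIV (\<lambda>t. g' (x(e := t)))"
    and meas[measurable]: "g \<in> borel_measurable (Pi\<^sub>M UNIV (\<lambda>_. borel))" "g' \<in> borel_measurable (Pi\<^sub>M UNIV (\<lambda>_. borel))"
    and bd: "\<And>x. norm (g x) \<le> K * (\<Prod>e\<in>UNIV. (1 + \<bar>x e\<bar>) ^ k)"
    and bd': "\<And>x. norm (g' x) \<le> K * (\<Prod>e\<in>UNIV. (1 + \<bar>x e\<bar>) ^ k)"
    and K: "0 \<le> K"
    and a: "\<And>e. \<bar>a e\<bar> \<le> 1"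
  shows "integrable std_normals (\<lambda>x. x e *\<^sub>R g (\<lambda>e. a e * x e))"
    and "(\<integral>x. x e *\<^sub>R g (\<lambda>e. a e * x e) \<partial>std_normals) = a e *\<^sub>R (\<integral>x. g' (\<lambda>e. a e * x e) \<partial>std_normals)"
proof -
  let ?I = "UNIV - {e}"
  define s where "s x = (\<lambda>e. a e * x e)" for x :: "'e \<Rightarrow> real"
  have [measurable]: "s \<in> measurable (Pi\<^sub>M UNIV (\<lambda>_. borel)) (Pi\<^sub>M UNIV (\<lambda>_. borel))"
    unfolding s_def by (rule measurable_PiM_single') auto
  have W: "(\<Prod>e\<in>UNIV. (1 + \<bar>s x e\<bar>) ^ j) \<le> (\<Prod>e\<in>UNIV. (1 + \<bar>x e\<bar>) ^ j)" for x j
  proof (intro prod_mono conjI power_mono add_left_mono)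
    fix e show "\<bar>s x e\<bar> \<le> \<bar>x e\<bar>"
      unfolding s_def abs_mult using mult_right_mono[OF a, of "\<bar>x e\<bar>" e] by simp
  qed auto
  have bd1: "norm (g (s x)) \<le> K * (\<Prod>e\<in>UNIV. (1 + \<bar>x e\<bar>) ^ k)" for x
    using bd[of "s x"] mult_left_mono[OF W[of x k] K] by linarith
  have bd2: "norm (g' (s x)) \<le> K * (\<Prod>e\<in>UNIV. (1 + \<bar>x e\<bar>) ^ k)" for x
    using bd'[of "s x"] mult_left_mono[OF W[of x k] K] by linarith
  have "norm (x e *\<^sub>R g (s x)) \<le> K * (\<Prod>e\<in>UNIV. (1 + \<bar>x e\<bar>) ^ Suc k)" for x
  proof -
    have "\<bar>x e\<bar> \<le> (\<Prod>e\<in>UNIV. (1 + \<bar>x e\<bar>))"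
    proof -
      have "1 * \<bar>x e\<bar> \<le> (\<Prod>e\<in>UNIV - {e}. (1 + \<bar>x e\<bar>)) * (1 + \<bar>x e\<bar>)"
        by (intro mult_mono prod_ge_1) (auto intro!: prod_nonneg)
      then show ?thesis by (simp add: prod.remove[of UNIV e] mult.commute)
    qed
    then have "\<bar>x e\<bar> * norm (g (s x)) \<le> (\<Prod>e\<in>UNIV. (1 + \<bar>x e\<bar>)) * (K * (\<Prod>e\<in>UNIV. (1 + \<bar>x e\<bar>) ^ k))"
      by (intro mult_mono bd1) (auto intro!: prod_nonneg)
    then show ?thesis by (simp add: prod.distrib ac_simps)
  qed
  then have int1: "integrable std_normals (\<lambda>x. x e *\<^sub>R g (s x))"
    by (rule integrable_std_normals_poly_bound[rotated]) simp
  then show "integrable std_normals (\<lambda>x. x e *\<^sub>R g (\<lambda>e. a e * x e))" by (simp add: s_def)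
  have int2: "integrable std_normals (\<lambda>x. g' (s x))"
    by (rule integrable_std_normals_poly_bound[OF _ bd2]) simp
  have U: "UNIV = insert e ?I" by auto
  have "(\<integral>x. x e *\<^sub>R g (s x) \<partial>std_normals) =
      (\<integral>x. (\<integral>y. (x(e:=y)) e *\<^sub>R g (s (x(e:=y))) \<partial>std_normal) \<partial>Pi\<^sub>M ?I (\<lambda>_. std_normal))"
    using std_normal_prod.product_integral_insert[of ?I e "\<lambda>x. x e *\<^sub>R g (s x)"] int1 by (simp flip: U)
  also have "\<dots> = (\<integral>x. (\<integral>y. a e *\<^sub>R g' (s (x(e:=y))) \<partial>std_normal) \<partial>Pi\<^sub>M ?I (\<lambda>_. std_normal))"
  proof (rule Bochner_Integration.integral_cong[OF refl])
    fix x :: "'e \<Rightarrow> real"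
    have sx: "s (x(e:=y)) = (s x)(e := a e * y)" for y by (auto simp: s_def)
    \<comment> \<open>With the other coordinates frozen, the product weight is a constant times the
      one-dimensional weight.\<close>
    define C where "C = (\<Prod>e\<in>UNIV - {e}. (1 + \<bar>x e\<bar>) ^ k)"
    have C: "(\<Prod>e'\<in>UNIV. (1 + \<bar>(x(e := y)) e'\<bar>) ^ k) = C * (1 + \<bar>y\<bar>) ^ k" for y
    proof -
      have "(\<Prod>e'\<in>UNIV - {e}. (1 + \<bar>(x(e := y)) e'\<bar>) ^ k) = C"
        unfolding C_def by (rule prod.cong) auto
      then show ?thesis by (simp add: prod.remove[of UNIV e])
    qed
    have "(\<integral>y. y *\<^sub>R g (s (x(e:=y))) \<partial>std_normal) = (\<integral>y. a e *\<^sub>R g' (s (x(e:=y))) \<partial>std_normal)"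
    proof (rule std_normal_integration_by_parts[where K="K * C" and k=k])
      fix y
      have "((\<lambda>t. a e * t) has_vector_derivative a e) (at y)"
        by (auto intro!: derivative_eq_intros simp flip: has_real_derivative_iff_has_vector_derivative)
      from vector_diff_chain_at[OF this deriv[where x="s x"]]
      show "((\<lambda>y. g (s (x(e:=y)))) has_vector_derivative a e *\<^sub>R g' (s (x(e:=y)))) (at y)"
        by (simp add: sx o_def)
      show "norm (g (s (x(e:=y)))) \<le> K * C * (1 + \<bar>y\<bar>) ^ k"
        using bd1[of "x(e:=y)"] unfolding C by (simp add: mult.assoc)
      have "norm (a e *\<^sub>R g' (s (x(e:=y)))) \<le> 1 * norm (g' (s (x(e:=y))))"
        unfolding norm_scaleR by (intro mult_right_mono a) auto
      also have "\<dots> \<le> K * C * (1 + \<bar>y\<bar>) ^ k"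
        using bd2[of "x(e:=y)"] unfolding C by (simp add: mult.assoc)
      finally show "norm (a e *\<^sub>R g' (s (x(e:=y)))) \<le> K * C * (1 + \<bar>y\<bar>) ^ k" .
    next
      show "continuous_on UNIV (\<lambda>y. a e *\<^sub>R g' (s (x(e:=y))))"
        unfolding sx by (intro continuous_intros continuous_on_compose2[OF cont[of "s x"]]) auto
    qed
    then show "(\<integral>y. (x(e:=y)) e *\<^sub>R g (s (x(e:=y))) \<partial>std_normal) = (\<integral>y. a e *\<^sub>R g' (s (x(e:=y))) \<partial>std_normal)"
      by simp
  qed
  also have "\<dots> = (\<integral>x. a e *\<^sub>R g' (s x) \<partial>std_normals)"
    using std_normal_prod.product_integral_insert[of ?I e "\<lambda>x. g' (s x)"] int2 by (simp flip: U)
  finally show "(\<integral>x. x e *\<^sub>R g (\<lambda>e. a e * x e) \<partial>std_normals) = a e *\<^sub>R (\<integral>x. g' (\<lambda>e. a e * x e) \<partial>std_normals)"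
    by (simp add: s_def)
qed

text \<open>The coordinates in \<open>A\<close> are scaled by the cosine, the others by the sine.
  Differentiating the expectation and integrating by parts produces second derivatives with the
  weights \<open>a' \<theta> e * a \<theta> e\<close>, and \<open>pde\<close> makes their sum
  vanish. The ends \<theta> = 0 and \<theta> = pi/2 keep only the coordinates inside and outside
  \<open>A\<close>. Differentiability is assumed along coordinatewise differentiable curves, which
  avoids a norm on the function space.\<close>

lemma gaussian_interpolation:
  fixes G :: "('e::finite \<Rightarrow> real) \<Rightarrow> 'b::euclidean_space" and G1 G2 :: "'e \<Rightarrow> ('e \<Rightarrow> real) \<Rightarrow> 'b"
  assumes deriv: "\<And>c c' t. (\<And>e. ((\<lambda>t. c t e) has_real_derivative c' e) (at t)) \<Longrightarrow>
        ((\<lambda>t. G (c t)) has_vector_derivative (\<Sum>e\<in>UNIV. c' e *\<^sub>R G1 e (c t))) (at t)"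
    and deriv2: "\<And>e x t. ((\<lambda>t. G1 e (x(e := t))) has_vector_derivative G2 e (x(e := t))) (at t)"
    and cont1: "\<And>e c. (\<And>e. continuous_on UNIV (\<lambda>t::real. c t e)) \<Longrightarrow> continuous_on UNIV (\<lambda>t. G1 e (c t))"
    and cont2: "\<And>e x. continuous_on UNIV (\<lambda>t. G2 e (x(e := t)))"
    and meas[measurable]: "G \<in> borel_measurable (Pi\<^sub>M UNIV (\<lambda>_. borel))"
      "\<And>e. G1 e \<in> borel_measurable (Pi\<^sub>M UNIV (\<lambda>_. borel))"
      "\<And>e. G2 e \<in> borel_measurable (Pi\<^sub>M UNIV (\<lambda>_. borel))"
    and bd: "\<And>x. norm (G x) \<le> K * (\<Prod>e\<in>UNIV. (1 + \<bar>x e\<bar>) ^ k)"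
    and bd1: "\<And>e x. norm (G1 e x) \<le> K * (\<Prod>e\<in>UNIV. (1 + \<bar>x e\<bar>) ^ k)"
    and bd2: "\<And>e x. norm (G2 e x) \<le> K * (\<Prod>e\<in>UNIV. (1 + \<bar>x e\<bar>) ^ k)"
    and pde: "\<And>x. (\<Sum>e\<in>A. G2 e x) = (\<Sum>e\<in>- A. G2 e x)"
  shows "(\<integral>x. G (\<lambda>e. if e \<in> A then x e else 0) \<partial>std_normals) =
    (\<integral>x. G (\<lambda>e. if e \<in> A then 0 else x e) \<partial>std_normals)"
proof -
  define a where "a \<theta> e = (if e \<in> A then cos \<theta> else sin \<theta>)" for \<theta> :: real and e
  define a' where "a' \<theta> e = (if e \<in> A then - sin \<theta> else cos \<theta>)" for \<theta> :: real and e
  define D where "D x \<theta> = (\<Sum>e\<in>UNIV. (a' \<theta> e * x e) *\<^sub>R G1 e (\<lambda>e. a \<theta> e * x e))" for x :: "'e \<Rightarrow> real" and \<theta> :: real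
  define J :: "real set" where "J = {0..pi/2}"
  interpret SN: prob_space "std_normals :: ('e \<Rightarrow> real) measure" by (rule prob_space_std_normals)
  interpret PS: pair_sigma_finite "std_normals :: ('e \<Rightarrow> real) measure" "lborel :: real measure"
    by unfold_locales
  have K: "0 \<le> K"
  proof -
    have "0 \<le> norm (G (\<lambda>_. 0))" by simp
    also have "\<dots> \<le> K" using bd[of "\<lambda>_. 0"] by simp
    finally show ?thesis .
  qed
  have a1: "\<bar>a \<theta> e\<bar> \<le> 1" and a'1: "\<bar>a' \<theta> e\<bar> \<le> 1" for \<theta> e
    by (auto simp: a_def a'_def)
  have ibp: "integrable std_normals (\<lambda>x. x e *\<^sub>R G1 e (\<lambda>e. a \<theta> e * x e))"
    "(\<integral>x. x e *\<^sub>R G1 e (\<lambda>e. a \<theta> e * x e) \<partial>std_normals) = a \<theta> e *\<^sub>R (\<integral>x. G2 e (\<lambda>e. a \<theta> e * x e) \<partial>std_normals)" for \<theta> e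
    by (rule std_normals_integration_by_parts[OF deriv2 cont2 meas(2,3) bd1 bd2 K a1])+
  have inner: "(\<integral>x. D x \<theta> \<partial>std_normals) = 0" for \<theta>
  proof -
    have sumE: "(\<Sum>e\<in>B. (\<integral>x. G2 e (\<lambda>e. a \<theta> e * x e) \<partial>std_normals)) = (\<integral>x. (\<Sum>e\<in>B. G2 e (\<lambda>e. a \<theta> e * x e)) \<partial>std_normals)" for B
    proof (rule Bochner_Integration.integral_sum[symmetric])
      fix e
      have W: "(\<Prod>e\<in>UNIV. (1 + \<bar>a \<theta> e * x e\<bar>) ^ k) \<le> (\<Prod>e\<in>UNIV. (1 + \<bar>x e\<bar>) ^ k)" for x :: "'e \<Rightarrow> real"
        by (intro prod_mono conjI power_mono add_left_mono) (auto simp: abs_mult mult_left_le_one_le a1)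
      show "integrable std_normals (\<lambda>x. G2 e (\<lambda>e. a \<theta> e * x e))"
      proof (rule integrable_std_normals_poly_bound)
        show "(\<lambda>x. G2 e (\<lambda>e. a \<theta> e * x e)) \<in> borel_measurable (Pi\<^sub>M UNIV (\<lambda>_. borel))"
          by (rule measurable_compose[OF _ meas(3)]) (rule measurable_PiM_single', auto)
        show "norm (G2 e (\<lambda>e. a \<theta> e * x e)) \<le> K * (\<Prod>e\<in>UNIV. (1 + \<bar>x e\<bar>) ^ k)" for x
          using bd2[of e "\<lambda>e. a \<theta> e * x e"] mult_left_mono[OF W K] by (rule order_trans)
      qed
    qed
    have "(\<integral>x. D x \<theta> \<partial>std_normals) = (\<Sum>e\<in>UNIV. a' \<theta> e *\<^sub>R (\<integral>x. x e *\<^sub>R G1 e (\<lambda>e. a \<theta> e * x e) \<partial>std_normals))"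
      unfolding D_def scaleR_scaleR[symmetric]
      by (subst Bochner_Integration.integral_sum) (use ibp(1) in \<open>auto simp del: scaleR_scaleR\<close>)
    also have "\<dots> = (\<Sum>e\<in>UNIV. (a' \<theta> e * a \<theta> e) *\<^sub>R (\<integral>x. G2 e (\<lambda>e. a \<theta> e * x e) \<partial>std_normals))"
      unfolding ibp(2) by simp
    \<comment> \<open>\<open>a' \<theta> e * a \<theta> e\<close> is minus sine times cosine on
      \<open>A\<close> and plus sine times cosine off \<open>A\<close>.\<close>
    also have "\<dots> = (sin \<theta> * cos \<theta>) *\<^sub>R ((\<Sum>e\<in>- A. (\<integral>x. G2 e (\<lambda>e. a \<theta> e * x e) \<partial>std_normals)) -
        (\<Sum>e\<in>A. (\<integral>x. G2 e (\<lambda>e. a \<theta> e * x e) \<partial>std_normals)))"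
    proof -
      have split: "sum h UNIV = sum h A + sum h (- A)" for h :: "'e \<Rightarrow> 'b"
        using sum.union_disjoint[of A "- A" h] by (simp add: Compl_partition)
      show ?thesis
        unfolding split by (simp add: a_def a'_def scaleR_diff_right scaleR_sum_right sum_negf mult.commute)
    qed
    also have "\<dots> = 0" by (simp only: sumE pde) simp
    finally show ?thesis .
  qed
  have Dmeas: "case_prod D \<in> borel_measurable (std_normals \<Otimes>\<^sub>M lborel)"
  proof -
    have m: "(\<lambda>p. (\<lambda>e. a (snd p) e * fst p e)) \<in> measurable (std_normals \<Otimes>\<^sub>M lborel) (Pi\<^sub>M UNIV (\<lambda>_. borel))"
    proof (rule measurable_PiM_single')
      fix e :: 'e
      have [measurable]: "(\<lambda>p. fst p e) \<in> borel_measurable ((std_normals :: ('e \<Rightarrow> real) measure) \<Otimes>\<^sub>M lborel)"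
        by (rule measurable_compose[OF measurable_fst]) (simp add: measurable_std_normals_iff)
      show "(\<lambda>p. a (snd p) e * fst p e) \<in> borel_measurable (std_normals \<Otimes>\<^sub>M lborel)"
        unfolding a_def by (cases "e \<in> A") auto
    qed auto
    have m2: "(\<lambda>p. a' (snd p) e * fst p e) \<in> borel_measurable (std_normals \<Otimes>\<^sub>M lborel)" for e
    proof -
      have [measurable]: "(\<lambda>p. fst p e) \<in> borel_measurable ((std_normals :: ('e \<Rightarrow> real) measure) \<Otimes>\<^sub>M lborel)"
        by (rule measurable_compose[OF measurable_fst]) (simp add: measurable_std_normals_iff)
      show ?thesis unfolding a'_def by (cases "e \<in> A") auto
    qed
    show ?thesis unfolding D_def case_prod_unfold
      by (intro borel_measurable_sum borel_measurable_scaleR m2 measurable_compose[OF m meas(2)])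
  qed
  \<comment> \<open>A majorant of \<open>D\<close> that does not depend on \<theta>. The extra power
    absorbs the factor \<open>x e\<close>; integrability of \<open>W\<close> permits the exchange of
    the two integrals.\<close>
  define W where "W x = real CARD('e) * (K * (\<Prod>e\<in>UNIV. (1 + \<bar>x e\<bar>) ^ Suc k))" for x :: "'e \<Rightarrow> real"
  have DW: "norm (D x \<theta>) \<le> W x" for x \<theta>
  proof -
    have le: "norm ((a' \<theta> e * x e) *\<^sub>R G1 e (\<lambda>e. a \<theta> e * x e)) \<le> K * (\<Prod>e\<in>UNIV. (1 + \<bar>x e\<bar>) ^ Suc k)" for e
    proof -
      have 1: "\<bar>a' \<theta> e * x e\<bar> \<le> (\<Prod>e\<in>UNIV. (1 + \<bar>x e\<bar>))"
      proof -
        have "1 * \<bar>a' \<theta> e * x e\<bar> \<le> (\<Prod>e\<in>UNIV - {e}. (1 + \<bar>x e\<bar>)) * (1 + \<bar>x e\<bar>)"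
        proof (intro mult_mono prod_ge_1)
          show "\<bar>a' \<theta> e * x e\<bar> \<le> 1 + \<bar>x e\<bar>"
            using mult_right_mono[OF a'1[of \<theta> e], of "\<bar>x e\<bar>"] by (simp add: abs_mult)
        qed (auto intro!: prod_nonneg)
        then show ?thesis by (simp add: prod.remove[of UNIV e] mult.commute)
      qed
      have "(\<Prod>e\<in>UNIV. (1 + \<bar>a \<theta> e * x e\<bar>) ^ k) \<le> (\<Prod>e\<in>UNIV. (1 + \<bar>x e\<bar>) ^ k)"
        by (intro prod_mono conjI power_mono add_left_mono) (auto simp: abs_mult mult_left_le_one_le a1)
      then have 2: "norm (G1 e (\<lambda>e. a \<theta> e * x e)) \<le> K * (\<Prod>e\<in>UNIV. (1 + \<bar>x e\<bar>) ^ k)"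
        using bd1[of e "\<lambda>e. a \<theta> e * x e"] mult_left_mono[OF _ K] by (meson order_trans)
      have "\<bar>a' \<theta> e * x e\<bar> * norm (G1 e (\<lambda>e. a \<theta> e * x e)) \<le> (\<Prod>e\<in>UNIV. (1 + \<bar>x e\<bar>)) * (K * (\<Prod>e\<in>UNIV. (1 + \<bar>x e\<bar>) ^ k))"
        by (intro mult_mono 1 2) (auto intro!: prod_nonneg)
      then show ?thesis by (simp add: prod.distrib ac_simps)
    qed
    have "norm (D x \<theta>) \<le> (\<Sum>e\<in>(UNIV::'e set). K * (\<Prod>e\<in>UNIV. (1 + \<bar>x e\<bar>) ^ Suc k))"
      unfolding D_def by (rule order_trans[OF norm_sum sum_mono[OF le]])
    then show ?thesis by (simp add: W_def)
  qed
  have intW: "integrable std_normals W"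
    unfolding W_def by (intro integrable_mult_right integrable_std_normals_poly)
  define F where "F x \<theta> = indicator J \<theta> *\<^sub>R D x \<theta>" for x \<theta>
  have intF: "integrable (std_normals \<Otimes>\<^sub>M lborel) (case_prod F)"
  proof (rule Bochner_Integration.integrable_bound)
    show "integrable (std_normals \<Otimes>\<^sub>M lborel) (\<lambda>(x, \<theta>). W x * indicator J \<theta>)"
    proof (rule PS.Fubini_integrable)
      show "(\<lambda>(x, \<theta>). W x * indicator J \<theta>) \<in> borel_measurable (std_normals \<Otimes>\<^sub>M lborel)"
        unfolding case_prod_unfold using borel_measurable_integrable[OF intW]
        by (intro borel_measurable_times measurable_compose[OF measurable_fst] measurable_compose[OF measurable_snd] borel_measurable_indicator) (auto simp: J_def)
      show "integrable std_normals (\<lambda>x. \<integral>y. norm (case (x, y) of (x, \<theta>) \<Rightarrow> W x * indicator J \<theta>) \<partial>lborel)"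
        using intW by (simp add: abs_mult J_def)
      show "AE x in std_normals. integrable lborel (\<lambda>y. case (x, y) of (x, \<theta>) \<Rightarrow> W x * indicator J \<theta>)"
        by (intro AE_I2) (auto simp: J_def)
    qed
    show "case_prod F \<in> borel_measurable (std_normals \<Otimes>\<^sub>M lborel)"
      unfolding F_def using Dmeas unfolding case_prod_unfold
      by (intro borel_measurable_scaleR measurable_compose[OF measurable_snd] borel_measurable_indicator) (auto simp: J_def)
    show "AE p in std_normals \<Otimes>\<^sub>M lborel. norm (case_prod F p) \<le> norm (case p of (x, \<theta>) \<Rightarrow> W x * indicator J \<theta>)"
      using DW by (intro AE_I2) (auto simp: F_def indicator_def intro: order_trans[OF _ abs_ge_self])
  qed
  have FTC: "(\<integral>\<theta>. F x \<theta> \<partial>lborel) = G (\<lambda>e. a (pi/2) e * x e) - G (\<lambda>e. a 0 e * x e)" for x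
    unfolding F_def J_def
  proof (rule integral_FTC_Icc)
    fix \<theta>
    have "((\<lambda>\<theta>. a \<theta> e * x e) has_real_derivative a' \<theta> e * x e) (at \<theta>)" for e
      unfolding a_def a'_def by (cases "e \<in> A") (auto intro!: derivative_eq_intros)
    from deriv[of "\<lambda>\<theta> e. a \<theta> e * x e", OF this]
    show "((\<lambda>\<theta>. G (\<lambda>e. a \<theta> e * x e)) has_vector_derivative D x \<theta>) (at \<theta> within {0..pi/2})"
      unfolding D_def by (rule has_vector_derivative_at_within)
  next
    have "continuous_on UNIV (\<lambda>\<theta>. a \<theta> e * x e)" "continuous_on UNIV (\<lambda>\<theta>. a' \<theta> e * x e)" for e
      unfolding a_def a'_def by (cases "e \<in> A"; auto intro!: continuous_intros)+
    then have "continuous_on UNIV (D x)"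
      unfolding D_def by (intro continuous_on_sum continuous_on_scaleR cont1)
    then show "continuous_on {0..pi/2} (D x)" by (rule continuous_on_subset) auto
  qed simp
  have intG: "integrable std_normals (\<lambda>x. G (\<lambda>e. a \<theta> e * x e))" for \<theta>
  proof (rule integrable_std_normals_poly_bound)
    show "(\<lambda>x. G (\<lambda>e. a \<theta> e * x e)) \<in> borel_measurable (Pi\<^sub>M UNIV (\<lambda>_. borel))"
      by (rule measurable_compose[OF _ meas(1)]) (rule measurable_PiM_single', auto)
    fix x :: "'e \<Rightarrow> real"
    have "(\<Prod>e\<in>UNIV. (1 + \<bar>a \<theta> e * x e\<bar>) ^ k) \<le> (\<Prod>e\<in>UNIV. (1 + \<bar>x e\<bar>) ^ k)"
      by (intro prod_mono conjI power_mono add_left_mono) (auto simp: abs_mult mult_left_le_one_le a1)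
    then show "norm (G (\<lambda>e. a \<theta> e * x e)) \<le> K * (\<Prod>e\<in>UNIV. (1 + \<bar>x e\<bar>) ^ k)"
      using bd[of "\<lambda>e. a \<theta> e * x e"] mult_left_mono[OF _ K] by (meson order_trans)
  qed
  have "(\<integral>x. G (\<lambda>e. a (pi/2) e * x e) \<partial>std_normals) - (\<integral>x. G (\<lambda>e. a 0 e * x e) \<partial>std_normals) =
      (\<integral>x. (\<integral>\<theta>. F x \<theta> \<partial>lborel) \<partial>std_normals)"
    unfolding FTC by (rule Bochner_Integration.integral_diff[OF intG intG, symmetric])
  also have "\<dots> = (\<integral>\<theta>. (\<integral>x. F x \<theta> \<partial>std_normals) \<partial>lborel)"
    by (rule PS.Fubini_integral[OF intF, symmetric])
  also have "\<dots> = 0" by (simp add: F_def inner)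
  finally have "(\<integral>x. G (\<lambda>e. a (pi/2) e * x e) \<partial>std_normals) = (\<integral>x. G (\<lambda>e. a 0 e * x e) \<partial>std_normals)" by simp
  moreover have "(\<lambda>e. a (pi/2) e * x e) = (\<lambda>e. if e \<in> A then 0 else x e)"
    "(\<lambda>e. a 0 e * x e) = (\<lambda>e. if e \<in> A then x e else 0)" for x :: "'e \<Rightarrow> real"
    by (auto simp: a_def)
  ultimately show ?thesis by simp
qed

subsection \<open>The duality between the matrix and its spectral parameters\<close>

text \<open>Exhibits resolvent entries as quotients of determinants, from which their continuity and
  measurability are read off.\<close>

lemma matrix_inv_cramer:
  fixes A :: "'a::field^'n^'n"
  assumes "det A \<noteq> 0"
  shows "matrix_inv A $ i $ j = det (\<chi> a b. if b = i then (if a = j then 1 else 0) else A $ a $ b) / det A"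
proof -
  have "A *v (matrix_inv A *v axis j 1) = axis j 1"
    by (simp add: matrix_vector_mul_assoc matrix_inv_det_nonzero(1)[OF assms])
  then have "matrix_inv A *v axis j 1 = (\<chi> k. det (\<chi> a b. if b = k then axis j 1 $ a else A $ a $ b) / det A)"
    using cramer[OF assms] by blast
  then have "(matrix_inv A *v axis j 1) $ i = det (\<chi> a b. if b = i then axis j 1 $ a else A $ a $ b) / det A"
    by simp
  moreover have "(matrix_inv A *v axis j 1) $ i = matrix_inv A $ i $ j"
    by (simp add: matrix_vector_mult_def axis_def if_distrib cong: if_cong)
  ultimately have "matrix_inv A $ i $ j = det (\<chi> a b. if b = i then axis j 1 $ a else A $ a $ b) / det A"
    by simp
  then show ?thesis by (simp only: axis_def vec_lambda_beta)
qed

lemma matrix_diff_ldistrib: "A ** (B - C) = A ** B - A ** (C :: 'a::ring_1^'n^'m)"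
  by (simp add: vec_eq_iff matrix_matrix_mult_def right_diff_distrib sum_subtractf)

lemma matrix_diff_rdistrib: "(A - B) ** C = A ** C - B ** (C :: 'a::ring_1^'n^'m)"
  by (simp add: vec_eq_iff matrix_matrix_mult_def left_diff_distrib sum_subtractf)

text \<open>The resolvent identity. It serves twice: for two values of the matrix (derivative of the
  resolvent) and for two poles (traces of products of resolvents).\<close>

lemma matrix_inv_diff:
  fixes A B :: "'a::field^'n^'n"
  assumes "det A \<noteq> 0" "det B \<noteq> 0"
  shows "matrix_inv A - matrix_inv B = matrix_inv A ** (B - A) ** matrix_inv B"
proof -
  have "matrix_inv A ** (B - A) ** matrix_inv B =
      matrix_inv A ** (B ** matrix_inv B) - (matrix_inv A ** A) ** matrix_inv B"
    by (simp only: matrix_diff_ldistrib matrix_diff_rdistrib matrix_mul_assoc)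
  then show ?thesis by (simp add: matrix_inv_det_nonzero assms)
qed

text \<open>Multilinearity writes the derivative as a sum of determinants with one row replaced by
  the row of \<open>A'\<close>. Since \<open>A' = C ** A t\<close>, that row is a combination of the
  rows of \<open>A t\<close>, and only its diagonal coefficient \<open>C $ i $ i\<close>
  survives.\<close>

lemma jacobi_formula:
  fixes A :: "real \<Rightarrow> complex^'n^'n" and A' :: "complex^'n^'n"
  assumes d: "\<And>i j. ((\<lambda>t. A t $ i $ j) has_vector_derivative A' $ i $ j) (at t)"
    and nz: "det (A t) \<noteq> 0"
  shows "((\<lambda>t. det (A t)) has_vector_derivative trace (matrix_inv (A t) ** A') * det (A t)) (at t)"
proof -
  define C where "C = A' ** matrix_inv (A t)"
  have CA: "C ** A t = A'"
    by (simp add: C_def matrix_inv_det_nonzero(2)[OF nz] flip: matrix_mul_assoc)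
  have row: "(\<Sum>k\<in>UNIV. (C $ i) $ k *s row k (A t)) = A' $ i" for i
    by (subst CA[symmetric]) (simp add: matrix_matrix_mult_def vec_eq_iff row_def)
  have "(det \<circ> A has_derivative (\<lambda>h. \<Sum>p\<in>{p. p permutes UNIV}. of_int (sign p) *
      (\<Sum>i\<in>UNIV. (h *\<^sub>R A' $ i $ p i) * (\<Prod>j\<in>UNIV - {i}. A t $ j $ p j)))) (at t)"
    unfolding det_def o_def
    by (intro has_derivative_sum has_derivative_mult_right has_derivative_prod)
       (use d in \<open>simp add: has_vector_derivative_def\<close>)
  also have "(\<lambda>h. \<Sum>p\<in>{p. p permutes UNIV}. of_int (sign p) *
      (\<Sum>i\<in>UNIV. (h *\<^sub>R A' $ i $ p i) * (\<Prod>j\<in>UNIV - {i}. A t $ j $ p j))) =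
      (\<lambda>h. h *\<^sub>R (\<Sum>i\<in>UNIV. det (\<chi> j. if j = i then A' $ i else A t $ j)))"
  proof
    fix h :: real
    have pr: "(\<Prod>j\<in>UNIV. (if j = i then A' $ i else A t $ j) $ p j) =
        A' $ i $ p i * (\<Prod>j\<in>UNIV - {i}. A t $ j $ p j)" for i p
      by (subst prod.remove[of UNIV i]) (auto intro!: prod.cong)
    have "(\<Sum>p\<in>{p. p permutes (UNIV::'n set)}. of_int (sign p) *
      (\<Sum>i\<in>UNIV. (h *\<^sub>R A' $ i $ p i) * (\<Prod>j\<in>UNIV - {i}. A t $ j $ p j))) =
      (\<Sum>p\<in>{p. p permutes UNIV}. \<Sum>i\<in>UNIV. h *\<^sub>R (of_int (sign p) * (A' $ i $ p i * (\<Prod>j\<in>UNIV - {i}. A t $ j $ p j))))"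
      by (simp add: sum_distrib_left)
    also have "\<dots> = h *\<^sub>R (\<Sum>i\<in>UNIV. det (\<chi> j. if j = i then A' $ i else A t $ j))"
      by (subst sum.swap) (simp add: det_def pr scaleR_sum_right)
    finally show "(\<Sum>p\<in>{p. p permutes (UNIV::'n set)}. of_int (sign p) *
      (\<Sum>i\<in>UNIV. (h *\<^sub>R A' $ i $ p i) * (\<Prod>j\<in>UNIV - {i}. A t $ j $ p j))) =
      h *\<^sub>R (\<Sum>i\<in>UNIV. det (\<chi> j. if j = i then A' $ i else A t $ j))" .
  qed
  also have "(\<Sum>i\<in>UNIV. det (\<chi> j. if j = i then A' $ i else A t $ j)) = (\<Sum>i\<in>UNIV. (C $ i) $ i * det (A t))"
  proof (rule sum.cong[OF refl])
    fix i
    have "(\<chi> j. if j = i then A' $ i else A t $ j) =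
        (\<chi> j. if j = i then (\<Sum>k\<in>UNIV. (C $ i) $ k *s row k (A t)) else row j (A t))"
      by (simp only: row) (simp add: vec_eq_iff row_def)
    then show "det (\<chi> j. if j = i then A' $ i else A t $ j) = (C $ i) $ i * det (A t)"
      by (simp only: cramer_lemma_transpose)
  qed
  also have "\<dots> = trace (matrix_inv (A t) ** A') * det (A t)"
    by (subst trace_mul_sym) (simp add: trace_def C_def sum_distrib_right)
  finally show ?thesis by (simp add: has_vector_derivative_def o_def)
qed

text \<open>The product rule in logarithmic form: each derivative is given as a multiple
  \<open>g i\<close> of the factor itself, so the multiples just add up.\<close>

lemma has_vector_derivative_prod_log:
  fixes f :: "'i \<Rightarrow> real \<Rightarrow> 'a::real_normed_field"
  assumes "finite I" "\<And>i. i \<in> I \<Longrightarrow> (f i has_vector_derivative g i * f i t) (at t)"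
  shows "((\<lambda>t. \<Prod>i\<in>I. f i t) has_vector_derivative (\<Sum>i\<in>I. g i) * (\<Prod>i\<in>I. f i t)) (at t)"
  using assms
proof (induction I)
  case (insert i I)
  then have "((\<lambda>t. f i t * (\<Prod>i\<in>I. f i t)) has_vector_derivative
      f i t * ((\<Sum>i\<in>I. g i) * (\<Prod>i\<in>I. f i t)) + (g i * f i t) * (\<Prod>i\<in>I. f i t)) (at t)"
    by (intro has_vector_derivative_mult) auto
  with insert show ?case by (simp add: algebra_simps)
qed simp

text \<open>Independent standard normal coordinates give a GUE matrix: above the diagonal,
  \<open>x (i, j)\<close> and \<open>x (j, i)\<close> are the rescaled real and imaginary parts of
  one entry. The factor \<open>1 / sqrt 2\<close> makes the coordinate directions an orthonormal
  basis for the trace form.\<close>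

definition hermitian_of :: "('n \<times> 'n \<Rightarrow> real) \<Rightarrow> complex^('n::{finite,linorder})^('n::{finite,linorder})" where
  "hermitian_of x = (\<chi> i j. if i = j then complex_of_real (x (i, i))
     else if i < j then Complex (x (i, j)) (x (j, i)) / sqrt 2
     else Complex (x (j, i)) (- x (i, j)) / sqrt 2)"

lemma hermitian_of_nth:
  "hermitian_of x $ i $ i = complex_of_real (x (i, i))"
  "i < j \<Longrightarrow> hermitian_of x $ i $ j = Complex (x (i, j)) (x (j, i)) / sqrt 2"
  "i < j \<Longrightarrow> hermitian_of x $ j $ i = Complex (x (i, j)) (- x (j, i)) / sqrt 2"
proof -
  show "hermitian_of x $ i $ i = complex_of_real (x (i, i))" by (simp add: hermitian_of_def)
next
  assume "i < j"
  then have "i \<noteq> j" "\<not> j < i" by simp_all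
  with \<open>i < j\<close> show "hermitian_of x $ i $ j = Complex (x (i, j)) (x (j, i)) / sqrt 2"
    by (simp add: hermitian_of_def)
next
  assume "i < j"
  then have "j \<noteq> i" "\<not> j < i" by simp_all
  then show "hermitian_of x $ j $ i = Complex (x (i, j)) (- x (j, i)) / sqrt 2"
    by (simp add: hermitian_of_def)
qed

lemma hermitian_hermitian_of: "hermitian (hermitian_of x)"
  unfolding hermitian_def
proof (intro allI)
  fix i j
  show "hermitian_of x $ i $ j = cnj (hermitian_of x $ j $ i)"
    by (cases i j rule: linorder_cases) (simp_all add: hermitian_of_nth complex_eq_iff)
qed

definition basis_hermitian :: "'n \<times> 'n \<Rightarrow> complex^('n::{finite,linorder})^('n::{finite,linorder})" where
  "basis_hermitian p = hermitian_of (\<lambda>q. if q = p then 1 else 0)"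

lemma hermitian_of_add: "hermitian_of (\<lambda>p. x p + y p) = hermitian_of x + hermitian_of y"
  unfolding vec_eq_iff
proof (intro allI)
  fix i j
  show "hermitian_of (\<lambda>p. x p + y p) $ i $ j = (hermitian_of x + hermitian_of y) $ i $ j"
    by (cases i j rule: linorder_cases) (simp_all add: hermitian_of_nth complex_eq_iff add_divide_distrib diff_divide_distrib)
qed

lemma hermitian_of_scaleR: "hermitian_of (\<lambda>p. c * x p) = c *\<^sub>R hermitian_of x"
  unfolding vec_eq_iff
proof (intro allI)
  fix i j
  show "hermitian_of (\<lambda>p. c * x p) $ i $ j = (c *\<^sub>R hermitian_of x) $ i $ j"
    by (cases i j rule: linorder_cases) (simp_all add: hermitian_of_nth complex_eq_iff)
qed

lemma basis_hermitian_nth: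
  "basis_hermitian (i, i) $ a $ b = (if a = i \<and> b = i then 1 else 0)"
  "i < j \<Longrightarrow> basis_hermitian (i, j) $ a $ b =
    (if a = i \<and> b = j \<or> a = j \<and> b = i then complex_of_real (1 / sqrt 2) else 0)"
  "i < j \<Longrightarrow> basis_hermitian (j, i) $ a $ b =
    (if a = i \<and> b = j then \<i> * complex_of_real (1 / sqrt 2)
     else if a = j \<and> b = i then - \<i> * complex_of_real (1 / sqrt 2) else 0)"
proof -
  show "basis_hermitian (i, i) $ a $ b = (if a = i \<and> b = i then 1 else 0)"
    unfolding basis_hermitian_def
    by (cases a b rule: linorder_cases) (auto simp: hermitian_of_nth complex_eq_iff)
next
  assume "i < j"
  then have "i \<noteq> j" "\<not> j < i" by simp_all
  with \<open>i < j\<close> show "basis_hermitian (i, j) $ a $ b =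
    (if a = i \<and> b = j \<or> a = j \<and> b = i then complex_of_real (1 / sqrt 2) else 0)"
    unfolding basis_hermitian_def
    by (cases a b rule: linorder_cases; cases "a = i"; cases "b = j"; cases "a = j"; cases "b = i")
       (simp_all add: hermitian_of_nth complex_eq_iff)
next
  assume "i < j"
  then have "i \<noteq> j" "\<not> j < i" by simp_all
  with \<open>i < j\<close> show "basis_hermitian (j, i) $ a $ b =
    (if a = i \<and> b = j then \<i> * complex_of_real (1 / sqrt 2)
     else if a = j \<and> b = i then - \<i> * complex_of_real (1 / sqrt 2) else 0)"
    unfolding basis_hermitian_def
    by (cases a b rule: linorder_cases; cases "a = i"; cases "b = j"; cases "a = j"; cases "b = i")
       (simp_all add: hermitian_of_nth complex_eq_iff)
qed

text \<open>The completeness relation of the orthonormal basis, which is also the covariance of the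
  GUE entries. Only the directions (b, c) and (c, b) touch the entry at row b and column c; for b
  distinct from c the real and the imaginary direction contribute 1/2 each, adding up or
  cancelling.\<close>

lemma basis_hermitian_complete:
  fixes a b c d :: "'n::{finite,linorder}"
  shows "(\<Sum>p\<in>UNIV. basis_hermitian p $ b $ c * basis_hermitian p $ d $ a) = (if a = b \<and> c = d then 1 else 0)"
proof -
  have z: "basis_hermitian p $ b $ c = 0" if "p \<notin> {(b, c), (c, b)}" for p :: "'n \<times> 'n"
  proof (cases p)
    case (Pair i j)
    then show ?thesis using that
      by (cases i j rule: linorder_cases) (auto simp: basis_hermitian_nth)
  qed
  have "(\<Sum>p\<in>UNIV. basis_hermitian p $ b $ c * basis_hermitian p $ d $ a) =
      (\<Sum>p\<in>{(b, c), (c, b)}. basis_hermitian p $ b $ c * basis_hermitian p $ d $ a)"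
    by (rule sum.mono_neutral_right) (use z in auto)
  also have "\<dots> = (if a = b \<and> c = d then 1 else 0)"
  proof -
    define r where "r = complex_of_real (1 / sqrt 2)"
    have rr: "r * r = 1 / 2" "\<i> * r * (\<i> * r) = - (1 / 2)"
      by (simp_all add: r_def complex_eq_iff)
    have off: "basis_hermitian (i, j) $ i $ j * basis_hermitian (i, j) $ d $ a +
        basis_hermitian (j, i) $ i $ j * basis_hermitian (j, i) $ d $ a = (if a = i \<and> j = d then 1 else 0)"
      "basis_hermitian (i, j) $ j $ i * basis_hermitian (i, j) $ d $ a +
        basis_hermitian (j, i) $ j $ i * basis_hermitian (j, i) $ d $ a = (if a = j \<and> i = d then 1 else 0)"
      if "i < j" for i j :: 'n
    proof -
      have "i \<noteq> j" using that by simp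
      then show "basis_hermitian (i, j) $ i $ j * basis_hermitian (i, j) $ d $ a +
        basis_hermitian (j, i) $ i $ j * basis_hermitian (j, i) $ d $ a = (if a = i \<and> j = d then 1 else 0)"
        "basis_hermitian (i, j) $ j $ i * basis_hermitian (i, j) $ d $ a +
        basis_hermitian (j, i) $ j $ i * basis_hermitian (j, i) $ d $ a = (if a = j \<and> i = d then 1 else 0)"
        unfolding basis_hermitian_nth(2,3)[OF that] r_def[symmetric]
        by (cases "d = i"; cases "d = j"; cases "a = i"; cases "a = j"; simp add: rr)+
    qed
    show ?thesis
    proof (cases b c rule: linorder_cases)
      case less
      then have "b \<noteq> c" by simp
      then show ?thesis using off(1)[OF less] by simp
    next
      case equal
      then show ?thesis by (auto simp: basis_hermitian_nth(1))
    next
      case greater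
      then have "b \<noteq> c" by simp
      then show ?thesis using off(2)[OF greater] by (simp add: add.commute)
    qed
  qed
  finally show ?thesis .
qed

text \<open>Two contractions of the completeness relation: summing over the basis merges a product
  of two traces into one trace, and splits one trace into a product. This exchange drives the
  duality.\<close>

lemma trace_mult_basis:
  fixes U V :: "complex^('n::{finite,linorder})^('n::{finite,linorder})"
  shows "(\<Sum>p\<in>UNIV. trace (U ** basis_hermitian p) * trace (V ** basis_hermitian p)) = trace (U ** V)"
    "(\<Sum>p\<in>UNIV. trace (U ** basis_hermitian p ** V ** basis_hermitian p)) = trace U * trace V"
proof -
  let ?B = "basis_hermitian :: 'n \<times> 'n \<Rightarrow> complex^('n::{finite,linorder})^('n::{finite,linorder})"
  have "(\<Sum>p\<in>UNIV. trace (U ** ?B p) * trace (V ** ?B p)) =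
      (\<Sum>p\<in>UNIV. (\<Sum>i\<in>UNIV. \<Sum>k\<in>UNIV. U $ i $ k * ?B p $ k $ i) * (\<Sum>j\<in>UNIV. \<Sum>l\<in>UNIV. V $ j $ l * ?B p $ l $ j))"
    by (simp add: trace_def matrix_matrix_mult_def)
  also have "\<dots> = (\<Sum>p\<in>UNIV. \<Sum>i\<in>UNIV. \<Sum>k\<in>UNIV. \<Sum>j\<in>UNIV. \<Sum>l\<in>UNIV. (U $ i $ k * V $ j $ l) * (?B p $ k $ i * ?B p $ l $ j))"
    unfolding sum_distrib_right unfolding sum_distrib_left by (simp add: ac_simps)
  also have "\<dots> = (\<Sum>i\<in>UNIV. \<Sum>k\<in>UNIV. \<Sum>j\<in>UNIV. \<Sum>l\<in>UNIV. (U $ i $ k * V $ j $ l) * (\<Sum>p\<in>UNIV. ?B p $ k $ i * ?B p $ l $ j))"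
    by (subst sum.swap, rule sum.cong[OF refl], subst sum.swap, rule sum.cong[OF refl], subst sum.swap,
        rule sum.cong[OF refl], subst sum.swap, rule sum.cong[OF refl]) (simp only: sum_distrib_left)
  also have "\<dots> = (\<Sum>i\<in>UNIV. \<Sum>k\<in>UNIV. \<Sum>j\<in>UNIV. \<Sum>l\<in>UNIV. if j = k \<and> i = l then U $ i $ k * V $ j $ l else 0)"
    unfolding basis_hermitian_complete by (simp add: if_distrib cong: if_cong)
  also have "\<dots> = (\<Sum>i\<in>UNIV. \<Sum>k\<in>UNIV. U $ i $ k * V $ k $ i)"
  proof (intro sum.cong refl)
    fix i k :: 'n
    have "(\<Sum>l\<in>UNIV. if j = k \<and> i = l then U $ i $ k * V $ j $ l else 0) = (if j = k then U $ i $ k * V $ k $ i else 0)" for j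
      by (cases "j = k") auto
    then show "(\<Sum>j\<in>UNIV. \<Sum>l\<in>UNIV. if j = k \<and> i = l then U $ i $ k * V $ j $ l else 0) = U $ i $ k * V $ k $ i"
      by simp
  qed
  also have "\<dots> = trace (U ** V)" by (simp add: trace_def matrix_matrix_mult_def)
  finally show "(\<Sum>p\<in>UNIV. trace (U ** ?B p) * trace (V ** ?B p)) = trace (U ** V)" .
  have "(\<Sum>p\<in>UNIV. trace (U ** ?B p ** V ** ?B p)) =
      (\<Sum>p\<in>UNIV. \<Sum>i\<in>UNIV. \<Sum>l\<in>UNIV. \<Sum>k\<in>UNIV. \<Sum>j\<in>UNIV. (U $ i $ j * V $ k $ l) * (?B p $ j $ k * ?B p $ l $ i))"
    by (simp only: trace_def matrix_matrix_mult_def vec_lambda_beta sum_distrib_right) (simp only: ac_simps)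
  also have "\<dots> = (\<Sum>i\<in>UNIV. \<Sum>l\<in>UNIV. \<Sum>k\<in>UNIV. \<Sum>j\<in>UNIV. (U $ i $ j * V $ k $ l) * (\<Sum>p\<in>UNIV. ?B p $ j $ k * ?B p $ l $ i))"
    by (subst sum.swap, rule sum.cong[OF refl], subst sum.swap, rule sum.cong[OF refl], subst sum.swap,
        rule sum.cong[OF refl], subst sum.swap, rule sum.cong[OF refl]) (simp only: sum_distrib_left)
  also have "\<dots> = (\<Sum>i\<in>UNIV. \<Sum>l\<in>UNIV. \<Sum>k\<in>UNIV. \<Sum>j\<in>UNIV. if i = j \<and> k = l then U $ i $ j * V $ k $ l else 0)"
    unfolding basis_hermitian_complete by (simp add: if_distrib cong: if_cong)
  also have "\<dots> = (\<Sum>i\<in>UNIV. \<Sum>l\<in>UNIV. U $ i $ i * V $ l $ l)"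
  proof (intro sum.cong refl)
    fix i l :: 'n
    have "(\<Sum>j\<in>UNIV. if i = j \<and> k = l then U $ i $ j * V $ k $ l else 0) = (if k = l then U $ i $ i * V $ l $ l else 0)" for k
      by (cases "k = l") auto
    then show "(\<Sum>k\<in>UNIV. \<Sum>j\<in>UNIV. if i = j \<and> k = l then U $ i $ j * V $ k $ l else 0) = U $ i $ i * V $ l $ l"
      by simp
  qed
  also have "\<dots> = trace U * trace V"
    by (simp add: trace_def sum_product)
  finally show "(\<Sum>p\<in>UNIV. trace (U ** ?B p ** V ** ?B p)) = trace U * trace V" .
qed

text \<open>The off-diagonal terms of the squares cancel in cyclic triples by the partial fraction
  identity 1/((a-b)(a-c)) + 1/((b-c)(b-a)) + 1/((c-a)(c-b)) = 0. Summands with coinciding indices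
  are 1 / 0 = 0.\<close>

lemma sum_reciprocal_differences:
  fixes w :: "'n::finite \<Rightarrow> 'a::field_char_0"
  assumes "inj w"
  shows "(\<Sum>m\<in>UNIV. (\<Sum>k\<in>UNIV. 1 / (w m - w k))\<^sup>2) = (\<Sum>m\<in>UNIV. \<Sum>k\<in>UNIV. (1 / (w m - w k))\<^sup>2)"
proof -
  define u where "u m k = 1 / (w m - w k)" for m k
  define t where "t m k l = (if k \<noteq> l then u m k * u m l else 0)" for m k l
  define T where "T = (\<Sum>m\<in>UNIV. \<Sum>k\<in>UNIV. \<Sum>l\<in>UNIV. t m k l)"
  have "t m k l + t k l m + t l m k = 0" for m k l
  proof (cases "m \<noteq> k \<and> k \<noteq> l \<and> m \<noteq> l")
    case True
    then have "w m \<noteq> w k" "w k \<noteq> w l" "w m \<noteq> w l" using assms by (auto simp: inj_def)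
    then show ?thesis using True by (auto simp: t_def u_def divide_simps) (simp add: algebra_simps)
  next
    case False then show ?thesis by (auto simp: t_def u_def)
  qed
  then have "0 = (\<Sum>m\<in>UNIV. \<Sum>k\<in>UNIV. \<Sum>l\<in>UNIV. t m k l + t k l m + t l m k)" by simp
  also have "\<dots> = T + (\<Sum>m\<in>UNIV. \<Sum>k\<in>UNIV. \<Sum>l\<in>UNIV. t k l m) + (\<Sum>m\<in>UNIV. \<Sum>k\<in>UNIV. \<Sum>l\<in>UNIV. t l m k)"
    by (simp add: sum.distrib T_def)
  also have "(\<Sum>m\<in>UNIV. \<Sum>k\<in>UNIV. \<Sum>l\<in>UNIV. t k l m) = T"
    unfolding T_def by (subst sum.swap) (intro sum.cong refl sum.swap)
  also have "(\<Sum>m\<in>UNIV. \<Sum>k\<in>UNIV. \<Sum>l\<in>UNIV. t l m k) = T"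
  proof -
    have "(\<Sum>m\<in>UNIV. \<Sum>k\<in>UNIV. \<Sum>l\<in>UNIV. t l m k) = (\<Sum>m\<in>UNIV. \<Sum>l\<in>UNIV. \<Sum>k\<in>UNIV. t l m k)"
      by (intro sum.cong refl sum.swap)
    also have "\<dots> = T" unfolding T_def by (rule sum.swap)
    finally show ?thesis .
  qed
  finally have T: "T = 0" by simp
  have "(\<Sum>k\<in>UNIV. u m k)\<^sup>2 = (\<Sum>k\<in>UNIV. \<Sum>l\<in>UNIV. t m k l) + (\<Sum>k\<in>UNIV. (u m k)\<^sup>2)" for m
  proof -
    have "(\<Sum>k\<in>UNIV. u m k)\<^sup>2 = (\<Sum>k\<in>UNIV. \<Sum>l\<in>UNIV. t m k l + (if l = k then (u m k)\<^sup>2 else 0))"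
      unfolding power2_eq_square sum_product t_def by (intro sum.cong refl) auto
    then show ?thesis by (simp add: sum.distrib)
  qed
  then have "(\<Sum>m\<in>UNIV. (\<Sum>k\<in>UNIV. u m k)\<^sup>2) = T + (\<Sum>m\<in>UNIV. \<Sum>k\<in>UNIV. (u m k)\<^sup>2)"
    by (simp add: sum.distrib T_def)
  with T show ?thesis by (simp add: u_def)
qed

text \<open>Differentiability in the form of an exact factorization of the increment with a
  continuous cofactor, which is what the resolvent identity supplies.\<close>

lemma has_vector_derivative_caratheodory:
  fixes f h :: "real \<Rightarrow> 'a::real_normed_vector"
  assumes eq: "\<And>y. f y - f x = (y - x) *\<^sub>R h y" and h: "isCont h x"
  shows "(f has_vector_derivative h x) (at x)"
  unfolding has_vector_derivative_def has_derivative_iff_norm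
proof (intro conjI bounded_linear_scaleR_left)
  have "((\<lambda>y. norm (h y - h x)) \<longlongrightarrow> 0) (at x)"
    using h unfolding isCont_def by (rule tendsto_norm_zero[OF LIM_zero])
  moreover have "\<forall>\<^sub>F y in at x. norm (h y - h x) = norm (f y - f x - (y - x) *\<^sub>R h x) / norm (y - x)"
    by (rule eventually_at_filter[THEN iffD2], rule always_eventually)
       (simp add: eq flip: scaleR_diff_right)
  ultimately show "((\<lambda>y. norm (f y - f x - (y - x) *\<^sub>R h x) / norm (y - x)) \<longlongrightarrow> 0) (at x)"
    by (rule Lim_transform_eventually)
qed

lemma linear_fun_expand:
  fixes F :: "('e::finite \<Rightarrow> real) \<Rightarrow> 'a::real_vector"
  assumes add: "\<And>u v. F (\<lambda>e. u e + v e) = F u + F v" and scale: "\<And>c u. F (\<lambda>e. c * u e) = c *\<^sub>R F u"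
  shows "F v = (\<Sum>e\<in>UNIV. v e *\<^sub>R F (\<lambda>e'. if e' = e then 1 else 0))"
proof -
  have 0: "F (\<lambda>_. 0) = 0" using scale[of 0 "\<lambda>_. 0"] by simp
  have "F (\<lambda>e'. \<Sum>e\<in>S. v e * (if e' = e then 1 else 0)) = (\<Sum>e\<in>S. v e *\<^sub>R F (\<lambda>e'. if e' = e then 1 else 0))"
    if "finite S" for S
    using that
  proof (induction S)
    case (insert e S)
    then show ?case
      using add[of "\<lambda>e'. v e * (if e' = e then 1 else 0)" "\<lambda>e'. \<Sum>e\<in>S. v e * (if e' = e then 1 else 0)"]
        scale[of "v e" "\<lambda>e'. if e' = e then 1 else 0"] by simp
  qed (simp add: 0)
  from this[of UNIV] show ?thesis by (simp add: if_distrib cong: if_cong)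
qed

lemma hermitian_of_expand: "hermitian_of x = (\<Sum>p\<in>UNIV. x p *\<^sub>R basis_hermitian p)"
proof -
  have "hermitian_of x = (\<Sum>p\<in>UNIV. x p *\<^sub>R hermitian_of (\<lambda>q. if q = p then 1 else 0))"
    by (rule linear_fun_expand[where F=hermitian_of]) (rule hermitian_of_add, rule hermitian_of_scaleR)
  then show ?thesis by (simp only: basis_hermitian_def)
qed

lemma hermitian_of_nth_expand: "hermitian_of x $ i $ j = (\<Sum>p\<in>UNIV. x p *\<^sub>R basis_hermitian p $ i $ j)"
  by (simp add: hermitian_of_expand)

lemma continuous_on_det:
  fixes A :: "'b::topological_space \<Rightarrow> 'a::{real_normed_field}^'n^'n"
  assumes "\<And>i j. continuous_on S (\<lambda>t. A t $ i $ j)"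
  shows "continuous_on S (\<lambda>t. det (A t))"
  unfolding det_def by (intro continuous_intros assms)

lemma borel_measurable_det:
  fixes A :: "'b \<Rightarrow> 'a::{real_normed_field,second_countable_topology}^'n^'n"
  assumes "\<And>i j. (\<lambda>t. A t $ i $ j) \<in> borel_measurable M"
  shows "(\<lambda>t. det (A t)) \<in> borel_measurable M"
  unfolding det_def by (intro borel_measurable_sum borel_measurable_times borel_measurable_prod assms borel_measurable_const)

lemma norm_matrix_mult_entry_le:
  fixes A B :: "complex^'n^'n"
  assumes "\<And>i j. norm (A $ i $ j) \<le> a" "\<And>i j. norm (B $ i $ j) \<le> b"
  shows "norm ((A ** B) $ i $ j) \<le> real CARD('n) * (a * b)"
proof -
  have "0 \<le> a" using norm_ge_zero assms(1) by (rule order_trans)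
  then have "norm ((A ** B) $ i $ j) \<le> (\<Sum>k\<in>(UNIV::'n set). a * b)"
    unfolding matrix_matrix_mult_def vec_lambda_beta
    by (intro order_trans[OF norm_sum] sum_mono) (auto simp: norm_mult intro!: mult_mono assms)
  then show ?thesis by simp
qed

lemma norm_trace_le:
  fixes A :: "complex^'n^'n"
  assumes "\<And>i j. norm (A $ i $ j) \<le> a"
  shows "norm (trace A) \<le> real CARD('n) * a"
proof -
  have "norm (trace A) \<le> (\<Sum>k\<in>(UNIV::'n set). a)"
    unfolding trace_def by (intro order_trans[OF norm_sum] sum_mono assms)
  then show ?thesis by simp
qed

text \<open>Every difference of shifted poles is at most a constant times the product of all
  \<open>1 + \<bar>x l\<bar>\<close>, and there are \<open>N\<close> differences. The crude product
  form is the one under which Gaussian integrability is stated.\<close>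

lemma ex_bound_vdm_shift:
  fixes z :: "'n::{finite,linorder} \<Rightarrow> complex"
  shows "\<exists>K k. 0 \<le> K \<and> (\<forall>x. norm (vdm (\<lambda>l. z l + complex_of_real (x l))) \<le> K * (\<Prod>l\<in>UNIV. (1 + \<bar>x l\<bar>) ^ k))"
proof -
  define Z where "Z = 1 + (\<Sum>l\<in>UNIV. norm (z l))"
  define N where "N = card {(j, k). j < (k::'n)}"
  have Z: "1 \<le> Z" by (auto simp: Z_def intro!: sum_nonneg)
  have "norm (vdm (\<lambda>l. z l + complex_of_real (x l))) \<le> (2 * Z) ^ N * (\<Prod>l\<in>UNIV. (1 + \<bar>x l\<bar>) ^ N)" for x
  proof -
    define W where "W = (\<Prod>l\<in>UNIV. (1 + \<bar>x l\<bar>))"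
    have W: "1 + \<bar>x l\<bar> \<le> W" for l
    proof -
      have "1 * (1 + \<bar>x l\<bar>) \<le> (\<Prod>e\<in>UNIV - {l}. (1 + \<bar>x e\<bar>)) * (1 + \<bar>x l\<bar>)"
        by (intro mult_right_mono prod_ge_1) auto
      then show ?thesis by (simp add: W_def prod.remove[of UNIV l] mult.commute)
    qed
    have w: "norm (z l + complex_of_real (x l)) \<le> Z * W" for l
    proof -
      have "norm (z l + complex_of_real (x l)) \<le> norm (z l) + \<bar>x l\<bar>"
        using norm_triangle_ineq[of "z l" "complex_of_real (x l)"] by simp
      also have "norm (z l) \<le> (\<Sum>l\<in>UNIV. norm (z l))" by (rule member_le_sum) auto
      finally have "norm (z l + complex_of_real (x l)) \<le> (Z - 1) + \<bar>x l\<bar>" by (simp add: Z_def)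
      also have "\<dots> \<le> Z * (1 + \<bar>x l\<bar>)"
        using Z mult_right_mono[OF Z, of "\<bar>x l\<bar>"] by (simp add: algebra_simps)
      also have "\<dots> \<le> Z * W" using W Z by (intro mult_left_mono) auto
      finally show ?thesis .
    qed
    have "norm (vdm (\<lambda>l. z l + complex_of_real (x l))) \<le> (\<Prod>(j, k)\<in>{(j, k). j < (k::'n)}. 2 * Z * W)"
      unfolding vdm_def prod_norm[symmetric]
    proof (rule prod_mono)
      fix p :: "'n \<times> 'n"
      obtain j k where p: "p = (j, k)" by (cases p)
      have "norm ((z k + complex_of_real (x k)) - (z j + complex_of_real (x j))) \<le> Z * W + Z * W"
        by (rule order_trans[OF norm_triangle_ineq4 add_mono[OF w w]])
      then show "0 \<le> norm (case p of (j, k) \<Rightarrow> (z k + complex_of_real (x k)) - (z j + complex_of_real (x j))) \<and>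
          norm (case p of (j, k) \<Rightarrow> (z k + complex_of_real (x k)) - (z j + complex_of_real (x j))) \<le> (case p of (j, k) \<Rightarrow> 2 * Z * W)"
        by (simp add: p ac_simps)
    qed
    then show ?thesis
      by (simp add: N_def power_mult_distrib case_prod_unfold W_def prod_power_distrib)
  qed
  then show ?thesis using Z by (intro exI[of _ "(2 * Z) ^ N"] exI[of _ N]) auto
qed

text \<open>Real shifts and Hermitian perturbations leave the imaginary parts of the poles alone. So
  no shifted pole is ever an eigenvalue, no two of them ever meet, and no singularity of the test
  function is met.\<close>

locale resolvent_test =
  fixes z :: "'n::{finite,linorder} \<Rightarrow> complex"
    and X :: "complex^('n::{finite,linorder})^('n::{finite,linorder})"
  assumes X: "hermitian X" and Im_nonzero: "\<And>l. Im (z l) \<noteq> 0" and Im_inj: "inj (\<lambda>l. Im (z l))"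
begin

definition w :: "('n \<times> 'n + 'n \<Rightarrow> real) \<Rightarrow> 'n \<Rightarrow> complex" where
  "w x l = z l + complex_of_real (x (Inr l))"

definition A :: "('n \<times> 'n + 'n \<Rightarrow> real) \<Rightarrow> 'n \<Rightarrow> complex^('n::{finite,linorder})^('n::{finite,linorder})" where
  "A x l = mat (w x l) - (X + hermitian_of (\<lambda>p. x (Inl p)))"

definition R :: "('n \<times> 'n + 'n \<Rightarrow> real) \<Rightarrow> 'n \<Rightarrow> complex^('n::{finite,linorder})^('n::{finite,linorder})" where
  "R x l = matrix_inv (A x l)"

definition dA :: "('n \<times> 'n + 'n \<Rightarrow> real) \<Rightarrow> 'n \<Rightarrow> complex^('n::{finite,linorder})^('n::{finite,linorder})" where
  "dA v l = mat (complex_of_real (v (Inr l))) - hermitian_of (\<lambda>p. v (Inl p))"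

definition G :: "('n \<times> 'n + 'n \<Rightarrow> real) \<Rightarrow> complex" where
  "G x = vdm (w x) * (\<Prod>l\<in>UNIV. 1 / det (A x l))"

text \<open>The logarithmic derivative of \<open>G\<close> at \<open>x\<close> in direction
  \<open>v\<close>: the first sum comes from the Vandermonde factor, the traces from Jacobi's
  formula. Its own derivative in that direction is \<open>ddlog\<close>, so the second derivative of
  \<open>G\<close> is \<open>ddlog + dlog\<^sup>2\<close> times \<open>G\<close>.\<close>

definition dlog :: "('n \<times> 'n + 'n \<Rightarrow> real) \<Rightarrow> ('n \<times> 'n + 'n \<Rightarrow> real) \<Rightarrow> complex" where
  "dlog x v = (\<Sum>(j, k)\<in>{(j, k). j < k}. complex_of_real (v (Inr k) - v (Inr j)) / (w x k - w x j)) -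
     (\<Sum>l\<in>UNIV. trace (R x l ** dA v l))"

definition ddlog :: "('n \<times> 'n + 'n \<Rightarrow> real) \<Rightarrow> ('n \<times> 'n + 'n \<Rightarrow> real) \<Rightarrow> complex" where
  "ddlog x v = (\<Sum>l\<in>UNIV. trace (R x l ** dA v l ** R x l ** dA v l)) -
     (\<Sum>(j, k)\<in>{(j, k). j < k}. (complex_of_real (v (Inr k) - v (Inr j)) / (w x k - w x j))\<^sup>2)"

definition unit :: "'n \<times> 'n + 'n \<Rightarrow> 'n \<times> 'n + 'n \<Rightarrow> real" where
  "unit e = (\<lambda>e'. if e' = e then 1 else 0)"

definition G1 where "G1 e x = dlog x (unit e) * G x"

definition G2 where "G2 e x = (ddlog x (unit e) + (dlog x (unit e))\<^sup>2) * G x"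

lemma Im_w [simp]: "Im (w x l) = Im (z l)"
  by (simp add: w_def)

lemma w_eq_iff [simp]: "w x j = w x k \<longleftrightarrow> j = k"
proof
  assume "w x j = w x k"
  then have "Im (z j) = Im (z k)" by (metis Im_w)
  then show "j = k" using Im_inj by (auto dest: injD)
qed simp

lemma hermitian_sum: "hermitian (X + hermitian_of y)"
  unfolding hermitian_def by (metis X hermitian_hermitian_of complex_cnj_add hermitian_def vector_add_component)

lemma det_A_nonzero: "det (A x l) \<noteq> 0"
  unfolding A_def by (rule hermitian_det_resolvent_nonzero[OF hermitian_sum]) (simp add: Im_nonzero)

lemma A_nth: "A x l $ i $ j = (if i = j then w x l else 0) - (X $ i $ j + (\<Sum>p\<in>UNIV. x (Inl p) *\<^sub>R basis_hermitian p $ i $ j))"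
  by (simp add: A_def mat_def hermitian_of_nth_expand)

lemma dA_nth: "dA v l $ i $ j = (if i = j then complex_of_real (v (Inr l)) else 0) - (\<Sum>p\<in>UNIV. v (Inl p) *\<^sub>R basis_hermitian p $ i $ j)"
  by (simp add: dA_def mat_def hermitian_of_nth_expand)

lemma G_has_vector_derivative:
  assumes c: "\<And>e. ((\<lambda>t. c t e) has_real_derivative c' e) (at t)"
  shows "((\<lambda>t. G (c t)) has_vector_derivative dlog (c t) c' * G (c t)) (at t)"
proof -
  have w': "((\<lambda>t. w (c t) l) has_vector_derivative complex_of_real (c' (Inr l))) (at t)" for l
  proof -
    have "((\<lambda>t. complex_of_real (c t (Inr l)) + z l) has_vector_derivative complex_of_real (c' (Inr l))) (at t)"
      unfolding has_vector_derivative_add_const by (rule has_vector_derivative_of_real[OF c])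
    then show ?thesis by (simp only: w_def add.commute)
  qed
  have c2: "((\<lambda>t. c t e) has_vector_derivative c' e) (at t)" for e
    using c by (simp add: has_real_derivative_iff_has_vector_derivative)
  have A': "((\<lambda>t. A (c t) l $ i $ j) has_vector_derivative dA c' l $ i $ j) (at t)" for l i j
    unfolding A_nth dA_nth
    by (cases "i = j") (auto intro!: derivative_eq_intros w' c simp: c)
  have vdm: "((\<lambda>t. vdm (w (c t))) has_vector_derivative
      (\<Sum>p\<in>{(j, k). j < k}. case p of (j, k) \<Rightarrow> complex_of_real (c' (Inr k) - c' (Inr j)) / (w (c t) k - w (c t) j)) * vdm (w (c t))) (at t)"
    unfolding vdm_def
  proof (rule has_vector_derivative_prod_log)
    fix p :: "'n \<times> 'n" assume "p \<in> {(j, k). j < k}"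
    then show "((\<lambda>t. case p of (j, k) \<Rightarrow> w (c t) k - w (c t) j) has_vector_derivative
      (case p of (j, k) \<Rightarrow> complex_of_real (c' (Inr k) - c' (Inr j)) / (w (c t) k - w (c t) j)) *
      (case p of (j, k) \<Rightarrow> w (c t) k - w (c t) j)) (at t)"
      using has_vector_derivative_diff[OF w' w'] by auto
  qed simp
  have "((\<lambda>t. \<Prod>l\<in>UNIV. 1 / det (A (c t) l)) has_vector_derivative
      (\<Sum>l\<in>UNIV. - trace (R (c t) l ** dA c' l)) * (\<Prod>l\<in>UNIV. 1 / det (A (c t) l))) (at t)"
  proof (rule has_vector_derivative_prod_log)
    fix l
    have d: "((\<lambda>t. det (A (c t) l)) has_vector_derivative trace (R (c t) l ** dA c' l) * det (A (c t) l)) (at t)"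
      unfolding R_def by (rule jacobi_formula[OF A' det_A_nonzero])
    have "((\<lambda>x. 1 / x) has_field_derivative - (1 / (det (A (c t) l))\<^sup>2)) (at (det (A (c t) l)))"
      using det_A_nonzero by (auto intro!: derivative_eq_intros simp: power2_eq_square)
    from field_vector_diff_chain_at[OF d this]
    show "((\<lambda>t. 1 / det (A (c t) l)) has_vector_derivative - trace (R (c t) l ** dA c' l) * (1 / det (A (c t) l))) (at t)"
      using det_A_nonzero by (simp add: o_def power2_eq_square)
  qed simp
  from has_vector_derivative_mult[OF vdm this] show ?thesis
    unfolding G_def dlog_def by (simp add: algebra_simps sum_negf)
qed

lemma dlog_expand: "dlog x v = (\<Sum>e\<in>UNIV. v e *\<^sub>R dlog x (unit e))"
  unfolding unit_def
proof (rule linear_fun_expand[where F="dlog x"])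
  fix u v :: "'n \<times> 'n + 'n \<Rightarrow> real" and c :: real
  have "dA (\<lambda>e. u e + v e) l = dA u l + dA v l" for l
    by (simp add: vec_eq_iff dA_nth sum.distrib algebra_simps)
  then have tr: "trace (R x l ** dA (\<lambda>e. u e + v e) l) = trace (R x l ** dA u l) + trace (R x l ** dA v l)" for l
    by (simp add: matrix_add_ldistrib trace_add)
  show "dlog x (\<lambda>e. u e + v e) = dlog x u + dlog x v"
    unfolding dlog_def tr by (simp add: sum.distrib case_prod_unfold add_diff_add add_divide_distrib)
  have "dA (\<lambda>e. c * u e) l = c *\<^sub>R dA u l" for l
    by (simp add: vec_eq_iff dA_nth scaleR_sum_right scaleR_diff_right) (simp add: scaleR_conv_of_real)
  then have tr: "trace (R x l ** dA (\<lambda>e. c * u e) l) = c *\<^sub>R trace (R x l ** dA u l)" for l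
    by (simp add: trace_def matrix_matrix_mult_def scaleR_sum_right)
  show "dlog x (\<lambda>e. c * u e) = c *\<^sub>R dlog x u"
    unfolding dlog_def tr
    by (simp add: scaleR_sum_right scaleR_diff_right case_prod_unfold)
       (simp add: scaleR_conv_of_real right_diff_distrib diff_divide_distrib)
qed

lemma R_nth: "R x l $ i $ j = det (\<chi> a b. if b = i then (if a = j then 1 else 0) else A x l $ a $ b) / det (A x l)"
  unfolding R_def by (rule matrix_inv_cramer[OF det_A_nonzero])

lemma continuous_R:
  assumes "\<And>e. continuous_on UNIV (\<lambda>t::real. c t e)"
  shows "continuous_on UNIV (\<lambda>t. R (c t) l $ i $ j)" "continuous_on UNIV (\<lambda>t. w (c t) l)"
    "continuous_on UNIV (\<lambda>t. det (A (c t) l))"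
proof -
  show w: "continuous_on UNIV (\<lambda>t. w (c t) l)" for l
    unfolding w_def by (intro continuous_intros assms)
  have A: "continuous_on UNIV (\<lambda>t. A (c t) l $ a $ b)" for a b
    unfolding A_nth by (cases "a = b") (auto intro!: continuous_intros assms w)
  then show det: "continuous_on UNIV (\<lambda>t. det (A (c t) l))" by (rule continuous_on_det)
  have "continuous_on UNIV (\<lambda>t. (if b = i then (if a = j then 1 else 0) else A (c t) l $ a $ b))" for a b
    using A by (cases "b = i"; cases "a = j") auto
  then show "continuous_on UNIV (\<lambda>t. R (c t) l $ i $ j)"
    unfolding R_nth by (intro continuous_on_divide continuous_on_det det) (auto simp: det_A_nonzero)
qed

lemma continuous_dlog:
  assumes "\<And>e. continuous_on UNIV (\<lambda>t::real. c t e)"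
  shows "continuous_on UNIV (\<lambda>t. dlog (c t) v)" "continuous_on UNIV (\<lambda>t. ddlog (c t) v)"
    "continuous_on UNIV (\<lambda>t. G (c t))"
proof -
  note [continuous_intros] = continuous_R[OF assms]
  show "continuous_on UNIV (\<lambda>t. dlog (c t) v)"
    unfolding dlog_def trace_def matrix_matrix_mult_def case_prod_unfold vec_lambda_beta
    by (intro continuous_intros) auto
  show "continuous_on UNIV (\<lambda>t. ddlog (c t) v)"
    unfolding ddlog_def trace_def matrix_matrix_mult_def case_prod_unfold vec_lambda_beta
    by (intro continuous_intros) auto
  show "continuous_on UNIV (\<lambda>t. G (c t))"
    unfolding G_def vdm_def case_prod_unfold by (intro continuous_intros) (auto simp: det_A_nonzero)
qed

text \<open>Only one coordinate moves, so the increments of the poles and of the matrices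
  \<open>A\<close> are exactly linear in it; the resolvents and reciprocal differences then have
  explicit increments.\<close>

lemma dlog_has_vector_derivative:
  "((\<lambda>t. dlog (x(e := t)) (unit e)) has_vector_derivative ddlog (x(e := t)) (unit e)) (at t)"
proof -
  let ?x = "\<lambda>t. x(e := t)" and ?u = "unit e"
  have cont: "continuous_on UNIV (\<lambda>t. ?x t e')" for e'
    by (cases "e' = e") auto
  have w: "w (?x t) l - w (?x s) l = (t - s) *\<^sub>R complex_of_real (?u (Inr l))" for t s l
    by (simp add: w_def unit_def scaleR_conv_of_real)
  have A: "A (?x s) l - A (?x t) l = (s - t) *\<^sub>R dA ?u l" for t s l
  proof -
    have "(\<Sum>p\<in>UNIV. ?x s (Inl p) *\<^sub>R basis_hermitian p $ i $ j) - (\<Sum>p\<in>UNIV. ?x t (Inl p) *\<^sub>R basis_hermitian p $ i $ j) =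
        (s - t) *\<^sub>R (\<Sum>p\<in>UNIV. ?u (Inl p) *\<^sub>R basis_hermitian p $ i $ j)" for i j :: 'n
      unfolding sum_subtractf[symmetric] scaleR_sum_right
      by (intro sum.cong refl) (auto simp: unit_def scaleR_diff_left)
    moreover have "(if i = j then w (?x s) l else 0) - (if i = j then w (?x t) l else 0) =
        (s - t) *\<^sub>R (if i = j then complex_of_real (?u (Inr l)) else 0)" for i j :: 'n
      using w by simp
    ultimately show ?thesis
      by (simp add: vec_eq_iff A_nth dA_nth scaleR_diff_right algebra_simps)
  qed
  \<comment> \<open>The resolvent identity factors the increment exactly: one resolvent moves with
    \<open>s\<close>, the other stays at \<open>t\<close>, and continuity in \<open>s\<close>
    suffices.\<close>
  have R: "((\<lambda>t. R (?x t) l $ i $ j) has_vector_derivative - (R (?x t) l ** dA ?u l ** R (?x t) l) $ i $ j) (at t)" for l i j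
  proof (rule has_vector_derivative_caratheodory[where h="\<lambda>s. - (R (?x s) l ** dA ?u l ** R (?x t) l) $ i $ j"])
    fix s
    have "R (?x s) l - R (?x t) l = R (?x s) l ** ((t - s) *\<^sub>R dA ?u l) ** R (?x t) l"
      unfolding R_def A[symmetric] by (rule matrix_inv_diff[OF det_A_nonzero det_A_nonzero])
    then have "(R (?x s) l - R (?x t) l) $ i $ j = (t - s) *\<^sub>R (R (?x s) l ** dA ?u l ** R (?x t) l) $ i $ j"
      by (simp add: matrix_matrix_mult_def flip: scaleR_sum_right)
    then show "R (?x s) l $ i $ j - R (?x t) l $ i $ j = (s - t) *\<^sub>R - (R (?x s) l ** dA ?u l ** R (?x t) l) $ i $ j"
      by (simp add: scaleR_diff_left)
    have "continuous_on UNIV (\<lambda>s. - (R (?x s) l ** dA ?u l ** R (?x t) l) $ i $ j)"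
      unfolding matrix_matrix_mult_def vec_lambda_beta
      by (intro continuous_intros continuous_R cont)
    then show "isCont (\<lambda>s. - (R (?x s) l ** dA ?u l ** R (?x t) l) $ i $ j) t"
      by (simp add: continuous_on_eq_continuous_at)
  qed
  have tr: "((\<lambda>t. trace (R (?x t) l ** dA ?u l)) has_vector_derivative - trace (R (?x t) l ** dA ?u l ** R (?x t) l ** dA ?u l)) (at t)" for l
  proof -
    have "((\<lambda>t. \<Sum>i\<in>UNIV. \<Sum>k\<in>UNIV. R (?x t) l $ i $ k * dA ?u l $ k $ i) has_vector_derivative
        (\<Sum>i\<in>UNIV. \<Sum>k\<in>UNIV. - (R (?x t) l ** dA ?u l ** R (?x t) l) $ i $ k * dA ?u l $ k $ i)) (at t)"
      by (intro has_vector_derivative_sum has_vector_derivative_mult_left R)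
    moreover have "(\<Sum>i\<in>UNIV. \<Sum>k\<in>UNIV. - (R (?x t) l ** dA ?u l ** R (?x t) l) $ i $ k * dA ?u l $ k $ i) =
        - trace (R (?x t) l ** dA ?u l ** R (?x t) l ** dA ?u l)"
      unfolding trace_def by (subst (3) matrix_matrix_mult_def) (simp add: sum_negf)
    ultimately show ?thesis by (simp add: trace_def matrix_matrix_mult_def)
  qed
  have fr: "((\<lambda>t. complex_of_real (?u (Inr k) - ?u (Inr j)) / (w (?x t) k - w (?x t) j)) has_vector_derivative
      - (complex_of_real (?u (Inr k) - ?u (Inr j)) / (w (?x t) k - w (?x t) j))\<^sup>2) (at t)" if "j \<noteq> k" for j k
  proof -
    define d where "d = complex_of_real (?u (Inr k) - ?u (Inr j))"
    define y where "y = w (?x t) k - w (?x t) j"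
    have y: "y \<noteq> 0" using that by (simp add: y_def)
    have "((\<lambda>t. w (?x t) k - w (?x t) j) has_vector_derivative d) (at t)"
    proof (rule has_vector_derivative_caratheodory[where h="\<lambda>_. d"])
      fix s
      have "(w (?x s) k - w (?x s) j) - (w (?x t) k - w (?x t) j) =
          (w (?x s) k - w (?x t) k) - (w (?x s) j - w (?x t) j)" by simp
      then show "(w (?x s) k - w (?x s) j) - (w (?x t) k - w (?x t) j) = (s - t) *\<^sub>R d"
        unfolding w by (simp add: d_def scaleR_diff_right)
    qed simp
    moreover have "((\<lambda>y. d / y) has_field_derivative - (d / y\<^sup>2)) (at y)"
      using y by (auto intro!: derivative_eq_intros simp: power2_eq_square)
    ultimately have "((\<lambda>y. d / y) \<circ> (\<lambda>t. w (?x t) k - w (?x t) j) has_vector_derivative d * - (d / y\<^sup>2)) (at t)"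
      unfolding y_def by (rule field_vector_diff_chain_at)
    then show ?thesis by (simp add: o_def d_def y_def power2_eq_square)
  qed
  have "((\<lambda>t. \<Sum>p\<in>{(j, k). j < k}. complex_of_real (?u (Inr (snd p)) - ?u (Inr (fst p))) / (w (?x t) (snd p) - w (?x t) (fst p)))
     has_vector_derivative (\<Sum>p\<in>{(j, k). j < k}. - (complex_of_real (?u (Inr (snd p)) - ?u (Inr (fst p))) / (w (?x t) (snd p) - w (?x t) (fst p)))\<^sup>2)) (at t)"
    by (intro has_vector_derivative_sum fr) auto
  from has_vector_derivative_diff[OF this has_vector_derivative_sum[OF tr]]
  show ?thesis
    unfolding dlog_def ddlog_def case_prod_unfold by (simp add: sum_negf)
qed

lemma G_deriv:
  assumes "\<And>e. ((\<lambda>t. c t e) has_real_derivative c' e) (at t)"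
  shows "((\<lambda>t. G (c t)) has_vector_derivative (\<Sum>e\<in>UNIV. c' e *\<^sub>R G1 e (c t))) (at t)"
proof -
  have "dlog (c t) c' * G (c t) = (\<Sum>e\<in>UNIV. c' e *\<^sub>R dlog (c t) (unit e)) * G (c t)"
    using dlog_expand[of "c t" c'] by (rule arg_cong)
  also have "\<dots> = (\<Sum>e\<in>UNIV. c' e *\<^sub>R G1 e (c t))"
    by (simp add: G1_def sum_distrib_right)
  finally show ?thesis using G_has_vector_derivative[of c c' t, OF assms] by simp
qed

lemma G1_deriv: "((\<lambda>t. G1 e (x(e := t))) has_vector_derivative G2 e (x(e := t))) (at t)"
proof -
  have "((\<lambda>t. (x(e := t)) e') has_real_derivative unit e e') (at t)" for e'
    by (cases "e' = e") (auto simp: unit_def intro!: derivative_eq_intros)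
  then have "((\<lambda>t. G (x(e := t))) has_vector_derivative dlog (x(e := t)) (unit e) * G (x(e := t))) (at t)"
    by (rule G_has_vector_derivative)
  from has_vector_derivative_mult[OF dlog_has_vector_derivative this]
  show ?thesis unfolding G1_def G2_def by (simp add: algebra_simps power2_eq_square)
qed

end

section \<open>The derivatives in the pole and in the matrix directions, and the equality of the
  Laplacians\<close>

lemma sum_pairs_through:
  fixes F :: "'n::{finite,linorder} \<Rightarrow> 'n \<Rightarrow> 'a::comm_monoid_add"
  assumes "\<And>j k. j \<noteq> m \<Longrightarrow> k \<noteq> m \<Longrightarrow> F j k = 0"
  shows "(\<Sum>(j, k)\<in>{(j, k). j < k}. F j k) = (\<Sum>k\<in>UNIV. if k < m then F k m else if m < k then F m k else 0)"
proof -
  let ?S = "(\<lambda>j. (j, m)) ` {..<m} \<union> (\<lambda>k. (m, k)) ` {m<..}"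
  have "(\<Sum>(j, k)\<in>{(j, k). j < k}. F j k) = (\<Sum>(j, k)\<in>?S. F j k)"
  proof (rule sum.mono_neutral_right)
    show "\<forall>i\<in>{(j, k). j < k} - ?S. (case i of (j, k) \<Rightarrow> F j k) = 0"
    proof
      fix i assume i: "i \<in> {(j, k). j < k} - ?S"
      obtain j k where jk: "i = (j, k)" by (cases i)
      with i have "j \<noteq> m" "k \<noteq> m" by auto
      with assms show "(case i of (j, k) \<Rightarrow> F j k) = 0" by (simp add: jk)
    qed
  qed auto
  also have "\<dots> = (\<Sum>j\<in>{..<m}. F j m) + (\<Sum>k\<in>{m<..}. F m k)"
    by (subst sum.union_disjoint) (auto simp: sum.reindex inj_on_def)
  also have "\<dots> = (\<Sum>k\<in>{..<m} \<union> {m<..}. if k < m then F k m else if m < k then F m k else 0)"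
    by (subst sum.union_disjoint) (auto intro!: arg_cong2[of _ _ _ _ "(+)"] sum.cong)
  also have "\<dots> = (\<Sum>k\<in>UNIV. if k < m then F k m else if m < k then F m k else 0)"
    by (rule sum.mono_neutral_left) auto
  finally show ?thesis .
qed

lemma trace_mult_mat: "trace (A ** mat c) = c * trace (A :: 'a::comm_semiring_1^'n^'n)"
  by (simp add: trace_def matrix_matrix_mult_def mat_def if_distrib sum_distrib_left mult.commute cong: if_cong)

lemma mult_mat_commute: "A ** mat c = mat c ** (A :: 'a::comm_semiring_1^'n^'n)"
  by (simp add: vec_eq_iff matrix_matrix_mult_def mat_def if_distrib if_distribR mult.commute cong: if_cong)

lemma trace_uminus: "trace (- A) = - trace (A :: 'a::comm_ring_1^'n^'n)"
  by (simp add: trace_def sum_negf)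

lemma matrix_mult_minus_right: "A ** (- B) = - (A ** (B :: 'a::comm_ring_1^'n^'m))"
  by (simp add: vec_eq_iff matrix_matrix_mult_def sum_negf)

lemma matrix_mult_minus_left: "(- A) ** B = - (A ** (B :: 'a::comm_ring_1^'n^'m))"
  by (simp add: vec_eq_iff matrix_matrix_mult_def sum_negf)

context resolvent_test
begin

lemma dA_Inr: "dA (unit (Inr m)) l = mat (if l = m then 1 else 0)"
  by (auto simp: vec_eq_iff dA_nth mat_def unit_def)

lemma dA_Inl: "dA (unit (Inl p)) l = - basis_hermitian p"
  by (simp add: dA_def unit_def basis_hermitian_def vec_eq_iff mat_def)

text \<open>Moving the pole m affects only the pairs containing m, with the same sign on both sides
  of the order. The sums may run over all k because the summand k = m is 1 / 0 = 0.\<close>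

lemma log_derivatives_Inr:
  "dlog x (unit (Inr m)) = (\<Sum>k\<in>UNIV. 1 / (w x m - w x k)) - trace (R x m)"
  "ddlog x (unit (Inr m)) = trace (R x m ** R x m) - (\<Sum>k\<in>UNIV. (1 / (w x m - w x k))\<^sup>2)"
proof -
  define d where "d j k = complex_of_real (unit (Inr m) (Inr k) - unit (Inr m) (Inr j)) / (w x k - w x j)" for j k
  have d0: "d j k = 0" if "j \<noteq> m" "k \<noteq> m" for j k using that by (simp add: d_def unit_def)
  have d: "d k m = 1 / (w x m - w x k)" "d m k = 1 / (w x m - w x k)" if "k \<noteq> m" for k
    using that by (auto simp: d_def unit_def divide_simps)
  have "(\<Sum>(j, k)\<in>{(j, k). j < k}. d j k) = (\<Sum>k\<in>UNIV. 1 / (w x m - w x k))"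
    by (subst sum_pairs_through[where m=m]) (auto simp: d0 d intro!: sum.cong)
  moreover have "(\<Sum>(j, k)\<in>{(j, k). j < k}. (d j k)\<^sup>2) = (\<Sum>k\<in>UNIV. (1 / (w x m - w x k))\<^sup>2)"
    by (subst sum_pairs_through[where m=m]) (auto simp: d0 d intro!: sum.cong)
  moreover have "(\<Sum>l\<in>UNIV. trace (R x l ** dA (unit (Inr m)) l)) = trace (R x m)"
  proof -
    have "trace (R x l ** dA (unit (Inr m)) l) = (if l = m then trace (R x m) else 0)" for l
      by (simp add: dA_Inr trace_mult_mat)
    then show ?thesis by simp
  qed
  moreover have "(\<Sum>l\<in>UNIV. trace (R x l ** dA (unit (Inr m)) l ** R x l ** dA (unit (Inr m)) l)) = trace (R x m ** R x m)"
  proof -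
    have "trace (R x l ** dA (unit (Inr m)) l ** R x l ** dA (unit (Inr m)) l) = (if l = m then trace (R x m ** R x m) else 0)" for l
      by (simp add: dA_Inr trace_mult_mat)
    then show ?thesis by simp
  qed
  ultimately show "dlog x (unit (Inr m)) = (\<Sum>k\<in>UNIV. 1 / (w x m - w x k)) - trace (R x m)"
    "ddlog x (unit (Inr m)) = trace (R x m ** R x m) - (\<Sum>k\<in>UNIV. (1 / (w x m - w x k))\<^sup>2)"
    unfolding dlog_def ddlog_def d_def by simp_all
qed

lemma log_derivatives_Inl:
  "dlog x (unit (Inl p)) = (\<Sum>l\<in>UNIV. trace (R x l ** basis_hermitian p))"
  "ddlog x (unit (Inl p)) = (\<Sum>l\<in>UNIV. trace (R x l ** basis_hermitian p ** R x l ** basis_hermitian p))"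
  by (simp_all add: dlog_def ddlog_def dA_Inl matrix_mult_minus_right matrix_mult_minus_left trace_uminus sum_negf)
     (simp_all add: unit_def)

text \<open>The matrices of two poles differ by a scalar matrix, so the resolvent identity reduces
  the trace of a product to a difference of traces.\<close>

lemma trace_R_mult:
  assumes "l \<noteq> m"
  shows "trace (R x l ** R x m) = (trace (R x m) - trace (R x l)) * (1 / (w x l - w x m))"
proof -
  have "A x m - A x l = mat (w x m - w x l)"
    by (simp add: A_def vec_eq_iff mat_def)
  then have "R x l - R x m = R x l ** mat (w x m - w x l) ** R x m"
    unfolding R_def using matrix_inv_diff[OF det_A_nonzero det_A_nonzero, of x l x m] by simp
  also have "\<dots> = R x l ** R x m ** mat (w x m - w x l)"
    by (metis matrix_mul_assoc mult_mat_commute)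
  finally have "trace (R x l) - trace (R x m) = (w x m - w x l) * trace (R x l ** R x m)"
    by (metis trace_mult_mat trace_sub)
  then show ?thesis using assms by (simp add: field_simps)
qed

text \<open>The coordinates \<open>Inr l\<close> shift the poles, the coordinates \<open>Inl p\<close> move the Hermitian matrix.\<close>

lemma G_duality: "(\<Sum>e\<in>range Inr. G2 e x) = (\<Sum>e\<in>- range Inr. G2 e x)"
proof -
  define r where "r l = trace (R x l)" for l
  define u where "u m k = 1 / (w x m - w x k)" for m k
  define tt where "tt l m = trace (R x l ** R x m)" for l m
  have u_sym: "u l m = - u m l" for l m by (cases "l = m") (auto simp: u_def divide_simps)
  \<comment> \<open>For distinct indices this is the resolvent identity for two poles; on the
    diagonal the second summand vanishes.\<close>
  have tt: "tt l m = (if l = m then tt m m else 0) + (r m - r l) * u l m" for l m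
    using trace_R_mult[of l m x] by (auto simp: tt_def r_def u_def)
  have "(\<Sum>l\<in>UNIV. \<Sum>m\<in>UNIV. tt l m) = (\<Sum>l\<in>UNIV. \<Sum>m\<in>UNIV. (if l = m then tt m m else 0) + (r m - r l) * u l m)"
    by (intro sum.cong refl) (rule tt)
  also have "\<dots> = (\<Sum>m\<in>UNIV. tt m m) + (\<Sum>l\<in>UNIV. \<Sum>m\<in>UNIV. r m * u l m) - (\<Sum>l\<in>UNIV. \<Sum>m\<in>UNIV. r l * u l m)"
    by (simp add: sum.distrib sum_subtractf left_diff_distrib)
  also have "(\<Sum>l\<in>UNIV. \<Sum>m\<in>UNIV. r m * u l m) = - (\<Sum>l\<in>UNIV. \<Sum>m\<in>UNIV. r l * u l m)"
    by (subst sum.swap, subst u_sym) (simp add: sum_negf)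
  finally have sum_tt: "(\<Sum>l\<in>UNIV. \<Sum>m\<in>UNIV. tt l m) = (\<Sum>m\<in>UNIV. tt m m) - 2 * (\<Sum>l\<in>UNIV. r l * (\<Sum>m\<in>UNIV. u l m))"
    by (simp add: sum_distrib_left sum_negf)
  have "inj (w x)" by (auto simp: inj_def)
  from sum_reciprocal_differences[OF this]
  have uu: "(\<Sum>m\<in>UNIV. (\<Sum>k\<in>UNIV. u m k)\<^sup>2) = (\<Sum>m\<in>UNIV. \<Sum>k\<in>UNIV. (u m k)\<^sup>2)" by (simp add: u_def)
  have "(\<Sum>m\<in>UNIV. ddlog x (unit (Inr m)) + (dlog x (unit (Inr m)))\<^sup>2) =
      (\<Sum>m\<in>UNIV. tt m m - (\<Sum>k\<in>UNIV. (u m k)\<^sup>2) + ((\<Sum>k\<in>UNIV. u m k)\<^sup>2 - 2 * (r m * (\<Sum>k\<in>UNIV. u m k)) + r m * r m))"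
    by (simp add: log_derivatives_Inr tt_def u_def r_def power2_eq_square algebra_simps)
  \<comment> \<open>The squares of the reciprocal differences cancel by \<open>uu\<close>, and the
    mixed terms are precisely the off-diagonal traces according to \<open>sum_tt\<close>.\<close>
  also have "\<dots> = (\<Sum>l\<in>UNIV. \<Sum>m\<in>UNIV. tt l m) + (\<Sum>m\<in>UNIV. r m * r m)"
    unfolding sum_tt by (simp add: sum.distrib sum_subtractf uu sum_distrib_left)
  finally have Inr: "(\<Sum>m\<in>UNIV. ddlog x (unit (Inr m)) + (dlog x (unit (Inr m)))\<^sup>2) =
      (\<Sum>l\<in>UNIV. \<Sum>m\<in>UNIV. tt l m) + (\<Sum>m\<in>UNIV. r m * r m)" .
  \<comment> \<open>In the matrix directions the roles are exchanged: the second logarithmic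
    derivatives give products of traces, the squared first ones give traces of products.\<close>
  have "(\<Sum>p\<in>UNIV. ddlog x (unit (Inl p))) = (\<Sum>l\<in>UNIV. r l * r l)"
    unfolding log_derivatives_Inl by (subst sum.swap) (simp add: trace_mult_basis(2) r_def)
  moreover have "(\<Sum>p\<in>UNIV. (dlog x (unit (Inl p)))\<^sup>2) = (\<Sum>l\<in>UNIV. \<Sum>m\<in>UNIV. tt l m)"
  proof -
    have "(\<Sum>p\<in>UNIV. (dlog x (unit (Inl p)))\<^sup>2) =
        (\<Sum>p\<in>UNIV. \<Sum>l\<in>UNIV. \<Sum>m\<in>UNIV. trace (R x l ** basis_hermitian p) * trace (R x m ** basis_hermitian p))"
      by (simp add: log_derivatives_Inl power2_eq_square sum_product)
    also have "\<dots> = (\<Sum>l\<in>UNIV. \<Sum>p\<in>UNIV. \<Sum>m\<in>UNIV. trace (R x l ** basis_hermitian p) * trace (R x m ** basis_hermitian p))"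
      by (rule sum.swap)
    also have "\<dots> = (\<Sum>l\<in>UNIV. \<Sum>m\<in>UNIV. \<Sum>p\<in>UNIV. trace (R x l ** basis_hermitian p) * trace (R x m ** basis_hermitian p))"
      by (intro sum.cong refl sum.swap)
    finally show ?thesis by (simp add: trace_mult_basis(1) tt_def)
  qed
  ultimately have Inl: "(\<Sum>p\<in>UNIV. ddlog x (unit (Inl p)) + (dlog x (unit (Inl p)))\<^sup>2) =
      (\<Sum>l\<in>UNIV. \<Sum>m\<in>UNIV. tt l m) + (\<Sum>m\<in>UNIV. r m * r m)"
    by (simp add: sum.distrib)
  have rng: "- range Inr = range (Inl :: 'n \<times> 'n \<Rightarrow> 'n \<times> 'n + 'n)"
  proof (rule set_eqI)
    fix e :: "'n \<times> 'n + 'n"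
    show "e \<in> - range Inr \<longleftrightarrow> e \<in> range Inl" by (cases e) auto
  qed
  show ?thesis
    unfolding rng G2_def sum_distrib_right[symmetric] sum.reindex[OF inj_Inl] sum.reindex[OF inj_Inr] o_def
    by (simp only: Inl Inr)
qed

text \<open>Uniform in \<open>x\<close>, since the resolvent entries are bounded by 1/|Im z| and the
  differences of poles from below by the differences of imaginary parts, and neither bound sees the
  real shifts.\<close>

lemma ex_bound_dlog: "\<exists>K. 0 \<le> K \<and> (\<forall>x e. norm (dlog x (unit e)) \<le> K \<and> norm (ddlog x (unit e)) \<le> K)"
proof -
  define \<rho> where "\<rho> = (\<Sum>l\<in>UNIV. 1 / \<bar>Im (z l)\<bar>)"
  define C where "C = (\<Sum>e\<in>UNIV. \<Sum>l\<in>UNIV. \<Sum>i\<in>UNIV. \<Sum>j\<in>UNIV. norm (dA (unit e) l $ i $ j))"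
  define D where "D = (\<Sum>(j, k)\<in>{(j, k). j < (k::'n)}. 1 / \<bar>Im (z k) - Im (z j)\<bar>)"
  define D2 where "D2 = (\<Sum>(j, k)\<in>{(j, k). j < (k::'n)}. (1 / \<bar>Im (z k) - Im (z j)\<bar>)\<^sup>2)"
  define N where "N = real CARD('n)"
  have R: "norm (R x l $ i $ j) \<le> \<rho>" for x l i j
  proof -
    have "norm (R x l $ i $ j) \<le> 1 / \<bar>Im (w x l)\<bar>"
      unfolding R_def A_def by (rule hermitian_resolvent_bound[OF hermitian_sum]) (simp add: Im_nonzero)
    also have "\<dots> \<le> \<rho>" unfolding \<rho>_def using member_le_sum[of l UNIV "\<lambda>l. 1 / \<bar>Im (z l)\<bar>"] by simp
    finally show ?thesis .
  qed
  have dA: "norm (dA (unit e) l $ i $ j) \<le> C" for e l i j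
  proof -
    have "norm (dA (unit e) l $ i $ j) \<le> (\<Sum>j\<in>UNIV. norm (dA (unit e) l $ i $ j))"
      by (rule member_le_sum) auto
    also have "\<dots> \<le> (\<Sum>i\<in>UNIV. \<Sum>j\<in>UNIV. norm (dA (unit e) l $ i $ j))"
      by (rule member_le_sum[of i UNIV "\<lambda>i. \<Sum>j\<in>UNIV. norm (dA (unit e) l $ i $ j)"]) (auto intro!: sum_nonneg)
    also have "\<dots> \<le> (\<Sum>l\<in>UNIV. \<Sum>i\<in>UNIV. \<Sum>j\<in>UNIV. norm (dA (unit e) l $ i $ j))"
      by (rule member_le_sum[of l UNIV "\<lambda>l. \<Sum>i\<in>UNIV. \<Sum>j\<in>UNIV. norm (dA (unit e) l $ i $ j)"]) (auto intro!: sum_nonneg)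
    also have "\<dots> \<le> C" unfolding C_def
      by (rule member_le_sum[of e UNIV "\<lambda>e. \<Sum>l\<in>UNIV. \<Sum>i\<in>UNIV. \<Sum>j\<in>UNIV. norm (dA (unit e) l $ i $ j)"]) (auto intro!: sum_nonneg)
    finally show ?thesis .
  qed
  have q: "norm (complex_of_real (unit e (Inr k) - unit e (Inr j)) / (w x k - w x j)) \<le> 1 / \<bar>Im (z k) - Im (z j)\<bar>"
    if "j < k" for e x j k
  proof -
    have ne: "Im (z k) \<noteq> Im (z j)" using that Im_inj by (auto dest: injD)
    have "\<bar>Im (z k) - Im (z j)\<bar> \<le> norm (w x k - w x j)"
      using abs_Im_le_cmod[of "w x k - w x j"] by simp
    moreover have "norm (complex_of_real (unit e (Inr k) - unit e (Inr j))) \<le> 1"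
      by (auto simp: unit_def)
    ultimately show ?thesis unfolding norm_divide using ne by (intro frac_le) auto
  qed
  have RdA: "norm ((R x l ** dA (unit e) l) $ i $ j) \<le> N * (\<rho> * C)" for x l e i j
    unfolding N_def by (rule norm_matrix_mult_entry_le[OF R dA])
  have RdAR: "norm ((R x l ** dA (unit e) l ** R x l ** dA (unit e) l) $ i $ j) \<le> N * (N * (\<rho> * C) * (N * (\<rho> * C)))" for x l e i j
  proof -
    have "norm ((R x l ** dA (unit e) l ** (R x l ** dA (unit e) l)) $ i $ j) \<le> N * (N * (\<rho> * C) * (N * (\<rho> * C)))"
      unfolding N_def by (rule norm_matrix_mult_entry_le) (use RdA in \<open>simp_all add: N_def\<close>)
    then show ?thesis by (simp add: matrix_mul_assoc)
  qed
  define K1 where "K1 = D + N * (N * (N * (\<rho> * C)))"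
  define K2 where "K2 = N * (N * (N * (N * (\<rho> * C) * (N * (\<rho> * C))))) + D2"
  have "norm (dlog x (unit e)) \<le> K1" for x e
    unfolding dlog_def K1_def
  proof (rule order_trans[OF norm_triangle_ineq4 add_mono])
    show "norm (\<Sum>(j, k)\<in>{(j, k). j < k}. complex_of_real (unit e (Inr k) - unit e (Inr j)) / (w x k - w x j)) \<le> D"
      unfolding D_def by (rule order_trans[OF norm_sum sum_mono]) (use q in auto)
    have "norm (\<Sum>l\<in>UNIV. trace (R x l ** dA (unit e) l)) \<le> (\<Sum>l\<in>(UNIV::'n set). N * (N * (\<rho> * C)))"
      unfolding N_def by (rule order_trans[OF norm_sum sum_mono]) (rule norm_trace_le, use RdA in \<open>simp add: N_def\<close>)
    then show "norm (\<Sum>l\<in>UNIV. trace (R x l ** dA (unit e) l)) \<le> N * (N * (N * (\<rho> * C)))"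
      by (simp add: N_def)
  qed
  moreover have "norm (ddlog x (unit e)) \<le> K2" for x e
    unfolding ddlog_def K2_def
  proof (rule order_trans[OF norm_triangle_ineq4 add_mono])
    show "norm (\<Sum>(j, k)\<in>{(j, k). j < k}. (complex_of_real (unit e (Inr k) - unit e (Inr j)) / (w x k - w x j))\<^sup>2) \<le> D2"
      unfolding D2_def by (rule order_trans[OF norm_sum sum_mono]) (use q in \<open>auto simp: norm_power intro!: power_mono\<close>)
    have "norm (\<Sum>l\<in>UNIV. trace (R x l ** dA (unit e) l ** R x l ** dA (unit e) l)) \<le>
        (\<Sum>l\<in>(UNIV::'n set). N * (N * (N * (\<rho> * C) * (N * (\<rho> * C)))))"
      unfolding N_def by (rule order_trans[OF norm_sum sum_mono]) (rule norm_trace_le, use RdAR in \<open>simp add: N_def\<close>)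
    then show "norm (\<Sum>l\<in>UNIV. trace (R x l ** dA (unit e) l ** R x l ** dA (unit e) l)) \<le>
        N * (N * (N * (N * (\<rho> * C) * (N * (\<rho> * C)))))"
      by (simp add: N_def)
  qed
  ultimately show ?thesis
    by (intro exI[of _ "max 0 (max K1 K2)"]) (auto simp: le_max_iff_disj)
qed

text \<open>Only the Vandermonde factor grows; the reciprocal determinants are bounded through the
  imaginary parts of the poles.\<close>

lemma ex_bound_G: "\<exists>K k. 0 \<le> K \<and> (\<forall>x. norm (G x) \<le> K * (\<Prod>e\<in>UNIV. (1 + \<bar>x e\<bar>) ^ k))"
proof -
  obtain K k where K: "0 \<le> K"
    and vdm: "\<And>x. norm (vdm (\<lambda>l. z l + complex_of_real (x l))) \<le> K * (\<Prod>l\<in>UNIV. (1 + \<bar>x l\<bar>) ^ k)"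
    using ex_bound_vdm_shift[of z] by metis
  define C where "C = (\<Prod>l\<in>UNIV. (1 / \<bar>Im (z l)\<bar>) ^ CARD('n))"
  have C: "0 \<le> C" by (auto simp: C_def intro!: prod_nonneg)
  have "norm (G x) \<le> K * C * (\<Prod>e\<in>UNIV. (1 + \<bar>x e\<bar>) ^ k)" for x
  proof -
    have "(\<Prod>l\<in>UNIV. (1 + \<bar>x (Inr l)\<bar>) ^ k) = (\<Prod>e\<in>range Inr. (1 + \<bar>x e\<bar>) ^ k)"
      by (simp add: prod.reindex)
    also have "\<dots> \<le> (\<Prod>e\<in>UNIV. (1 + \<bar>x e\<bar>) ^ k)"
      by (rule prod_mono2) auto
    finally have v: "norm (vdm (w x)) \<le> K * (\<Prod>e\<in>UNIV. (1 + \<bar>x e\<bar>) ^ k)"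
      using vdm[of "\<lambda>l. x (Inr l)"] mult_left_mono[OF _ K] unfolding w_def by (meson order_trans)
    have "norm (\<Prod>l\<in>UNIV. 1 / det (A x l)) \<le> C"
      unfolding C_def prod_norm[symmetric]
    proof (rule prod_mono)
      fix l
      have "norm (1 / det (A x l)) \<le> (1 / \<bar>Im (w x l)\<bar>) ^ CARD('n)"
        unfolding A_def by (rule hermitian_det_resolvent_bound[OF hermitian_sum]) (simp add: Im_nonzero)
      then show "0 \<le> norm (1 / det (A x l)) \<and> norm (1 / det (A x l)) \<le> (1 / \<bar>Im (z l)\<bar>) ^ CARD('n)" by simp
    qed
    then have "norm (G x) \<le> K * (\<Prod>e\<in>UNIV. (1 + \<bar>x e\<bar>) ^ k) * C"
      unfolding G_def norm_mult by (intro mult_mono v mult_nonneg_nonneg K prod_nonneg) auto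
    then show ?thesis by (simp add: ac_simps)
  qed
  then show ?thesis using K C by (intro exI[of _ "K * C"] exI[of _ k]) auto
qed

lemma measurable_G:
  "G \<in> borel_measurable (Pi\<^sub>M UNIV (\<lambda>_. borel))"
  "(\<lambda>x. dlog x v) \<in> borel_measurable (Pi\<^sub>M UNIV (\<lambda>_. borel))"
  "(\<lambda>x. ddlog x v) \<in> borel_measurable (Pi\<^sub>M UNIV (\<lambda>_. borel))"
proof -
  let ?M = "Pi\<^sub>M UNIV (\<lambda>_. borel) :: ('n \<times> 'n + 'n \<Rightarrow> real) measure"
  have [measurable]: "(\<lambda>x. w x l) \<in> borel_measurable ?M" for l
    unfolding w_def by measurable
  have A: "(\<lambda>x. A x l $ i $ j) \<in> borel_measurable ?M" for l i j
    unfolding A_nth by (cases "i = j") auto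
  then have [measurable]: "(\<lambda>x. det (A x l)) \<in> borel_measurable ?M" for l by (rule borel_measurable_det)
  have "(\<lambda>x. if b = i then (if a = j then 1 else 0) else A x l $ a $ b) \<in> borel_measurable ?M" for a b i j l
    using A by (cases "b = i"; cases "a = j") auto
  then have "(\<lambda>x. det (\<chi> a b. if b = i then (if a = j then 1 else 0) else A x l $ a $ b)) \<in> borel_measurable ?M" for i j l
    by (intro borel_measurable_det) simp
  then have [measurable]: "(\<lambda>x. R x l $ i $ j) \<in> borel_measurable ?M" for l i j
    unfolding R_nth by simp
  show "G \<in> borel_measurable ?M"
    unfolding G_def[abs_def] vdm_def case_prod_unfold by measurable
  show "(\<lambda>x. dlog x v) \<in> borel_measurable ?M"
    unfolding dlog_def trace_def matrix_matrix_mult_def vec_lambda_beta case_prod_unfold by measurable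
  show "(\<lambda>x. ddlog x v) \<in> borel_measurable ?M"
    unfolding ddlog_def trace_def matrix_matrix_mult_def vec_lambda_beta case_prod_unfold by measurable
qed

lemma G_interpolation:
  "(\<integral>x. G (\<lambda>e. if e \<in> range Inr then x e else 0) \<partial>std_normals) =
   (\<integral>x. G (\<lambda>e. if e \<in> range Inr then 0 else x e) \<partial>std_normals)"
proof -
  obtain K k where K: "0 \<le> K" "\<And>x. norm (G x) \<le> K * (\<Prod>e\<in>UNIV. (1 + \<bar>x e\<bar>) ^ k)"
    using ex_bound_G by metis
  obtain B where B: "0 \<le> B" "\<And>x e. norm (dlog x (unit e)) \<le> B" "\<And>x e. norm (ddlog x (unit e)) \<le> B"
    using ex_bound_dlog by metis
  \<comment> \<open>The first factor dominates 1, \<open>B\<close> and \<open>B + B\<^sup>2\<close>,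
    the bounds for the multipliers of \<open>G\<close> in \<open>G\<close>, \<open>G1\<close> and
    \<open>G2\<close>.\<close>
  define K' where "K' = (1 + B + B\<^sup>2) * K"
  let ?W = "\<lambda>x. \<Prod>e\<in>UNIV. (1 + \<bar>x e\<bar>) ^ k"
  have bd: "norm (c * G x) \<le> K' * ?W x" if "norm c \<le> 1 + B + B\<^sup>2" for c x
    unfolding norm_mult K'_def mult.assoc by (intro mult_mono that K) (use B in auto)
  have 1: "norm (G x) \<le> K' * ?W x" for x using bd[of 1 x] B by simp
  have 2: "norm (G1 e x) \<le> K' * ?W x" for e x
    unfolding G1_def by (rule bd) (use B(1) B(2)[of x e] in \<open>simp add: add_increasing2\<close>)
  have 3: "norm (G2 e x) \<le> K' * ?W x" for e x
    unfolding G2_def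
  proof (rule bd, rule order_trans[OF norm_triangle_ineq])
    have "norm ((dlog x (unit e))\<^sup>2) \<le> B\<^sup>2"
      unfolding norm_power by (rule power_mono[OF B(2)]) simp
    then show "norm (ddlog x (unit e)) + norm ((dlog x (unit e))\<^sup>2) \<le> 1 + B + B\<^sup>2"
      using B(3)[of x e] by simp
  qed
  show ?thesis
  proof (rule gaussian_interpolation[where ?G1.0=G1 and ?G2.0=G2, OF G_deriv G1_deriv _ _ _ _ _ 1 2 3 G_duality])
    show "continuous_on UNIV (\<lambda>t. G1 e (c t))" if "\<And>e. continuous_on UNIV (\<lambda>t::real. c t e)" for e c
      unfolding G1_def by (intro continuous_intros continuous_dlog that)
    have c: "continuous_on UNIV (\<lambda>t. (x(e := t)) e')" for x e e'
      by (cases "e' = e") auto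
    show "continuous_on UNIV (\<lambda>t. G2 e (x(e := t)))" for e x
      unfolding G2_def by (intro continuous_intros continuous_dlog c)
  qed (use measurable_G in \<open>auto simp: G1_def[abs_def] G2_def[abs_def]\<close>)
qed

end

lemma integral_std_normals_marginal:
  fixes F :: "('a::finite \<Rightarrow> real) \<Rightarrow> complex" and g :: "'a \<Rightarrow> 'e::finite"
  assumes g: "inj g" and F: "F \<in> borel_measurable (Pi\<^sub>M UNIV (\<lambda>_. borel))"
  shows "(\<integral>x. F (\<lambda>a. x (g a)) \<partial>std_normals) = (\<integral>x. F x \<partial>std_normals)"
proof -
  have "distr std_normals std_normals (\<lambda>x. \<lambda>n\<in>UNIV. x (g n)) = (std_normals :: ('a \<Rightarrow> real) measure)"
    by (rule distr_PiM_reindex) (use g std_normal.prob_space_axioms in auto)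
  then have "(\<integral>x. F x \<partial>std_normals) = (\<integral>x. F x \<partial>distr std_normals std_normals (\<lambda>x. \<lambda>n\<in>UNIV. x (g n)))" by simp
  also have "\<dots> = (\<integral>x. F (\<lambda>n\<in>UNIV. x (g n)) \<partial>std_normals)"
  proof (rule integral_distr)
    show "(\<lambda>x. \<lambda>n\<in>UNIV. x (g n)) \<in> std_normals \<rightarrow>\<^sub>M std_normals"
      by (rule measurable_restrict) simp
  qed (use F in \<open>simp add: measurable_std_normals_iff\<close>)
  finally show ?thesis by (simp add: restrict_def)
qed

text \<open>The two ends of the interpolation depend on the matrix coordinates only and on the
  shifts only, so each integral reduces to the marginal of those coordinates.\<close>

lemma resolvent_duality:
  fixes z :: "'n::{finite,linorder} \<Rightarrow> complex" and X :: "complex^('n::{finite,linorder})^('n::{finite,linorder})"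
  assumes "hermitian X" "\<And>l. Im (z l) \<noteq> 0" "inj (\<lambda>l. Im (z l))"
  shows "(\<integral>x. vdm z * (\<Prod>l\<in>UNIV. 1 / det (mat (z l) - (X + hermitian_of x))) \<partial>std_normals) =
    (\<integral>y. vdm (\<lambda>l. z l + complex_of_real (y l)) *
      (\<Prod>l\<in>UNIV. 1 / det (mat (z l + complex_of_real (y l)) - X)) \<partial>std_normals)"
proof -
  interpret resolvent_test z X by unfold_locales (use assms in auto)
  have h0: "hermitian_of (\<lambda>_. 0) = (0 :: complex^('n::{finite,linorder})^('n::{finite,linorder}))"
    using hermitian_of_scaleR[of 0 "\<lambda>_. 0"] by simp
  have 1: "G (\<lambda>e. if e \<in> range Inr then x e else 0) = vdm (\<lambda>l. z l + complex_of_real (x (Inr l))) *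
      (\<Prod>l\<in>UNIV. 1 / det (mat (z l + complex_of_real (x (Inr l))) - X))" for x
    by (simp add: G_def w_def[abs_def] A_def h0 image_iff)
  have 2: "G (\<lambda>e. if e \<in> range Inr then 0 else x e) =
      vdm z * (\<Prod>l\<in>UNIV. 1 / det (mat (z l) - (X + hermitian_of (\<lambda>p. x (Inl p)))))" for x
    by (simp add: G_def w_def[abs_def] A_def image_iff)
  have m: "G \<in> borel_measurable (Pi\<^sub>M UNIV (\<lambda>_. borel))" by (rule measurable_G)
  have "(\<lambda>y. vdm (\<lambda>l. z l + complex_of_real (y l)) *
      (\<Prod>l\<in>UNIV. 1 / det (mat (z l + complex_of_real (y l)) - X))) =
      (\<lambda>y. G (\<lambda>e. case e of Inl p \<Rightarrow> 0 | Inr l \<Rightarrow> y l))"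
    by (simp add: G_def w_def[abs_def] A_def h0)
  also have "\<dots> \<in> borel_measurable (Pi\<^sub>M UNIV (\<lambda>_. borel))"
  proof (rule measurable_compose[OF _ m], rule measurable_PiM_single')
    fix e :: "'n \<times> 'n + 'n"
    show "(\<lambda>y. case e of Inl p \<Rightarrow> 0 | Inr l \<Rightarrow> y l) \<in> borel_measurable (Pi\<^sub>M UNIV (\<lambda>_. borel))"
      by (cases e) auto
  qed auto
  finally have m1: "(\<lambda>y. vdm (\<lambda>l. z l + complex_of_real (y l)) *
      (\<Prod>l\<in>UNIV. 1 / det (mat (z l + complex_of_real (y l)) - X))) \<in> borel_measurable (Pi\<^sub>M UNIV (\<lambda>_. borel))" .
  have "(\<lambda>x. vdm z * (\<Prod>l\<in>UNIV. 1 / det (mat (z l) - (X + hermitian_of x)))) =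
      (\<lambda>x. G (\<lambda>e. case e of Inl p \<Rightarrow> x p | Inr l \<Rightarrow> 0))"
    by (simp add: G_def w_def[abs_def] A_def)
  also have "\<dots> \<in> borel_measurable (Pi\<^sub>M UNIV (\<lambda>_. borel))"
  proof (rule measurable_compose[OF _ m], rule measurable_PiM_single')
    fix e :: "'n \<times> 'n + 'n"
    show "(\<lambda>y. case e of Inl p \<Rightarrow> y p | Inr l \<Rightarrow> 0) \<in> borel_measurable (Pi\<^sub>M UNIV (\<lambda>_. borel))"
      by (cases e) auto
  qed auto
  finally have m2: "(\<lambda>x. vdm z * (\<Prod>l\<in>UNIV. 1 / det (mat (z l) - (X + hermitian_of x)))) \<in> borel_measurable (Pi\<^sub>M UNIV (\<lambda>_. borel))" .
  show ?thesis
    using G_interpolation unfolding 1 2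
      integral_std_normals_marginal[OF inj_Inl m2] integral_std_normals_marginal[OF inj_Inr m1] by simp
qed

subsection \<open>Coordinates of the GUE\<close>

text \<open>Inverse to \<open>hermitian_of\<close> on Hermitian matrices. The factor
  \<open>sqrt 2\<close> brings the variance 1/2 of real and imaginary parts to 1.\<close>

definition gue_coords :: "complex^('n::{finite,linorder})^('n::{finite,linorder}) \<Rightarrow> 'n \<times> 'n \<Rightarrow> real" where
  "gue_coords A = (\<lambda>(i, j). if i = j then Re (A $ i $ i)
     else if i < j then sqrt 2 * Re (A $ i $ j) else sqrt 2 * Im (A $ j $ i))"

lemma hermitian_of_gue_coords:
  assumes "hermitian A"
  shows "hermitian_of (gue_coords A) = A"
proof -
  have h: "A $ i $ j = cnj (A $ j $ i)" for i j using assms unfolding hermitian_def by blast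
  show ?thesis
    unfolding vec_eq_iff
  proof (intro allI)
    fix i j
    show "hermitian_of (gue_coords A) $ i $ j = A $ i $ j"
    proof (cases i j rule: linorder_cases)
      case less
      then have "i \<noteq> j" "\<not> j < i" by simp_all
      with less show ?thesis by (simp add: hermitian_of_nth gue_coords_def complex_eq_iff)
    next
      case equal
      then show ?thesis using arg_cong[OF h[of i i], of Im]
        by (simp add: hermitian_of_nth gue_coords_def complex_eq_iff)
    next
      case greater
      then have "i \<noteq> j" "\<not> i < j" by simp_all
      with greater show ?thesis
        by (subst h[of i j]) (simp add: hermitian_of_nth gue_coords_def complex_eq_iff)
    qed
  qed
qed

lemma borel_measurable_matrix_nth [measurable (raw)]:
  fixes f :: "'b \<Rightarrow> complex^'n^'m"
  assumes "f \<in> borel_measurable M"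
  shows "(\<lambda>x. f x $ i $ j) \<in> borel_measurable M"
  by (rule measurable_compose[OF assms borel_measurable_continuous_onI]) (intro continuous_intros)

lemma closed_hermitian: "closed {A :: complex^'n^'n. hermitian A}"
  unfolding hermitian_def by (intro closed_Collect_all closed_Collect_eq continuous_intros)

lemma borel_measurable_hermitian_of: "hermitian_of \<in> borel_measurable (Pi\<^sub>M UNIV (\<lambda>_. borel))"
  unfolding hermitian_of_expand[abs_def] by measurable

text \<open>Regroups the n^2 real coordinates by the independent matrix entries on and above the
  diagonal, one coordinate on the diagonal and two above it.\<close>

lemma prod_over_pairs:
  fixes a :: "'n::{finite,linorder} \<times> 'n \<Rightarrow> 'a::comm_monoid_mult"
  shows "(\<Prod>(i, j)\<in>{(i, j). i \<le> j}. if i = j then a (i, i) else a (i, j) * a (j, i)) = (\<Prod>p\<in>UNIV. a p)"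
proof -
  let ?D = "{(i, j). i < (j::'n)}" and ?E = "{(i, j). i = (j::'n)}" and ?L = "{(i, j). j < (i::'n)}"
  have L: "(\<Prod>p\<in>?L. a p) = (\<Prod>(i, j)\<in>?D. a (j, i))"
    by (rule prod.reindex_bij_witness[of _ prod.swap prod.swap]) auto
  have "{(i, j). i \<le> (j::'n)} = ?E \<union> ?D" by auto
  then have "(\<Prod>(i, j)\<in>{(i, j). i \<le> j}. if i = j then a (i, i) else a (i, j) * a (j, i)) =
      (\<Prod>(i, j)\<in>?E. if i = j then a (i, i) else a (i, j) * a (j, i)) *
      (\<Prod>(i, j)\<in>?D. if i = j then a (i, i) else a (i, j) * a (j, i))"
    by (simp only:) (rule prod.union_disjoint, auto)
  also have "(\<Prod>(i, j)\<in>?E. if i = j then a (i, i) else a (i, j) * a (j, i)) = (\<Prod>p\<in>?E. a p)"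
    by (rule prod.cong) auto
  also have "(\<Prod>(i, j)\<in>?D. if i = j then a (i, i) else a (i, j) * a (j, i)) = (\<Prod>p\<in>?D. a p * a (prod.swap p))"
    by (rule prod.cong) auto
  also have "\<dots> = (\<Prod>p\<in>?D. a p) * (\<Prod>p\<in>?L. a p)"
    unfolding L by (simp add: prod.distrib case_prod_unfold prod.swap_def)
  also have "(\<Prod>p\<in>?E. a p) * ((\<Prod>p\<in>?D. a p) * (\<Prod>p\<in>?L. a p)) = (\<Prod>p\<in>?E \<union> (?D \<union> ?L). a p)"
    by (subst prod.union_disjoint; (subst prod.union_disjoint)?; auto)
  also have "?E \<union> (?D \<union> ?L) = UNIV" by auto
  finally show ?thesis .
qed

context prob_space
begin

lemma distributed_std_normal_prob:
  assumes "distributed M lborel X std_normal_density" "A \<in> sets borel"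
  shows "prob (X -` A \<inter> space M) = measure std_normal A"
proof -
  have "distr M lborel X = std_normal"
    unfolding std_normal_def by (rule distributed_distr_eq_density[OF assms(1)])
  moreover have "measure (distr M lborel X) A = prob (X -` A \<inter> space M)"
    by (rule measure_distr) (use assms distributed_measurable[OF assms(1)] in auto)
  ultimately show ?thesis by simp
qed

lemma distributed_scaled_std_normal:
  assumes "distributed M lborel X (normal_density 0 (sqrt (1/2)))"
  shows "distributed M lborel (\<lambda>\<omega>. sqrt 2 * X \<omega>) std_normal_density"
  using normal_density_affine[OF assms, of "sqrt 2" 0] by (simp flip: real_sqrt_mult)

text \<open>It suffices to compute the probability of boxes. Independence of the entries factors it
  over the pairs i \<le> j, and independence of real and imaginary part splits each off-diagonal
  factor once more.\<close>

lemma GUE_coords_distr: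
  fixes H :: "'a \<Rightarrow> complex^('n::{finite,linorder})^('n::{finite,linorder})"
  assumes H: "GUE M H" and rv[measurable]: "H \<in> borel_measurable M"
  shows "distr M (Pi\<^sub>M UNIV (\<lambda>_. borel)) (\<lambda>\<omega>. gue_coords (H \<omega>)) = std_normals"
proof (rule std_normal_prod.PiM_eqI)
  let ?X = "\<lambda>(i, j) \<omega>. H \<omega> $ i $ j"
  let ?K = "{(i, j). i \<le> (j::'n)}"
  let ?\<mu> = "measure std_normal"
  have c[measurable]: "(\<lambda>\<omega>. gue_coords (H \<omega>) p) \<in> borel_measurable M" for p
    by (cases p) (auto simp: gue_coords_def)
  have cm: "(\<lambda>\<omega>. gue_coords (H \<omega>)) \<in> measurable M (Pi\<^sub>M UNIV (\<lambda>_. borel))"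
    by (rule measurable_PiM_single') auto
  show "sets (distr M (Pi\<^sub>M UNIV (\<lambda>_. borel)) (\<lambda>\<omega>. gue_coords (H \<omega>))) = sets (std_normals :: ('n \<times> 'n \<Rightarrow> real) measure)"
    by (simp, rule sets_PiM_cong) auto
  fix A :: "'n \<times> 'n \<Rightarrow> real set" assume "\<And>p. p \<in> UNIV \<Longrightarrow> A p \<in> sets std_normal"
  then have A[measurable]: "A p \<in> sets borel" for p by simp
  \<comment> \<open>The constraints that the box puts on one complex entry: one interval condition
    on the diagonal, two above it.\<close>
  define B where "B = (\<lambda>(i, j). if i = j then {c. Re c \<in> A (i, i)}
      else {c. sqrt 2 * Re c \<in> A (i, j) \<and> sqrt 2 * Im c \<in> A (j, i)})"
  have B: "B p \<in> sets borel" for p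
  proof -
    have "{c. Re c \<in> A (i, i)} \<in> sets borel" for i
      using measurable_sets[OF borel_measurable_Re A[of "(i, i)"]] by (simp add: vimage_def)
    moreover have "{c. sqrt 2 * Re c \<in> A p \<and> sqrt 2 * Im c \<in> A q} \<in> sets borel" for p q
    proof -
      have "{c \<in> space borel. sqrt 2 * Re c \<in> A p \<and> sqrt 2 * Im c \<in> A q} \<in> sets borel" by measurable
      then show ?thesis by simp
    qed
    ultimately show ?thesis unfolding B_def by (cases p) auto
  qed
  have "(\<lambda>\<omega>. gue_coords (H \<omega>)) -` (Pi\<^sub>E UNIV A) \<inter> space M = (\<Inter>p\<in>?K. ?X p -` B p \<inter> space M)"
  proof (intro set_eqI iffI)
    fix \<omega> assume \<omega>: "\<omega> \<in> (\<lambda>\<omega>. gue_coords (H \<omega>)) -` (Pi\<^sub>E UNIV A) \<inter> space M"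
    then have 1: "gue_coords (H \<omega>) p \<in> A p" for p by auto
    have "H \<omega> $ i $ j \<in> B (i, j)" if "i \<le> j" for i j
      using that 1[of "(i, j)"] 1[of "(j, i)"]
      by (cases "i = j") (auto simp: B_def gue_coords_def split: if_splits)
    then show "\<omega> \<in> (\<Inter>p\<in>?K. ?X p -` B p \<inter> space M)" using \<omega> by auto
  next
    fix \<omega> assume \<omega>: "\<omega> \<in> (\<Inter>p\<in>?K. ?X p -` B p \<inter> space M)"
    have 1: "H \<omega> $ i $ j \<in> B (i, j)" if "i \<le> j" for i j
      using INT_D[OF \<omega>, of "(i, j)"] that by simp
    have "gue_coords (H \<omega>) (i, j) \<in> A (i, j)" for i j
    proof (cases i j rule: linorder_cases)
      case less then show ?thesis using 1[of i j] by (simp add: B_def gue_coords_def less_imp_neq)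
    next
      case equal then show ?thesis using 1[of i j] by (simp add: B_def gue_coords_def)
    next
      case greater
      then have "i \<noteq> j" "j \<noteq> i" "\<not> i < j" by simp_all
      then show ?thesis using 1[of j i] greater by (simp add: B_def gue_coords_def)
    qed
    moreover have "\<omega> \<in> space M" using INT_D[OF \<omega>, of "(i, i)" for i] by simp
    ultimately show "\<omega> \<in> (\<lambda>\<omega>. gue_coords (H \<omega>)) -` (Pi\<^sub>E UNIV A) \<inter> space M" by auto
  qed
  then have "prob ((\<lambda>\<omega>. gue_coords (H \<omega>)) -` (Pi\<^sub>E UNIV A) \<inter> space M) = (\<Prod>p\<in>?K. prob (?X p -` B p \<inter> space M))"
    using H unfolding GUE_def by (simp only:) (intro indep_varsD, auto simp: B)
  also have "\<dots> = (\<Prod>(i, j)\<in>?K. if i = j then ?\<mu> (A (i, i)) else ?\<mu> (A (i, j)) * ?\<mu> (A (j, i)))"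
  proof (rule prod.cong[OF refl])
    fix p assume "p \<in> ?K"
    then obtain i j where p: "p = (i, j)" "i \<le> j" by auto
    show "prob (?X p -` B p \<inter> space M) = (case p of (i, j) \<Rightarrow> if i = j then ?\<mu> (A (i, i)) else ?\<mu> (A (i, j)) * ?\<mu> (A (j, i)))"
    proof (cases "i = j")
      case True
      have "distributed M lborel (\<lambda>\<omega>. Re (H \<omega> $ i $ i)) std_normal_density" using H by (simp add: GUE_def)
      from distributed_std_normal_prob[OF this A] True show ?thesis
        by (simp add: p B_def vimage_def)
    next
      case False
      then have "i < j" using p by simp
      then have n: "standard_complex_normal M (\<lambda>\<omega>. H \<omega> $ i $ j)" using H by (simp add: GUE_def)
      define C where "C q = (\<lambda>t. sqrt 2 * t) -` A q" for q
      have C[measurable]: "C q \<in> sets borel" for q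
        unfolding C_def using measurable_sets[of "\<lambda>t. sqrt 2 * t" borel borel "A q"] by simp
      have "prob (?X p -` B p \<inter> space M) =
          prob ((\<lambda>\<omega>. (Re (H \<omega> $ i $ j), Im (H \<omega> $ i $ j))) -` (C (i, j) \<times> C (j, i)) \<inter> space M)"
        using False by (intro arg_cong[of _ _ prob]) (auto simp: p B_def C_def)
      also have "\<dots> = prob ((\<lambda>\<omega>. Re (H \<omega> $ i $ j)) -` C (i, j) \<inter> space M) * prob ((\<lambda>\<omega>. Im (H \<omega> $ i $ j)) -` C (j, i) \<inter> space M)"
        using n unfolding standard_complex_normal_def by (intro indep_varD) (auto simp: C)
      also have "prob ((\<lambda>\<omega>. Re (H \<omega> $ i $ j)) -` C (i, j) \<inter> space M) = ?\<mu> (A (i, j))"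
        using n distributed_std_normal_prob[OF distributed_scaled_std_normal A, of "\<lambda>\<omega>. Re (H \<omega> $ i $ j)" "(i, j)"]
        unfolding standard_complex_normal_def C_def by (simp add: vimage_def)
      also have "prob ((\<lambda>\<omega>. Im (H \<omega> $ i $ j)) -` C (j, i) \<inter> space M) = ?\<mu> (A (j, i))"
        using n distributed_std_normal_prob[OF distributed_scaled_std_normal A, of "\<lambda>\<omega>. Im (H \<omega> $ i $ j)" "(j, i)"]
        unfolding standard_complex_normal_def C_def by (simp add: vimage_def)
      finally show ?thesis using False by (simp add: p)
    qed
  qed
  also have "\<dots> = (\<Prod>p\<in>UNIV. ?\<mu> (A p))" by (rule prod_over_pairs)
  finally have "prob ((\<lambda>\<omega>. gue_coords (H \<omega>)) -` (Pi\<^sub>E UNIV A) \<inter> space M) = (\<Prod>p\<in>UNIV. ?\<mu> (A p))" .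
  moreover have "emeasure (distr M (Pi\<^sub>M UNIV (\<lambda>_. borel)) (\<lambda>\<omega>. gue_coords (H \<omega>))) (Pi\<^sub>E UNIV A) =
      emeasure M ((\<lambda>\<omega>. gue_coords (H \<omega>)) -` (Pi\<^sub>E UNIV A) \<inter> space M)"
    by (rule emeasure_distr[OF cm]) (rule sets_PiM_I_finite, auto)
  ultimately show "emeasure (distr M (Pi\<^sub>M UNIV (\<lambda>_. borel)) (\<lambda>\<omega>. gue_coords (H \<omega>))) (Pi\<^sub>E UNIV A) =
      (\<Prod>p\<in>UNIV. emeasure std_normal (A p))"
    by (simp add: emeasure_eq_measure std_normal.emeasure_eq_measure prod_ennreal)
qed simp

lemma GUE_distr:
  fixes H :: "'a \<Rightarrow> complex^('n::{finite,linorder})^('n::{finite,linorder})"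
  assumes H: "GUE M H" and rv: "H \<in> borel_measurable M"
  shows "distr M borel H = distr std_normals borel hermitian_of"
proof -
  have cm: "(\<lambda>\<omega>. gue_coords (H \<omega>)) \<in> measurable M (Pi\<^sub>M UNIV (\<lambda>_. borel))"
    by (rule measurable_PiM_single') (use rv in \<open>auto simp: gue_coords_def split: prod.splits\<close>)
  have "distr M borel H = distr M borel (hermitian_of \<circ> (\<lambda>\<omega>. gue_coords (H \<omega>)))"
    by (rule distr_cong) (use H in \<open>auto simp: GUE_def hermitian_of_gue_coords\<close>)
  also have "\<dots> = distr (distr M (Pi\<^sub>M UNIV (\<lambda>_. borel)) (\<lambda>\<omega>. gue_coords (H \<omega>))) borel hermitian_of"
    by (rule distr_distr[OF borel_measurable_hermitian_of cm, symmetric])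
  finally show ?thesis unfolding GUE_coords_distr[OF H rv] .
qed

text \<open>By independence the expectation is an iterated integral, so the duality can be applied
  for each fixed value of \<open>X\<close>.\<close>

lemma resolvent_expectation:
  fixes H X :: "'a \<Rightarrow> complex^('n::{finite,linorder})^('n::{finite,linorder})" and z :: "'n \<Rightarrow> complex"
  assumes H: "GUE M H" and X: "\<And>\<omega>. \<omega> \<in> space M \<Longrightarrow> hermitian (X \<omega>)"
    and indep: "indep_var borel H borel X"
    and z: "\<And>l. Im (z l) \<noteq> 0" "inj (\<lambda>l. Im (z l))"
  shows "(\<integral>\<omega>. vdm z * (\<Prod>l\<in>UNIV. 1 / det (mat (z l) - (H \<omega> + X \<omega>))) \<partial>M) =
    (\<integral>\<omega>. (\<integral>y. vdm (\<lambda>l. z l + complex_of_real (y l)) *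
      (\<Prod>l\<in>UNIV. 1 / det (mat (z l + complex_of_real (y l)) - X \<omega>)) \<partial>std_normals) \<partial>M)"
proof -
  \<comment> \<open>The cutoff outside the closed set of Hermitian matrices makes the test function
    bounded and Borel on the whole matrix space, as Fubini requires.\<close>
  define \<Phi> where "\<Phi> Y = (if hermitian Y then vdm z * (\<Prod>l\<in>UNIV. 1 / det (mat (z l) - Y)) else 0)"
    for Y :: "complex^('n::{finite,linorder})^('n::{finite,linorder})"
  have rv[measurable]: "H \<in> borel_measurable M" "X \<in> borel_measurable M"
    using indep indep_var_rv1 indep_var_rv2 by auto
  have dist: "distr M borel H \<Otimes>\<^sub>M distr M borel X = distr M (borel \<Otimes>\<^sub>M borel) (\<lambda>\<omega>. (H \<omega>, X \<omega>))"
    using indep unfolding indep_var_distribution_eq by simp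
  have \<Phi>[measurable]: "\<Phi> \<in> borel_measurable borel"
    unfolding \<Phi>_def
  proof (rule measurable_If)
    have "(\<lambda>Y::complex^('n::{finite,linorder})^('n::{finite,linorder}). (mat (z l) - Y) $ i $ j) \<in> borel_measurable borel" for l i j
      by measurable
    then have "(\<lambda>Y::complex^('n::{finite,linorder})^('n::{finite,linorder}). det (mat (z l) - Y)) \<in> borel_measurable borel" for l
      by (rule borel_measurable_det)
    then show "(\<lambda>Y::complex^('n::{finite,linorder})^('n::{finite,linorder}). vdm z * (\<Prod>l\<in>UNIV. 1 / det (mat (z l) - Y))) \<in> borel_measurable borel"
      by measurable
    show "{Y \<in> space borel. hermitian Y} \<in> sets borel"
      using borel_closed[OF closed_hermitian] by simp
  qed simp
  define C where "C = norm (vdm z) * (\<Prod>l\<in>UNIV. (1 / \<bar>Im (z l)\<bar>) ^ CARD('n))"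
  have C: "norm (\<Phi> Y) \<le> C" for Y
  proof (cases "hermitian Y")
    case True
    have "norm (\<Prod>l\<in>UNIV. 1 / det (mat (z l) - Y)) \<le> (\<Prod>l\<in>UNIV. (1 / \<bar>Im (z l)\<bar>) ^ CARD('n))"
      unfolding prod_norm[symmetric] by (intro prod_mono) (use True z in \<open>auto intro: hermitian_det_resolvent_bound\<close>)
    then show ?thesis using True by (simp add: \<Phi>_def C_def norm_mult mult_left_mono)
  next
    case False then show ?thesis by (auto simp: \<Phi>_def C_def intro!: mult_nonneg_nonneg prod_nonneg)
  qed
  interpret dH: prob_space "distr M borel H" by (rule prob_space_distr) simp
  interpret dX: prob_space "distr M borel X" by (rule prob_space_distr) simp
  interpret dHX: pair_prob_space "distr M borel H" "distr M borel X" ..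
  have hsum: "hermitian (A + B)" if "hermitian A" "hermitian B" for A B :: "complex^('n::{finite,linorder})^('n::{finite,linorder})"
    unfolding hermitian_def using that by (metis complex_cnj_add hermitian_def vector_add_component)
  have "(\<integral>\<omega>. vdm z * (\<Prod>l\<in>UNIV. 1 / det (mat (z l) - (H \<omega> + X \<omega>))) \<partial>M) = (\<integral>\<omega>. \<Phi> (H \<omega> + X \<omega>) \<partial>M)"
    by (rule Bochner_Integration.integral_cong[OF refl]) (use H X hsum in \<open>auto simp: \<Phi>_def GUE_def\<close>)
  also have "\<dots> = (\<integral>p. \<Phi> (fst p + snd p) \<partial>distr M (borel \<Otimes>\<^sub>M borel) (\<lambda>\<omega>. (H \<omega>, X \<omega>)))"
    by (subst integral_distr) auto
  also have "\<dots> = (\<integral>p. (case p of (h, x) \<Rightarrow> \<Phi> (h + x)) \<partial>(distr M borel H \<Otimes>\<^sub>M distr M borel X))"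
    unfolding dist by (simp add: case_prod_unfold)
  also have "\<dots> = (\<integral>x. (\<integral>h. \<Phi> (h + x) \<partial>distr M borel H) \<partial>distr M borel X)"
    by (rule dHX.integral_snd[symmetric], rule dHX.P.integrable_const_bound[where B=C]) (auto simp: C case_prod_unfold)
  also have "\<dots> = (\<integral>\<omega>. (\<integral>h. \<Phi> (h + X \<omega>) \<partial>distr M borel H) \<partial>M)"
    by (rule integral_distr) auto
  also have "\<dots> = (\<integral>\<omega>. (\<integral>y. vdm (\<lambda>l. z l + complex_of_real (y l)) *
      (\<Prod>l\<in>UNIV. 1 / det (mat (z l + complex_of_real (y l)) - X \<omega>)) \<partial>std_normals) \<partial>M)"
  proof (rule Bochner_Integration.integral_cong[OF refl])
    fix \<omega> assume "\<omega> \<in> space M"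
    then have h: "hermitian (X \<omega>)" by (rule X)
    have "(\<integral>h. \<Phi> (h + X \<omega>) \<partial>distr M borel H) = (\<integral>x. \<Phi> (hermitian_of x + X \<omega>) \<partial>std_normals)"
      unfolding GUE_distr[OF H rv(1)]
      by (rule integral_distr) (auto simp: measurable_std_normals_iff borel_measurable_hermitian_of)
    also have "\<dots> = (\<integral>x. vdm z * (\<Prod>l\<in>UNIV. 1 / det (mat (z l) - (X \<omega> + hermitian_of x))) \<partial>std_normals)"
      by (simp add: \<Phi>_def hsum hermitian_hermitian_of h add.commute)
    also have "\<dots> = (\<integral>y. vdm (\<lambda>l. z l + complex_of_real (y l)) *
      (\<Prod>l\<in>UNIV. 1 / det (mat (z l + complex_of_real (y l)) - X \<omega>)) \<partial>std_normals)"
      by (rule resolvent_duality[OF h z])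
    finally show "(\<integral>h. \<Phi> (h + X \<omega>) \<partial>distr M borel H) = (\<integral>y. vdm (\<lambda>l. z l + complex_of_real (y l)) *
      (\<Prod>l\<in>UNIV. 1 / det (mat (z l + complex_of_real (y l)) - X \<omega>)) \<partial>std_normals)" .
  qed
  finally show ?thesis .
qed

end

subsection \<open>Integrability of the functions of a polynomial ensemble\<close>

interpretation lborel_prod: product_sigma_finite "\<lambda>_. lborel :: real measure"
  by unfold_locales

abbreviation lborels :: "('n::finite \<Rightarrow> real) measure" where
  "lborels \<equiv> Pi\<^sub>M UNIV (\<lambda>_. lborel)"

lemma borel_measurable_vec_lambda:
  fixes f :: "'b \<Rightarrow> 'n::finite \<Rightarrow> real"
  assumes "\<And>i. (\<lambda>x. f x i) \<in> borel_measurable M"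
  shows "(\<lambda>x. \<chi> i. f x i) \<in> borel_measurable M"
  by (subst borel_measurable_euclidean_space) (use assms in \<open>auto simp: Basis_vec_def inner_axis\<close>)

lemma borel_measurable_vec_nth [measurable (raw)]:
  fixes f :: "'b \<Rightarrow> real^'n"
  assumes "f \<in> borel_measurable M"
  shows "(\<lambda>x. f x $ i) \<in> borel_measurable M"
  by (rule measurable_compose[OF assms borel_measurable_continuous_onI]) (intro continuous_intros)

lemma measurable_vec_lborels [measurable]: "(\<lambda>x. \<chi> i. x i) \<in> (lborels :: ('n::finite \<Rightarrow> real) measure) \<rightarrow>\<^sub>M borel"
  by (rule borel_measurable_vec_lambda) simp

lemma Basis_real_vec: "(Basis :: (real^'n) set) = range (\<lambda>i. axis i 1)"
  by (auto simp: Basis_vec_def)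

text \<open>Comparison on open boxes. It carries Fubini and the product formulas for the function
  space over to \<open>real^'n\<close>.\<close>

lemma lborel_eq_distr_lborels: "(lborel :: (real^'n) measure) = distr lborels borel (\<lambda>x. \<chi> i. x i)"
proof (rule lborel_eqI)
  fix l u :: "real^'n" assume le: "\<And>b. b \<in> Basis \<Longrightarrow> l \<bullet> b \<le> u \<bullet> b"
  have le': "l $ i \<le> u $ i" for i using le[of "axis i 1"] by (simp add: Basis_real_vec inner_axis)
  have "emeasure (distr lborels borel (\<lambda>x. \<chi> i. x i)) (box l u) =
      emeasure lborels ((\<lambda>x. \<chi> i. x i) -` box l u \<inter> space (lborels :: ('n \<Rightarrow> real) measure))"
    by (rule emeasure_distr) auto
  also have "(\<lambda>x. \<chi> i. x i) -` box l u \<inter> space (lborels :: ('n \<Rightarrow> real) measure) = Pi\<^sub>E UNIV (\<lambda>i. {l $ i <..< u $ i})"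
    by (auto simp: space_PiM mem_box Basis_real_vec inner_axis PiE_iff)
  also have "emeasure lborels \<dots> = (\<Prod>i\<in>UNIV. emeasure lborel {l $ i <..< u $ i})"
    by (rule lborel_prod.emeasure_PiM) auto
  also have "\<dots> = (\<Prod>i\<in>UNIV. ennreal (u $ i - l $ i))"
    using le' by simp
  also have "\<dots> = ennreal (\<Prod>i\<in>UNIV. u $ i - l $ i)"
    using le' by (intro prod_ennreal) simp
  also have "(\<Prod>i\<in>UNIV. u $ i - l $ i) = (\<Prod>b\<in>Basis. (u - l) \<bullet> b)"
    unfolding Basis_real_vec by (subst prod.reindex) (auto simp: inj_on_def axis_eq_axis inner_axis)
  finally show "emeasure (distr lborels borel (\<lambda>x. \<chi> i. x i)) (box l u) = (\<Prod>b\<in>Basis. (u - l) \<bullet> b)" .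
qed simp

lemma integral_lborel_vec:
  fixes f :: "real^'n \<Rightarrow> 'b::{banach,second_countable_topology}"
  assumes "f \<in> borel_measurable borel"
  shows "(\<integral>x. f x \<partial>lborel) = (\<integral>x. f (\<chi> i. x i) \<partial>lborels)"
  unfolding lborel_eq_distr_lborels by (rule integral_distr) (use assms in auto)

lemma integrable_lborel_vec:
  fixes f :: "real^'n \<Rightarrow> 'b::{banach,second_countable_topology}"
  assumes "f \<in> borel_measurable borel"
  shows "integrable lborel f \<longleftrightarrow> integrable lborels (\<lambda>x. f (\<chi> i. x i))"
  unfolding lborel_eq_distr_lborels by (rule integrable_distr_eq) (use assms in auto)

lemma AE_lborel_vec_iff:
  assumes "Measurable.pred borel P"
  shows "(AE x in (lborel :: (real^'n) measure). P x) \<longleftrightarrow> (AE x in lborels. P (\<chi> i. x i))"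
  unfolding lborel_eq_distr_lborels
  by (rule AE_distr_iff) (use assms in \<open>auto simp: pred_def\<close>)

text \<open>Fubini makes almost every section in coordinate i integrable as a statement on the other
  coordinates. To phrase it for almost every full vector, the exceptional set is extended as a
  cylinder along coordinate i, which is again a null set.\<close>

lemma AE_integrable_section:
  fixes p :: "real^'n \<Rightarrow> real"
  assumes p: "integrable lborel p"
  shows "AE x in lborel. integrable lborel (\<lambda>t. p (\<chi> j. if j = i then t else x $ j))"
proof -
  let ?I = "UNIV - {i}"
  define q where "q x = ennreal (norm (p (\<chi> j. x j)))" for x
  define N where "N x = (\<integral>\<^sup>+t. q (x(i := t)) \<partial>lborel)" for x :: "'n \<Rightarrow> real"
  have U: "insert i ?I = UNIV" by auto
  have pm[measurable]: "p \<in> borel_measurable borel" using p by auto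
  have qm: "q \<in> borel_measurable lborels" unfolding q_def by measurable
  have upd: "(\<lambda>(x, t). x(i := t)) \<in> Pi\<^sub>M J (\<lambda>_. lborel) \<Otimes>\<^sub>M lborel \<rightarrow>\<^sub>M lborels" if "insert i J = UNIV" for J
    using measurable_add_dim[of i J "\<lambda>_. lborel :: real measure"] that by simp
  have Nm: "N \<in> borel_measurable (Pi\<^sub>M J (\<lambda>_. lborel))" if "insert i J = UNIV" for J
    unfolding N_def using measurable_compose[OF upd[OF that] qm]
    by (intro lborel.borel_measurable_nn_integral) (simp add: case_prod_unfold)
  have "(\<integral>\<^sup>+x. q x \<partial>lborels) < \<infinity>"
    using p unfolding q_def integrable_lborel_vec[OF pm] by (simp add: integrable_iff_bounded)
  moreover have "(\<integral>\<^sup>+x. q x \<partial>lborels) = (\<integral>\<^sup>+x. N x \<partial>Pi\<^sub>M ?I (\<lambda>_. lborel))"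
    unfolding N_def using lborel_prod.product_nn_integral_insert[of ?I i q] qm by (simp add: U)
  ultimately have "AE x in Pi\<^sub>M ?I (\<lambda>_. lborel). N x \<noteq> \<infinity>"
    by (intro nn_integral_PInf_AE Nm U) auto
  then have "0 = (\<integral>\<^sup>+x. indicator {\<infinity>} (N x) \<partial>Pi\<^sub>M ?I (\<lambda>_. lborel :: real measure))"
    by (intro nn_integral_0_iff_AE[THEN iffD2, symmetric]) (use Nm[OF U] in \<open>auto simp: indicator_def elim!: eventually_mono\<close>)
  \<comment> \<open>\<open>N\<close> does not see coordinate i, so the inner integral is the
    indicator times the infinite length of the line; where the indicator is 0 this product is
    0.\<close>
  then have "(\<integral>\<^sup>+x. (\<integral>\<^sup>+t. indicator {\<infinity>} (N (x(i := t))) \<partial>lborel) \<partial>Pi\<^sub>M ?I (\<lambda>_. lborel)) = 0"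
  proof -
    have "N (x(i := t)) = N x" for x t by (simp add: N_def)
    moreover have "AE x in Pi\<^sub>M ?I (\<lambda>_. lborel). (indicator {\<infinity>} (N x) :: ennreal) = 0"
      using \<open>AE x in Pi\<^sub>M ?I (\<lambda>_. lborel). N x \<noteq> \<infinity>\<close> by (auto elim!: eventually_mono)
    then have "AE x in Pi\<^sub>M ?I (\<lambda>_. lborel :: real measure). (indicator {\<infinity>} (N x) :: ennreal) * \<infinity> = 0"
      by (auto elim!: eventually_mono)
    then have "(\<integral>\<^sup>+x. (indicator {\<infinity>} (N x) :: ennreal) * \<infinity> \<partial>Pi\<^sub>M ?I (\<lambda>_. lborel :: real measure)) = 0"
      by (subst nn_integral_0_iff_AE) (use Nm[OF U] in auto)
    ultimately show ?thesis by simp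
  qed
  then have "(\<integral>\<^sup>+x. indicator {\<infinity>} (N x) \<partial>lborels) = 0"
    using lborel_prod.product_nn_integral_insert[of ?I i "\<lambda>x. indicator {\<infinity>} (N x)"] Nm[of UNIV] by (simp add: U)
  then have "AE x in lborels. (indicator {\<infinity>} (N x) :: ennreal) = 0"
    by (subst (asm) nn_integral_0_iff_AE) (use Nm[of UNIV] in auto)
  then have AE: "AE x in lborels. N x < \<infinity>"
    by (auto elim!: eventually_mono simp: indicator_def less_top split: if_splits)
  define Q where "Q x \<longleftrightarrow> (\<integral>\<^sup>+t. ennreal (norm (p (\<chi> j. if j = i then t else x $ j))) \<partial>lborel) < \<infinity>" for x :: "real^'n"
  have vm: "(\<lambda>(x, t). \<chi> j. if j = i then t else x $ j) \<in> borel \<Otimes>\<^sub>M lborel \<rightarrow>\<^sub>M (borel :: (real^'n) measure)"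
    unfolding case_prod_unfold
  proof (rule borel_measurable_vec_lambda)
    fix j :: 'n
    show "(\<lambda>x. if j = i then snd x else fst x $ j) \<in> borel_measurable ((borel :: (real^'n) measure) \<Otimes>\<^sub>M lborel)"
    proof (cases "j = i")
      case False
      have "(\<lambda>x. fst x $ j) \<in> borel_measurable ((borel :: (real^'n) measure) \<Otimes>\<^sub>M lborel)"
        by (intro borel_measurable_vec_nth measurable_fst)
      with False show ?thesis by simp
    qed auto
  qed
  have pm': "(\<lambda>x. ennreal (norm (p x))) \<in> borel_measurable borel" by measurable
  have [measurable]: "(\<lambda>x. \<integral>\<^sup>+t. ennreal (norm (p (\<chi> j. if j = i then t else x $ j))) \<partial>lborel) \<in> borel_measurable borel"
    by (rule lborel.borel_measurable_nn_integral)
       (use measurable_compose[OF vm pm'] in \<open>simp add: case_prod_unfold\<close>)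
  have "Measurable.pred borel Q" unfolding Q_def by measurable
  moreover have "AE x in lborels. Q (\<chi> i. x i)"
    using AE unfolding Q_def N_def q_def by (auto elim!: eventually_mono simp: fun_upd_def cong: if_cong)
  ultimately have "AE x in lborel. Q x" by (simp add: AE_lborel_vec_iff)
  then show ?thesis
  proof (rule eventually_mono)
    fix x assume "Q x"
    moreover have "(\<lambda>t. p (\<chi> j. if j = i then t else x $ j)) \<in> borel_measurable lborel"
      using measurable_compose[OF _ measurable_compose[OF vm pm], of "\<lambda>t. (x, t)" lborel] by simp
    ultimately show "integrable lborel (\<lambda>t. p (\<chi> j. if j = i then t else x $ j))"
      by (simp add: Q_def integrable_iff_bounded)
  qed
qed

lemma AE_lborel_component_neq: "AE x in lborel. (x :: real^'n) $ i \<noteq> c"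
proof -
  have "negligible {x :: real^'n. axis i 1 \<bullet> x = c}"
    by (rule negligible_hyperplane) (simp add: axis_eq_0_iff)
  moreover have "{x :: real^'n. axis i 1 \<bullet> x = c} = {x. x $ i = c}"
    by (simp add: inner_axis')
  moreover have "{x :: real^'n. x $ i = c} \<in> sets borel"
  proof -
    have "{x \<in> space borel. (x :: real^'n) $ i = c} \<in> sets borel" by measurable
    then show ?thesis by simp
  qed
  ultimately have "{x :: real^'n. x $ i = c} \<in> null_sets lborel"
    by (simp add: negligible_iff_null_sets null_sets_def)
  then show ?thesis by (rule AE_I') auto
qed

lemma vandermonde_eq_vdm: "vandermonde x = vdm (($) x)"
  by (simp add: vandermonde_def vdm_def)

lemma borel_measurable_polynomial_ensemble [measurable]:
  fixes f :: "'n::{finite,linorder} \<Rightarrow> real \<Rightarrow> real"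
  assumes [measurable]: "\<And>k. f k \<in> borel_measurable borel"
  shows "polynomial_ensemble Z f \<in> borel_measurable borel"
proof -
  have "(\<lambda>x::real^('n::{finite,linorder}). det (\<chi> j k. f k (x $ j))) \<in> borel_measurable borel"
    by (rule borel_measurable_det) simp
  then show ?thesis
    unfolding polynomial_ensemble_def[abs_def] vandermonde_def case_prod_unfold
    using assms by (intro borel_measurable_times borel_measurable_const borel_measurable_prod) auto
qed

lemma card_pairs_through:
  fixes i :: "'n::{finite,linorder}"
  shows "(\<Sum>(j, k)\<in>{(j, k). j < k}. if j = i \<or> k = i then 1 else 0 :: nat) = CARD('n) - 1"
proof -
  have "(\<Sum>(j, k)\<in>{(j, k). j < k}. if j = i \<or> k = i then 1 else 0 :: nat) = (\<Sum>k\<in>(UNIV::'n set). if k = i then 0 else 1)"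
    by (subst sum_pairs_through[where m=i]) (auto intro!: sum.cong)
  also have "\<dots> = (\<Sum>k\<in>(UNIV::'n set) - {i}. 1)"
    by (rule sum.mono_neutral_cong_right) auto
  finally show ?thesis by simp
qed

text \<open>Exactly n - 1 factors involve the moved particle i. As long as \<open>t\<close> keeps
  the distance \<delta> from the old particles, each of them is comparable to
  \<open>1 + \<bar>t\<bar>\<close>; the remaining factors are nonzero constants.\<close>

lemma vandermonde_update_lower_bound:
  fixes x :: "real^('n::{finite,linorder})"
  assumes x: "inj (($) x)" and \<delta>: "0 < \<delta>"
  obtains c where "0 < c" "\<And>t. (\<And>j. \<delta> \<le> \<bar>t - x $ j\<bar>) \<Longrightarrow>
      c * (1 + \<bar>t\<bar>) ^ (CARD('n) - 1) \<le> \<bar>vandermonde (\<chi> j. if j = i then t else x $ j)\<bar>"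
proof -
  let ?D = "{(j, k). j < (k::'n)}"
  \<comment> \<open>Chosen from \<open>1 + \<bar>t\<bar> \<le> 1 + \<bar>x $ j\<bar> + \<bar>t - x $
    j\<bar>\<close> and \<open>\<delta> \<le> \<bar>t - x $ j\<bar>\<close>.\<close>
  define \<kappa> where "\<kappa> j = \<delta> / (1 + \<bar>x $ j\<bar> + \<delta>)" for j
  define c where "c = (\<lambda>(j, k). if k = i then \<kappa> j else if j = i then \<kappa> k else \<bar>x $ k - x $ j\<bar>)"
  have \<kappa>: "0 < \<kappa> j" for j using \<delta> by (auto simp: \<kappa>_def intro!: divide_pos_pos)
  have \<kappa>2: "\<kappa> j * (1 + \<bar>t\<bar>) \<le> \<bar>t - x $ j\<bar>" if t: "\<delta> \<le> \<bar>t - x $ j\<bar>" for t j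
  proof -
    have "\<delta> * (1 + \<bar>t\<bar>) \<le> \<delta> * (1 + \<bar>x $ j\<bar> + \<bar>t - x $ j\<bar>)"
      using \<delta> by (intro mult_left_mono) auto
    also have "\<dots> \<le> \<bar>t - x $ j\<bar> * (1 + \<bar>x $ j\<bar>) + \<delta> * \<bar>t - x $ j\<bar>"
      using mult_right_mono[OF t, of "1 + \<bar>x $ j\<bar>"] by (simp add: algebra_simps)
    finally show ?thesis using \<delta> by (simp add: \<kappa>_def field_simps)
  qed
  have cpos: "0 < c p" if "p \<in> ?D" for p
    using that \<kappa> x by (auto simp: c_def inj_eq)
  show thesis
  proof
    show "0 < (\<Prod>p\<in>?D. c p)" using cpos by (intro prod_pos) auto
    fix t assume t: "\<And>j. \<delta> \<le> \<bar>t - x $ j\<bar>"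
    define y where "y = (\<chi> j. if j = i then t else x $ j)"
    define h where "h = (\<lambda>(j, k). if j = i \<or> k = i then 1 else 0 :: nat)"
    have "(\<Prod>p\<in>?D. c p) * (1 + \<bar>t\<bar>) ^ (CARD('n) - 1) = (\<Prod>p\<in>?D. c p * (1 + \<bar>t\<bar>) ^ h p)"
    proof -
      have "sum h ?D = CARD('n) - 1"
        using card_pairs_through[of i] by (simp add: h_def)
      then show ?thesis by (simp add: prod.distrib flip: power_sum)
    qed
    also have "\<dots> \<le> (\<Prod>p\<in>?D. \<bar>case p of (j, k) \<Rightarrow> y $ k - y $ j\<bar>)"
    proof (rule prod_mono)
      fix p assume p: "p \<in> ?D"
      then obtain j k where jk: "p = (j, k)" "j < k" by auto
      then have "j \<noteq> k" by simp
      then have "c p * (1 + \<bar>t\<bar>) ^ h p \<le> \<bar>y $ k - y $ j\<bar>"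
        using \<kappa>2[OF t, of j] \<kappa>2[OF t, of k] by (auto simp: jk c_def h_def y_def abs_minus_commute)
      then show "0 \<le> c p * (1 + \<bar>t\<bar>) ^ h p \<and> c p * (1 + \<bar>t\<bar>) ^ h p \<le> \<bar>case p of (j, k) \<Rightarrow> y $ k - y $ j\<bar>"
        using cpos[OF p] by (simp add: jk)
    qed
    also have "\<dots> = \<bar>vandermonde y\<bar>" by (simp add: vandermonde_def abs_prod)
    finally show "(\<Prod>p\<in>?D. c p) * (1 + \<bar>t\<bar>) ^ (CARD('n) - 1) \<le> \<bar>vandermonde (\<chi> j. if j = i then t else x $ j)\<bar>"
      by (simp add: y_def)
  qed
qed

text \<open>Cramer's rule for row vectors. With \<open>v\<close> the row of values
  \<open>f k t\<close>, it recovers each value from the determinants in which one particle has been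
  moved to \<open>t\<close>.\<close>

lemma expand_along_rows:
  fixes A :: "'a::field^'n^'n" and v :: "'a^'n"
  assumes "det A \<noteq> 0"
  shows "v $ k = (\<Sum>i\<in>UNIV. det (\<chi> j. if j = i then v else A $ j) * A $ i $ k) / det A"
proof -
  define \<beta> where "\<beta> = v v* matrix_inv A"
  have "\<beta> v* A = v"
    by (simp add: \<beta>_def vector_matrix_mul_assoc matrix_inv_det_nonzero[OF assms])
  then have v: "(\<Sum>i\<in>UNIV. \<beta> $ i *s row i A) = v"
    by (simp add: vec_eq_iff vector_matrix_mult_def row_def mult.commute)
  have rowA: "row j A = A $ j" for j by (simp add: row_def vec_eq_iff)
  have "det (\<chi> j. if j = i then v else A $ j) = \<beta> $ i * det A" for i
    using cramer_lemma_transpose[of i \<beta> A] unfolding v by (simp only: rowA)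
  then have "(\<Sum>i\<in>UNIV. det (\<chi> j. if j = i then v else A $ j) * A $ i $ k) / det A = (\<Sum>i\<in>UNIV. \<beta> $ i * A $ i $ k)"
    using assms by (simp add: sum_divide_distrib)
  also have "\<dots> = v $ k" by (subst v[symmetric]) (simp add: row_def)
  finally show ?thesis by simp
qed

text \<open>A generic configuration recovers the functions from sections of the density.  Near the particles of
  that configuration the Vandermonde factor degenerates, so a second one with other particles is needed.\<close>

lemma polynomial_ensemble_integrable:
  fixes f :: "'n::{finite,linorder} \<Rightarrow> real \<Rightarrow> real"
  assumes f[measurable]: "\<And>k. f k \<in> borel_measurable borel"
    and int: "integrable lborel (polynomial_ensemble Z f)"
    and nz: "(\<integral>x. polynomial_ensemble Z f x \<partial>lborel) \<noteq> 0"
  shows "integrable lborel (\<lambda>t. (1 + \<bar>t\<bar>) ^ (CARD('n) - 1) * f k t)"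
proof -
  let ?p = "polynomial_ensemble Z f"
  define u :: "real^('n::{finite,linorder}) \<Rightarrow> 'n \<Rightarrow> real \<Rightarrow> real^('n::{finite,linorder})"
    where "u = (\<lambda>x i t. \<chi> j. if j = i then t else x $ j)"
  define good where "good x \<longleftrightarrow> (\<forall>i. integrable lborel (\<lambda>t. ?p (u x i t)))" for x
  have good: "AE x in lborel. good x"
    unfolding good_def u_def by (simp add: AE_all_countable AE_integrable_section[OF int])
  \<comment> \<open>The density has nonzero integral, so it cannot vanish wherever an almost sure
    property holds.\<close>
  have ex: "\<exists>x. ?p x \<noteq> 0 \<and> Q x" if Q: "AE x in lborel. Q x" for Q
  proof (rule ccontr)
    assume "\<nexists>x. ?p x \<noteq> 0 \<and> Q x"
    then have "AE x in lborel. ?p x = 0" using Q by (auto elim!: eventually_mono)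
    then have "(\<integral>x. ?p x \<partial>lborel) = 0" by (rule integral_eq_zero_AE)
    with nz show False by simp
  qed
  obtain x where x: "?p x \<noteq> 0" "good x" using ex[OF good] by auto
  have "AE y in lborel. good y \<and> (\<forall>i j. y $ i \<noteq> x $ j)"
    by (intro AE_conjI good) (simp add: AE_all_countable AE_lborel_component_neq)
  from ex[OF this] obtain y where y: "?p y \<noteq> 0" "good y" "\<And>i j. y $ i \<noteq> x $ j" by auto
  \<comment> \<open>Half the least distance between the two configurations: no \<open>t\<close> is
    within \<delta> of both, so one of the two lower bounds always applies.\<close>
  define \<delta> where "\<delta> = Min (range (\<lambda>(i, j). \<bar>y $ i - x $ j\<bar>)) / 2"
  have \<delta>pos: "0 < \<delta>" unfolding \<delta>_def using y(3) by (subst half_gt_zero_iff, subst Min_gr_iff) auto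
  have \<delta>: "2 * \<delta> \<le> \<bar>y $ i - x $ j\<bar>" for i j
  proof -
    have "\<bar>y $ i - x $ j\<bar> \<in> range (\<lambda>(i, j). \<bar>y $ i - x $ j\<bar>)"
      by (rule image_eqI[of _ _ "(i, j)"]) auto
    then show ?thesis by (simp add: \<delta>_def)
  qed
  let ?g = "\<lambda>x t. \<Sum>i\<in>UNIV. \<bar>?p (u x i t)\<bar>"
  have key: "\<exists>C\<ge>0. \<forall>t. (\<forall>j. \<delta> \<le> \<bar>t - x $ j\<bar>) \<longrightarrow> (1 + \<bar>t\<bar>) ^ (CARD('n) - 1) * \<bar>f k t\<bar> \<le> C * ?g x t"
    if x: "?p x \<noteq> 0" for x
  proof -
    define A where "A = (\<chi> j k. f k (x $ j))"
    have Z: "Z \<noteq> 0" and V: "vandermonde x \<noteq> 0" and A: "det A \<noteq> 0"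
      using x by (auto simp: polynomial_ensemble_def A_def)
    have inj: "inj (($) x)" using V by (simp add: vandermonde_eq_vdm vdm_eq_0_iff)
    have "\<exists>c>0. \<forall>t. (\<forall>j. \<delta> \<le> \<bar>t - x $ j\<bar>) \<longrightarrow>
        c * (1 + \<bar>t\<bar>) ^ (CARD('n) - 1) \<le> \<bar>vandermonde (u x i t)\<bar>" for i
      by (rule vandermonde_update_lower_bound[OF inj \<delta>pos, of i]) (auto simp: u_def)
    then obtain c where c0: "\<forall>i. 0 < c i \<and> (\<forall>t. (\<forall>j. \<delta> \<le> \<bar>t - x $ j\<bar>) \<longrightarrow>
        c i * (1 + \<bar>t\<bar>) ^ (CARD('n) - 1) \<le> \<bar>vandermonde (u x i t)\<bar>)"
      by metis
    then have c: "0 < c i" "(\<And>j. \<delta> \<le> \<bar>t - x $ j\<bar>) \<Longrightarrow>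
        c i * (1 + \<bar>t\<bar>) ^ (CARD('n) - 1) \<le> \<bar>vandermonde (u x i t)\<bar>" for i t
      by auto
    define C where "C = (\<Sum>i\<in>UNIV. \<bar>Z\<bar> / c i * \<bar>A $ i $ k\<bar> / \<bar>det A\<bar>)"
    have C: "0 \<le> C" unfolding C_def using c(1) by (intro sum_nonneg) (simp add: less_imp_le)
    moreover have "(1 + \<bar>t\<bar>) ^ (CARD('n) - 1) * \<bar>f k t\<bar> \<le> C * ?g x t"
      if t: "\<And>j. \<delta> \<le> \<bar>t - x $ j\<bar>" for t
    proof -
      let ?w = "(1 + \<bar>t\<bar>) ^ (CARD('n) - 1)"
      \<comment> \<open>The determinant with particle i moved to \<open>t\<close>. Dividing the
        section of the density by its Vandermonde factor bounds it, and these determinants give back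
        \<open>f k t\<close>.\<close>
      define d where "d i = det (\<chi> j. if j = i then (\<chi> k. f k t) else A $ j)" for i
      have du: "?p (u x i t) = 1 / Z * vandermonde (u x i t) * d i" for i
      proof -
        have "(\<chi> j k. f k (u x i t $ j)) = (\<chi> j. if j = i then (\<chi> k. f k t) else A $ j)"
          by (simp add: vec_eq_iff u_def A_def)
        then show ?thesis by (simp add: polynomial_ensemble_def d_def)
      qed
      have d: "?w * \<bar>d i\<bar> \<le> \<bar>Z\<bar> / c i * \<bar>?p (u x i t)\<bar>" for i
      proof -
        have "c i * ?w * \<bar>d i\<bar> \<le> \<bar>vandermonde (u x i t)\<bar> * \<bar>d i\<bar>"
          by (intro mult_right_mono c(2) t) auto
        also have "\<dots> = \<bar>Z\<bar> * \<bar>?p (u x i t)\<bar>" unfolding du using Z by (simp add: abs_mult)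
        finally show ?thesis using c(1)[of i] by (simp add: field_simps)
      qed
      have "f k t = (\<Sum>i\<in>UNIV. d i * A $ i $ k) / det A"
        using expand_along_rows[OF A, of "\<chi> k. f k t" k] by (simp add: d_def)
      then have "\<bar>f k t\<bar> \<le> (\<Sum>i\<in>UNIV. \<bar>d i\<bar> * \<bar>A $ i $ k\<bar>) / \<bar>det A\<bar>"
        by (simp add: abs_mult divide_right_mono order_trans[OF sum_abs])
      then have "?w * \<bar>f k t\<bar> \<le> ?w * ((\<Sum>i\<in>UNIV. \<bar>d i\<bar> * \<bar>A $ i $ k\<bar>) / \<bar>det A\<bar>)"
        by (intro mult_left_mono) auto
      also have "\<dots> = (\<Sum>i\<in>UNIV. (?w * \<bar>d i\<bar>) * (\<bar>A $ i $ k\<bar> / \<bar>det A\<bar>))"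
        by (simp add: sum_distrib_left sum_divide_distrib mult.assoc)
      also have "\<dots> \<le> (\<Sum>i\<in>UNIV. (\<bar>Z\<bar> / c i * \<bar>?p (u x i t)\<bar>) * (\<bar>A $ i $ k\<bar> / \<bar>det A\<bar>))"
        by (intro sum_mono mult_right_mono d) auto
      also have "\<dots> \<le> (\<Sum>i\<in>UNIV. (\<bar>Z\<bar> / c i * ?g x t) * (\<bar>A $ i $ k\<bar> / \<bar>det A\<bar>))"
      proof (intro sum_mono mult_right_mono mult_left_mono)
        show "\<bar>?p (u x i t)\<bar> \<le> ?g x t" for i by (rule member_le_sum) auto
      qed (use c(1) in \<open>auto simp: less_imp_le\<close>)
      also have "\<dots> = C * ?g x t"
        unfolding C_def by (subst sum_distrib_right) (simp add: ac_simps)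
      finally show ?thesis .
    qed
    ultimately show ?thesis by blast
  qed
  obtain C1 where C1: "0 \<le> C1" "\<And>t. (\<forall>j. \<delta> \<le> \<bar>t - x $ j\<bar>) \<Longrightarrow> (1 + \<bar>t\<bar>) ^ (CARD('n) - 1) * \<bar>f k t\<bar> \<le> C1 * ?g x t"
    using key[OF x(1)] by metis
  obtain C2 where C2: "0 \<le> C2" "\<And>t. (\<forall>j. \<delta> \<le> \<bar>t - y $ j\<bar>) \<Longrightarrow> (1 + \<bar>t\<bar>) ^ (CARD('n) - 1) * \<bar>f k t\<bar> \<le> C2 * ?g y t"
    using key[OF y(1)] by metis
  show ?thesis
  proof (rule Bochner_Integration.integrable_bound)
    show "integrable lborel (\<lambda>t. C1 * ?g x t + C2 * ?g y t)"
      using x(2) y(2) unfolding good_def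
      by (intro Bochner_Integration.integrable_add integrable_mult_right Bochner_Integration.integrable_sum integrable_abs) auto
    show "AE t in lborel. norm ((1 + \<bar>t\<bar>) ^ (CARD('n) - 1) * f k t) \<le> norm (C1 * ?g x t + C2 * ?g y t)"
    proof (rule AE_I2)
      fix t
      have g: "0 \<le> C1 * ?g x t" "0 \<le> C2 * ?g y t"
        using C1(1) C2(1) by (auto intro!: mult_nonneg_nonneg sum_nonneg)
      have "(\<forall>j. \<delta> \<le> \<bar>t - x $ j\<bar>) \<or> (\<forall>j. \<delta> \<le> \<bar>t - y $ j\<bar>)"
      proof (rule ccontr)
        assume "\<not> ?thesis"
        then obtain i j where "\<bar>t - x $ j\<bar> < \<delta>" "\<bar>t - y $ i\<bar> < \<delta>" by (auto simp: not_le)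
        then show False using \<delta>[of i j] by linarith
      qed
      then have "(1 + \<bar>t\<bar>) ^ (CARD('n) - 1) * \<bar>f k t\<bar> \<le> C1 * ?g x t + C2 * ?g y t"
      proof (elim disjE)
        assume "\<forall>j. \<delta> \<le> \<bar>t - x $ j\<bar>"
        from C1(2)[OF this] g show ?thesis by linarith
      next
        assume "\<forall>j. \<delta> \<le> \<bar>t - y $ j\<bar>"
        from C2(2)[OF this] g show ?thesis by linarith
      qed
      then show "norm ((1 + \<bar>t\<bar>) ^ (CARD('n) - 1) * f k t) \<le> norm (C1 * ?g x t + C2 * ?g y t)"
        using g by (simp add: abs_mult)
    qed
  qed simp
qed

subsection \<open>Resolvent expectations of the sum\<close>

lemma (in pair_sigma_finite) integrable_prod_mult:
  fixes a :: "'a \<Rightarrow> 'c::{real_normed_field,banach,second_countable_topology}"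
  assumes a: "integrable M1 a" and b: "integrable M2 b"
  shows "integrable (M1 \<Otimes>\<^sub>M M2) (\<lambda>(x, y). a x * b y)"
proof (rule Fubini_integrable)
  have [measurable]: "a \<in> borel_measurable M1" "b \<in> borel_measurable M2" using a b by auto
  show "(\<lambda>(x, y). a x * b y) \<in> borel_measurable (M1 \<Otimes>\<^sub>M M2)" by measurable
  show "integrable M1 (\<lambda>x. \<integral>y. norm (case (x, y) of (x, y) \<Rightarrow> a x * b y) \<partial>M2)"
    using a by (simp add: norm_mult)
  show "AE x in M1. integrable M2 (\<lambda>y. case (x, y) of (x, y) \<Rightarrow> a x * b y)"
    using b by simp
qed

lemma integrable_convolution_kernel:
  fixes a b :: "real \<Rightarrow> real"
  assumes a: "integrable lborel a" and b: "integrable lborel b"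
  shows "integrable (lborel \<Otimes>\<^sub>M lborel) (\<lambda>(t, y). a t * b (y - t))"
proof (rule lborel_pair.Fubini_integrable)
  have [measurable]: "a \<in> borel_measurable borel" "b \<in> borel_measurable borel" using a b by auto
  show "(\<lambda>(t, y). a t * b (y - t)) \<in> borel_measurable (lborel \<Otimes>\<^sub>M lborel)" by measurable
  have shift: "integrable lborel (\<lambda>y. b (y - t))" for t
    using lborel_integrable_real_affine[OF b, of 1 "- t"] by simp
  have "(\<integral>y. \<bar>b (y - t)\<bar> \<partial>lborel) = (\<integral>y. \<bar>b y\<bar> \<partial>lborel)" for t
    using lborel_integral_real_affine[of 1 "\<lambda>y. \<bar>b y\<bar>" "- t"] by simp
  then show "integrable lborel (\<lambda>t. \<integral>y. norm (case (t, y) of (t, y) \<Rightarrow> a t * b (y - t)) \<partial>lborel)"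
    using a by (simp add: abs_mult)
  show "AE t in lborel. integrable lborel (\<lambda>y. case (t, y) of (t, y) \<Rightarrow> a t * b (y - t))"
    using shift by simp
qed

text \<open>The kernel is not normalized: this is \<open>sqrt (2 * pi)\<close> times the convolution
  with the standard normal law.\<close>

definition gaussian_transform :: "(real \<Rightarrow> real) \<Rightarrow> real \<Rightarrow> real" where
  "gaussian_transform f y = (LINT t|lborel. f t * exp (- (1/2) * (y - t)\<^sup>2))"

lemma exp_eq_std_normal_density: "exp (- (1/2) * x\<^sup>2) = sqrt (2 * pi) * std_normal_density x"
  by (simp add: std_normal_density_def)

text \<open>The weight is submultiplicative, \<open>1 + \<bar>y\<bar> \<le> (1 + \<bar>t\<bar>) * (1
  + \<bar>y - t\<bar>)\<close>, so the weighted kernel is dominated by the convolution kernel of the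
  weighted \<open>f\<close> and the weighted Gaussian.\<close>

lemma gaussian_transform_kernel_integrable:
  fixes f :: "real \<Rightarrow> real"
  assumes "integrable lborel (\<lambda>t. (1 + \<bar>t\<bar>) ^ N * f t)"
  shows "integrable (lborel \<Otimes>\<^sub>M lborel) (\<lambda>(t, y). (1 + \<bar>y\<bar>) ^ N * (f t * exp (- (1/2) * (y - t)\<^sup>2)))"
proof (rule Bochner_Integration.integrable_bound)
  define a where "a t = (1 + \<bar>t\<bar>) ^ N * f t" for t
  define b where "b s = (1 + \<bar>s\<bar>) ^ N * exp (- (1/2) * s\<^sup>2)" for s :: real
  have a: "integrable lborel a" using assms by (simp add: a_def[abs_def])
  then have [measurable]: "a \<in> borel_measurable borel" by auto
  \<comment> \<open>Measurability of \<open>f\<close> is recovered from that of the weighted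
    function by dividing by the positive weight.\<close>
  have "f = (\<lambda>t::real. a t / (1 + \<bar>t\<bar>) ^ N)"
  proof
    fix t :: real
    have "1 + \<bar>t\<bar> \<noteq> 0" using abs_ge_zero[of t] by linarith
    then show "f t = a t / (1 + \<bar>t\<bar>) ^ N" by (simp add: a_def)
  qed
  also have "\<dots> \<in> borel_measurable borel" by measurable
  finally have [measurable]: "f \<in> borel_measurable borel" .
  have "b = (\<lambda>s. sqrt (2 * pi) * (std_normal_density s *\<^sub>R (1 + \<bar>s\<bar>) ^ N))"
    unfolding b_def exp_eq_std_normal_density by (simp add: ac_simps)
  moreover have "integrable lborel (\<lambda>s. std_normal_density s *\<^sub>R (1 + \<bar>s\<bar>) ^ N)"
    using integrable_std_normal_poly[of N] by (subst (asm) integrable_std_normal) auto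
  ultimately have b: "integrable lborel b" by simp
  show "integrable (lborel \<Otimes>\<^sub>M lborel) (\<lambda>(t, y). a t * b (y - t))"
    by (rule integrable_convolution_kernel[OF a b])
  show "(\<lambda>(t, y). (1 + \<bar>y\<bar>) ^ N * (f t * exp (- (1/2) * (y - t)\<^sup>2))) \<in> borel_measurable (lborel \<Otimes>\<^sub>M lborel)"
    by measurable
  have "norm ((1 + \<bar>y\<bar>) ^ N * (f t * exp (- (1/2) * (y - t)\<^sup>2))) \<le> norm (a t * b (y - t))" for t y
  proof -
    have "1 + \<bar>y\<bar> \<le> 1 + \<bar>t\<bar> + \<bar>y - t\<bar>" by simp
    also have "\<dots> \<le> (1 + \<bar>t\<bar>) * (1 + \<bar>y - t\<bar>)" by (simp add: algebra_simps)
    finally have "1 + \<bar>y\<bar> \<le> (1 + \<bar>t\<bar>) * (1 + \<bar>y - t\<bar>)" .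
    then have "(1 + \<bar>y\<bar>) ^ N \<le> ((1 + \<bar>t\<bar>) * (1 + \<bar>y - t\<bar>)) ^ N"
      by (intro power_mono) auto
    then have "(1 + \<bar>y\<bar>) ^ N * (\<bar>f t\<bar> * exp (- (1/2) * (y - t)\<^sup>2)) \<le>
        ((1 + \<bar>t\<bar>) * (1 + \<bar>y - t\<bar>)) ^ N * (\<bar>f t\<bar> * exp (- (1/2) * (y - t)\<^sup>2))"
      by (intro mult_right_mono) auto
    then show ?thesis by (simp add: a_def b_def abs_mult power_mult_distrib power_abs ac_simps)
  qed
  then show "AE p in lborel \<Otimes>\<^sub>M lborel. norm (case p of (t, y) \<Rightarrow> (1 + \<bar>y\<bar>) ^ N * (f t * exp (- (1/2) * (y - t)\<^sup>2))) \<le>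
      norm (case p of (t, y) \<Rightarrow> a t * b (y - t))"
    by (intro AE_I2) auto
qed

lemma gaussian_transform_integrable:
  assumes "integrable lborel (\<lambda>t. (1 + \<bar>t\<bar>) ^ N * f t)"
  shows "integrable lborel (\<lambda>y. (1 + \<bar>y\<bar>) ^ N * gaussian_transform f y)"
proof -
  have "integrable lborel (\<lambda>y. \<integral>t. (1 + \<bar>y\<bar>) ^ N * (f t * exp (- (1/2) * (y - t)\<^sup>2)) \<partial>lborel)"
    by (rule lborel_pair.integrable_snd[OF gaussian_transform_kernel_integrable[OF assms]])
  then show ?thesis by (simp add: gaussian_transform_def)
qed

lemma integrable_mult_bounded:
  fixes h :: "'a \<Rightarrow> real" and \<phi> :: "'a \<Rightarrow> complex"
  assumes h: "integrable M h" and \<phi>: "\<phi> \<in> borel_measurable M" "\<And>t. norm (\<phi> t) \<le> B"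
  shows "integrable M (\<lambda>t. complex_of_real (h t) * \<phi> t)"
proof (rule Bochner_Integration.integrable_bound[OF integrable_mult_right[OF h, of B]])
  show "AE t in M. norm (complex_of_real (h t) * \<phi> t) \<le> norm (B * h t)"
  proof (rule AE_I2)
    fix t
    have "norm (\<phi> t) \<le> \<bar>B\<bar>" using \<phi>(2)[of t] by linarith
    then show "norm (complex_of_real (h t) * \<phi> t) \<le> norm (B * h t)"
      using mult_right_mono[of "norm (\<phi> t)" "\<bar>B\<bar>" "\<bar>h t\<bar>"] by (simp add: norm_mult abs_mult mult.commute)
  qed
qed (use h \<phi> in auto)

text \<open>Fubini and the substitution y = t + s move the Gaussian from the function to a random
  translation of the test function.\<close>

lemma integral_gaussian_transform:
  fixes \<phi> :: "real \<Rightarrow> complex"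
  assumes f: "integrable lborel f" and \<phi>[measurable]: "\<phi> \<in> borel_measurable borel" and B: "\<And>t. norm (\<phi> t) \<le> B"
  shows "(\<integral>y. complex_of_real (gaussian_transform f y) * \<phi> y \<partial>lborel) =
    complex_of_real (sqrt (2 * pi)) * (\<integral>s. (\<integral>t. complex_of_real (f t) * \<phi> (t + s) \<partial>lborel) \<partial>std_normal)"
proof -
  have [measurable]: "f \<in> borel_measurable borel" using f by auto
  let ?k = "\<lambda>t y. exp (- (1/2) * (y - t)\<^sup>2)"
  have "integrable (lborel \<Otimes>\<^sub>M lborel) (\<lambda>(t, y). f t * ?k t y)"
    using gaussian_transform_kernel_integrable[of 0 f] f by simp
  then have int: "integrable (lborel \<Otimes>\<^sub>M lborel) (\<lambda>(t, y). complex_of_real (f t * ?k t y) * \<phi> y)"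
    using integrable_mult_bounded[of "lborel \<Otimes>\<^sub>M lborel" "\<lambda>(t, y). f t * ?k t y" "\<lambda>p. \<phi> (snd p)" B] B
    by (simp add: case_prod_unfold)
  interpret sl: pair_sigma_finite std_normal "lborel :: real measure" ..
  have "integrable (std_normal \<Otimes>\<^sub>M lborel) (\<lambda>(s, t). 1 * f t)"
    by (rule sl.integrable_prod_mult) (use f in auto)
  then have int2: "integrable (std_normal \<Otimes>\<^sub>M lborel) (\<lambda>(s, t). complex_of_real (f t) * \<phi> (t + s))"
    using integrable_mult_bounded[of "std_normal \<Otimes>\<^sub>M lborel" "\<lambda>(s, t). f t" "\<lambda>(s, t). \<phi> (t + s)" B] B
    by (simp add: case_prod_unfold)
  have "(\<integral>y. complex_of_real (gaussian_transform f y) * \<phi> y \<partial>lborel) =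
      (\<integral>y. (\<integral>t. complex_of_real (f t * ?k t y) * \<phi> y \<partial>lborel) \<partial>lborel)"
    unfolding gaussian_transform_def
    by (intro Bochner_Integration.integral_cong refl) (simp only: integral_mult_left_zero integral_complex_of_real)
  also have "\<dots> = (\<integral>t. (\<integral>y. complex_of_real (f t * ?k t y) * \<phi> y \<partial>lborel) \<partial>lborel)"
    by (rule lborel_pair.Fubini_integral[OF int])
  also have "\<dots> = (\<integral>t. complex_of_real (sqrt (2 * pi)) * (\<integral>s. complex_of_real (f t) * \<phi> (t + s) \<partial>std_normal) \<partial>lborel)"
  proof (rule Bochner_Integration.integral_cong[OF refl])
    fix t
    have "(\<integral>y. complex_of_real (f t * ?k t y) * \<phi> y \<partial>lborel) =
        (\<integral>s. complex_of_real (f t * exp (- (1/2) * s\<^sup>2)) * \<phi> (t + s) \<partial>lborel)"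
      using lborel_integral_real_affine[of 1 "\<lambda>y. complex_of_real (f t * ?k t y) * \<phi> y" t] by simp
    also have "\<dots> = (\<integral>s. complex_of_real (sqrt (2 * pi)) * (std_normal_density s *\<^sub>R (complex_of_real (f t) * \<phi> (t + s))) \<partial>lborel)"
      unfolding exp_eq_std_normal_density by (simp add: scaleR_conv_of_real ac_simps)
    also have "\<dots> = complex_of_real (sqrt (2 * pi)) * (\<integral>s. complex_of_real (f t) * \<phi> (t + s) \<partial>std_normal)"
      by (subst integral_std_normal, simp) (simp flip: integral_mult_right_zero)
    finally show "(\<integral>y. complex_of_real (f t * ?k t y) * \<phi> y \<partial>lborel) =
        complex_of_real (sqrt (2 * pi)) * (\<integral>s. complex_of_real (f t) * \<phi> (t + s) \<partial>std_normal)" .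
  qed
  also have "\<dots> = complex_of_real (sqrt (2 * pi)) * (\<integral>s. (\<integral>t. complex_of_real (f t) * \<phi> (t + s) \<partial>lborel) \<partial>std_normal)"
    using sl.Fubini_integral[OF int2] by simp
  finally show ?thesis .
qed

lemma of_real_det: "of_real (det A) = (det (\<chi> i j. of_real (A $ i $ j)) :: 'a::{real_normed_field})"
  by (simp add: det_def)

lemma integral_lborel_vec_prod:
  fixes h :: "'n::finite \<Rightarrow> real \<Rightarrow> complex"
  assumes h: "\<And>i. integrable lborel (h i)"
  shows "integrable lborel (\<lambda>y::real^'n. \<Prod>i\<in>UNIV. h i (y $ i))"
    "(\<integral>y. (\<Prod>i\<in>UNIV. h i (y $ i)) \<partial>(lborel :: (real^'n) measure)) = (\<Prod>i\<in>UNIV. integral\<^sup>L lborel (h i))"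
proof -
  have [measurable]: "h i \<in> borel_measurable borel" for i using h[of i] by auto
  have m: "(\<lambda>y::real^'n. \<Prod>i\<in>UNIV. h i (y $ i)) \<in> borel_measurable borel" by measurable
  show "integrable lborel (\<lambda>y::real^'n. \<Prod>i\<in>UNIV. h i (y $ i))"
    unfolding integrable_lborel_vec[OF m] using lborel_prod.product_integrable_prod[of UNIV h] h by simp
  show "(\<integral>y. (\<Prod>i\<in>UNIV. h i (y $ i)) \<partial>(lborel :: (real^'n) measure)) = (\<Prod>i\<in>UNIV. integral\<^sup>L lborel (h i))"
    unfolding integral_lborel_vec[OF m] using lborel_prod.product_integral_prod[of UNIV h] h by simp
qed

text \<open>Andreief's identity, left as a double sum over permutations instead of a single
  determinant: in this form every factor involves one function \<open>\<phi> l\<close>, hence later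
  one shift, and can be averaged separately.\<close>

lemma andreief_expansion:
  fixes h :: "'n::finite \<Rightarrow> real \<Rightarrow> real" and \<phi> :: "'n \<Rightarrow> real \<Rightarrow> complex"
  assumes h: "\<And>k. integrable lborel (h k)" and \<phi>: "\<And>l. \<phi> l \<in> borel_measurable borel" "\<And>l t. norm (\<phi> l t) \<le> B l"
  shows "integrable lborel (\<lambda>y::real^'n. complex_of_real (det (\<chi> j k. h k (y $ j))) * det (\<chi> l j. \<phi> l (y $ j)))"
    "(\<integral>y. complex_of_real (det (\<chi> j k. h k (y $ j))) * det (\<chi> l j. \<phi> l (y $ j)) \<partial>(lborel :: (real^'n) measure)) =
     (\<Sum>\<tau>\<in>{p. p permutes UNIV}. \<Sum>\<sigma>\<in>{p. p permutes UNIV}. of_int (sign \<tau>) * of_int (sign \<sigma>) *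
       (\<Prod>j\<in>UNIV. \<integral>t. complex_of_real (h (\<tau> j) t) * \<phi> (\<sigma> j) t \<partial>lborel))"
proof -
  have int: "integrable lborel (\<lambda>t. complex_of_real (h k t) * \<phi> l t)" for k l
    by (rule integrable_mult_bounded[OF h _ \<phi>(2)]) (use \<phi> in simp)
  have "complex_of_real (det (\<chi> j k. h k (y $ j))) * det (\<chi> l j. \<phi> l (y $ j)) =
      (\<Sum>\<tau>\<in>{p. p permutes UNIV}. \<Sum>\<sigma>\<in>{p. p permutes UNIV}. of_int (sign \<tau>) * of_int (sign \<sigma>) *
       (\<Prod>j\<in>UNIV. complex_of_real (h (\<tau> j) (y $ j)) * \<phi> (\<sigma> j) (y $ j)))" for y :: "real^'n"
  proof -
    have "det (\<chi> l j. \<phi> l (y $ j)) = det (\<chi> j l. \<phi> l (y $ j))"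
      using det_transpose[of "\<chi> j l. \<phi> l (y $ j)"] by (simp add: transpose_def)
    then show ?thesis
      unfolding of_real_det by (simp only: det_def sum_product vec_lambda_beta prod.distrib) (simp add: ac_simps)
  qed
  note eq = this
  note i = integral_lborel_vec_prod[of "\<lambda>j t. complex_of_real (h (\<tau> j) t) * \<phi> (\<sigma> j) t" for \<tau> \<sigma> :: "'n \<Rightarrow> 'n", OF int]
  show "integrable lborel (\<lambda>y::real^'n. complex_of_real (det (\<chi> j k. h k (y $ j))) * det (\<chi> l j. \<phi> l (y $ j)))"
    unfolding eq by (intro Bochner_Integration.integrable_sum integrable_mult_right i(1))
  show "(\<integral>y. complex_of_real (det (\<chi> j k. h k (y $ j))) * det (\<chi> l j. \<phi> l (y $ j)) \<partial>(lborel :: (real^'n) measure)) =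
     (\<Sum>\<tau>\<in>{p. p permutes UNIV}. \<Sum>\<sigma>\<in>{p. p permutes UNIV}. of_int (sign \<tau>) * of_int (sign \<sigma>) *
       (\<Prod>j\<in>UNIV. \<integral>t. complex_of_real (h (\<tau> j) t) * \<phi> (\<sigma> j) t \<partial>lborel))"
    unfolding eq
    by (subst Bochner_Integration.integral_sum, (intro Bochner_Integration.integrable_sum integrable_mult_right i(1)),
        intro sum.cong refl, subst Bochner_Integration.integral_sum, (intro integrable_mult_right i(1)),
        intro sum.cong refl) (simp add: i(2))
qed

lemma integrable_vdm_shift:
  "integrable std_normals (\<lambda>y. vdm (\<lambda>l. z l + complex_of_real (y l)))"
proof -
  obtain K k where "\<And>x. norm (vdm (\<lambda>l. z l + complex_of_real (x l))) \<le> K * (\<Prod>l\<in>UNIV. (1 + \<bar>x l\<bar>) ^ k)"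
    using ex_bound_vdm_shift[of z] by metis
  then show ?thesis
    by (rule integrable_std_normals_poly_bound[rotated]) (simp add: vdm_def case_prod_unfold)
qed

text \<open>The Vandermonde factor of the density together with that of \<open>w\<close> is what the
  Cauchy determinant needs; the sign appears twice and cancels. What remains is a product of two
  determinants.\<close>

lemma polynomial_ensemble_cauchy:
  fixes f :: "'n::{finite,linorder} \<Rightarrow> real \<Rightarrow> real" and w :: "'n \<Rightarrow> complex"
  assumes w: "\<And>l. Im (w l) \<noteq> 0"
  shows "complex_of_real (polynomial_ensemble Z f x) * (vdm w * (\<Prod>l\<in>UNIV. \<Prod>j\<in>UNIV. 1 / (w l - complex_of_real (x $ j)))) =
    (- 1) ^ card {(j, k). j < (k::'n)} / complex_of_real Z *
      (complex_of_real (det (\<chi> j k. f k (x $ j))) * det (\<chi> l j. 1 / (w l - complex_of_real (x $ j))))"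
proof -
  have ne: "w l \<noteq> complex_of_real (x $ j)" for l j using w[of l] by auto
  have v: "vdm (\<lambda>j. complex_of_real (x $ j)) = complex_of_real (vandermonde x)"
    by (simp add: vdm_def vandermonde_def case_prod_unfold)
  have "(- 1 :: complex) ^ k * (- 1) ^ k = 1" for k by (simp flip: power_mult_distrib)
  then have s: "(- 1 :: complex) ^ k * ((- 1) ^ k * a) = a" for k a by (simp flip: mult.assoc)
  show ?thesis
    unfolding det_cauchy[OF ne] v polynomial_ensemble_def by (simp add: s ac_simps)
qed

text \<open>The density is that of the image of a probability measure, so it has mass 1;
  nonnegativity allows the passage from the extended integral to the real one.\<close>

lemma has_eigenvalue_density_integrable:
  fixes A :: "'a \<Rightarrow> complex^('n::{finite,linorder})^('n::{finite,linorder})"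
  assumes M: "prob_space M" and h: "has_eigenvalue_density M A \<rho>" and \<rho>: "\<rho> \<in> borel_measurable borel"
  shows "integrable lborel \<rho>" "(\<integral>x. \<rho> x \<partial>lborel) = 1"
proof -
  let ?U = "uniform_count_measure {\<pi>. \<pi> permutes (UNIV :: 'n set)}"
  let ?X = "\<lambda>(\<omega>, \<pi>). \<chi> i. eigenvalues (A \<omega>) $ \<pi> i"
  have U: "prob_space ?U"
    by (rule prob_space_uniform_count_measure) (auto intro: exI[of _ id] permutes_id)
  interpret M: prob_space M by fact
  interpret U: prob_space ?U by fact
  interpret MU: pair_prob_space M ?U ..
  have D: "distributed (M \<Otimes>\<^sub>M ?U) lborel ?X (\<lambda>x. ennreal (\<rho> x))" and nn: "AE x in lborel. 0 \<le> \<rho> x"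
    using h by (simp_all add: has_eigenvalue_density_def)
  have "prob_space (density lborel (\<lambda>x. ennreal (\<rho> x)))"
    unfolding distributed_distr_eq_density[OF D, symmetric]
    by (rule MU.prob_space_distr[OF distributed_measurable[OF D]])
  then have "emeasure (density lborel (\<lambda>x. ennreal (\<rho> x))) (space lborel) = 1"
    by (metis prob_space.emeasure_space_1 space_density)
  then have 1: "(\<integral>\<^sup>+x. ennreal (\<rho> x) \<partial>lborel) = 1"
    by (subst (asm) emeasure_density) (use \<rho> in auto)
  then show int: "integrable lborel \<rho>"
    by (intro integrableI_nonneg) (use \<rho> nn in auto)
  show "(\<integral>x. \<rho> x \<partial>lborel) = 1"
    using nn_integral_eq_integral[OF int nn] 1 integral_nonneg_AE[OF nn] by (simp flip: ennreal_1)
qed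

text \<open>A symmetric function does not notice the random relabelling, so the permutation
  integrates out.\<close>

lemma has_eigenvalue_density_integral:
  fixes A :: "'a \<Rightarrow> complex^('n::{finite,linorder})^('n::{finite,linorder})" and g :: "real^('n::{finite,linorder}) \<Rightarrow> complex"
  assumes M: "prob_space M" and h: "has_eigenvalue_density M A \<rho>" and \<rho>: "\<rho> \<in> borel_measurable borel"
    and g: "g \<in> borel_measurable borel" and sym: "\<And>\<pi> x. \<pi> permutes UNIV \<Longrightarrow> g (\<chi> i. x $ \<pi> i) = g x"
  shows "(\<integral>\<omega>. g (eigenvalues (A \<omega>)) \<partial>M) = (\<integral>x. complex_of_real (\<rho> x) * g x \<partial>lborel)"
proof -
  let ?U = "uniform_count_measure {\<pi>. \<pi> permutes (UNIV :: 'n set)}"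
  let ?X = "\<lambda>(\<omega>, \<pi>). \<chi> i. eigenvalues (A \<omega>) $ \<pi> i"
  have U: "prob_space ?U"
    by (rule prob_space_uniform_count_measure) (auto intro: exI[of _ id] permutes_id)
  interpret M: prob_space M by fact
  interpret U: prob_space ?U by fact
  have D: "distributed (M \<Otimes>\<^sub>M ?U) lborel ?X (\<lambda>x. ennreal (\<rho> x))" and nn: "AE x in lborel. 0 \<le> \<rho> x"
    using h by (simp_all add: has_eigenvalue_density_def)
  have X: "?X \<in> M \<Otimes>\<^sub>M ?U \<rightarrow>\<^sub>M lborel" by (rule distributed_measurable[OF D])
  \<comment> \<open>Measurability in \<omega> alone is obtained from that of the pair by fixing the
    identity permutation.\<close>
  have "(\<lambda>\<omega>. g (?X (\<omega>, id))) \<in> borel_measurable M"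
    by (rule measurable_compose[OF _ measurable_compose[OF X]], rule measurable_Pair)
       (use g in \<open>auto simp: space_uniform_count_measure permutes_id\<close>)
  then have gm: "(\<lambda>\<omega>. g (eigenvalues (A \<omega>))) \<in> borel_measurable M" by simp
  have "(\<integral>x. complex_of_real (\<rho> x) * g x \<partial>lborel) = (\<integral>x. g x \<partial>density lborel (\<lambda>x. ennreal (\<rho> x)))"
    by (subst integral_density) (use g \<rho> nn in \<open>auto simp: scaleR_conv_of_real\<close>)
  also have "\<dots> = (\<integral>p. g (?X p) \<partial>(M \<Otimes>\<^sub>M ?U))"
    unfolding distributed_distr_eq_density[OF D, symmetric] by (rule integral_distr[OF X]) (use g in simp)
  also have "\<dots> = (\<integral>p. g (eigenvalues (A (fst p))) \<partial>(M \<Otimes>\<^sub>M ?U))"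
    by (rule Bochner_Integration.integral_cong[OF refl])
       (auto simp: space_pair_measure space_uniform_count_measure sym)
  also have "\<dots> = (\<integral>\<omega>. g (eigenvalues (A \<omega>)) \<partial>distr (M \<Otimes>\<^sub>M ?U) M fst)"
    by (rule integral_distr[symmetric]) (use gm in auto)
  finally show ?thesis by (simp add: U.distr_pair_fst)
qed

lemma integral_std_normal_minus:
  fixes h :: "real \<Rightarrow> complex"
  assumes [measurable]: "h \<in> borel_measurable borel"
  shows "(\<integral>s. h (- s) \<partial>std_normal) = (\<integral>s. h s \<partial>std_normal)"
proof -
  have "(\<integral>s. std_normal_density s *\<^sub>R h s \<partial>lborel) = (\<integral>s. std_normal_density (- s) *\<^sub>R h (- s) \<partial>lborel)"
    using lborel_integral_real_affine[of "- 1" "\<lambda>s. std_normal_density s *\<^sub>R h s" 0] by simp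
  then show ?thesis by (simp add: integral_std_normal)
qed

lemma norm_inverse_diff_real_le:
  assumes "Im z \<noteq> 0"
  shows "norm (1 / (z - complex_of_real x)) \<le> 1 / \<bar>Im z\<bar>"
  using norm_diff_real_ge[of z x] assms by (simp add: norm_divide frac_le)

text \<open>For fixed shifts the integral over the particles is an Andreief sum of products of the
  Cauchy transforms \<open>\<phi> k l\<close>, each depending on one shift. The independent shifts
  then average factor by factor, each average is the Cauchy transform of a
  \<open>gaussian_transform\<close> up to \<open>sqrt (2 * pi)\<close>, and Andreief's identity is
  read backwards.\<close>

lemma integral_vdm_cauchy_transform:
  fixes f :: "'n::{finite,linorder} \<Rightarrow> real \<Rightarrow> real" and z :: "'n \<Rightarrow> complex"
  assumes f: "\<And>k. integrable lborel (f k)" and p: "integrable lborel (polynomial_ensemble Z f)"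
    and z: "\<And>l. Im (z l) \<noteq> 0"
  shows "(\<integral>x. complex_of_real (polynomial_ensemble Z f x) * (\<integral>y. vdm (\<lambda>l. z l + complex_of_real (y l)) *
      (\<Prod>l\<in>UNIV. \<Prod>j\<in>UNIV. 1 / (z l + complex_of_real (y l) - complex_of_real (x $ j))) \<partial>std_normals) \<partial>lborel) =
    (\<integral>y. complex_of_real (polynomial_ensemble (Z * sqrt (2 * pi) ^ CARD('n)) (\<lambda>k. gaussian_transform (f k)) y) *
      (vdm z * (\<Prod>l\<in>UNIV. \<Prod>j\<in>UNIV. 1 / (z l - complex_of_real (y $ j)))) \<partial>lborel)"
proof -
  let ?n = "CARD('n)" and ?P = "{p. p permutes (UNIV::'n set)}"
  let ?p = "polynomial_ensemble Z f"
  define s where "s = (- 1 :: complex) ^ card {(j, k). j < (k::'n)}"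
  define W where "W x y = vdm (\<lambda>l. z l + complex_of_real (y l)) *
      (\<Prod>l\<in>UNIV. \<Prod>j\<in>UNIV. 1 / (z l + complex_of_real (y l) - complex_of_real (x $ j)))" for x :: "real^('n::{finite,linorder})" and y
  define \<phi> where "\<phi> k l u = (\<integral>t. complex_of_real (f k t) * (1 / (z l + complex_of_real u - complex_of_real t)) \<partial>lborel)" for k l u
  have [measurable]: "f k \<in> borel_measurable borel" for k using f[of k] by auto
  have pm[measurable]: "?p \<in> borel_measurable borel" using p by auto
  interpret SN: prob_space "std_normals :: ('n \<Rightarrow> real) measure" by (rule prob_space_std_normals)
  interpret PS: pair_sigma_finite "lborel :: (real^('n::{finite,linorder})) measure" "std_normals :: ('n \<Rightarrow> real) measure" ..
  have \<phi>m[measurable]: "\<phi> k l \<in> borel_measurable borel" for k l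
    unfolding \<phi>_def by (rule lborel.borel_measurable_lebesgue_integral) simp
  have \<phi>b: "norm (\<phi> k l u) \<le> (\<integral>t. \<bar>f k t\<bar> * (1 / \<bar>Im (z l)\<bar>) \<partial>lborel)" for k l u
    unfolding \<phi>_def
  proof (rule order_trans[OF integral_norm_bound integral_mono])
    show "integrable lborel (\<lambda>t. norm (complex_of_real (f k t) * (1 / (z l + complex_of_real u - complex_of_real t))))"
      by (rule integrable_norm, rule integrable_mult_bounded[OF f, where B="1 / \<bar>Im (z l)\<bar>"])
         (use norm_inverse_diff_real_le[of "z l + complex_of_real u"] z in auto)
    show "integrable lborel (\<lambda>t. \<bar>f k t\<bar> * (1 / \<bar>Im (z l)\<bar>))" using f[of k] by (intro integrable_mult_left integrable_abs)
    fix t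
    show "norm (complex_of_real (f k t) * (1 / (z l + complex_of_real u - complex_of_real t))) \<le> \<bar>f k t\<bar> * (1 / \<bar>Im (z l)\<bar>)"
      using mult_left_mono[OF norm_inverse_diff_real_le[of "z l + complex_of_real u" t], of "\<bar>f k t\<bar>"] z[of l]
      unfolding norm_mult by simp
  qed
  have \<phi>i: "integrable std_normal (\<phi> k l)" for k l
    by (rule std_normal.integrable_const_bound[of _ "\<integral>t. \<bar>f k t\<bar> * (1 / \<bar>Im (z l)\<bar>) \<partial>lborel"]) (use \<phi>b in auto)
  have inner: "(\<integral>x. complex_of_real (?p x) * W x y \<partial>lborel) =
      s / complex_of_real Z * (\<Sum>\<tau>\<in>?P. \<Sum>\<sigma>\<in>?P. of_int (sign \<tau>) * of_int (sign \<sigma>) * (\<Prod>j\<in>UNIV. \<phi> (\<tau> j) (\<sigma> j) (y (\<sigma> j))))" for y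
  proof -
    have im: "Im (z l + complex_of_real (y l)) \<noteq> 0" for l using z[of l] by simp
    have "(\<integral>x. complex_of_real (?p x) * W x y \<partial>lborel) =
        (\<integral>x. s / complex_of_real Z * (complex_of_real (det (\<chi> j k. f k (x $ j))) *
           det (\<chi> l j. 1 / (z l + complex_of_real (y l) - complex_of_real (x $ j)))) \<partial>lborel)"
      unfolding W_def s_def polynomial_ensemble_cauchy[OF im] ..
    also have "\<dots> = s / complex_of_real Z * (\<integral>x. complex_of_real (det (\<chi> j k. f k (x $ j))) *
           det (\<chi> l j. 1 / (z l + complex_of_real (y l) - complex_of_real (x $ j))) \<partial>lborel)"
      by (rule integral_mult_right_zero)
    also have "(\<integral>x. complex_of_real (det (\<chi> j k. f k (x $ j))) *
           det (\<chi> l j. 1 / (z l + complex_of_real (y l) - complex_of_real (x $ j))) \<partial>lborel) =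
        (\<Sum>\<tau>\<in>?P. \<Sum>\<sigma>\<in>?P. of_int (sign \<tau>) * of_int (sign \<sigma>) * (\<Prod>j\<in>UNIV. \<phi> (\<tau> j) (\<sigma> j) (y (\<sigma> j))))"
      unfolding \<phi>_def
      by (rule andreief_expansion(2)[OF f, where \<phi>="\<lambda>l t. 1 / (z l + complex_of_real (y l) - complex_of_real t)" and B="\<lambda>l. 1 / \<bar>Im (z l)\<bar>"])
         (use norm_inverse_diff_real_le[OF im] in auto)
    finally show ?thesis .
  qed
  have Wm[measurable]: "(\<lambda>(x, y). W x y) \<in> borel_measurable (lborel \<Otimes>\<^sub>M std_normals)"
  proof -
    have [measurable]: "(\<lambda>p. snd p l) \<in> borel_measurable ((lborel :: (real^('n::{finite,linorder})) measure) \<Otimes>\<^sub>M std_normals)" for l :: 'n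
      by (rule measurable_compose[OF measurable_snd]) (simp add: measurable_std_normals_iff)
    have [measurable]: "(\<lambda>p. fst p $ l) \<in> borel_measurable ((lborel :: (real^('n::{finite,linorder})) measure) \<Otimes>\<^sub>M (std_normals :: ('n \<Rightarrow> real) measure))" for l :: 'n
      by (rule borel_measurable_vec_nth) simp
    show ?thesis unfolding W_def vdm_def case_prod_unfold by measurable
  qed
  \<comment> \<open>The resolvent products are bounded by \<open>C\<close> uniformly in the shifts,
    so the integrand is dominated by a product of an integrable function of \<open>x\<close> and one
    of \<open>y\<close>.\<close>
  have int: "integrable (lborel \<Otimes>\<^sub>M std_normals) (\<lambda>(x, y). complex_of_real (?p x) * W x y)"
  proof (rule Bochner_Integration.integrable_bound)
    define C where "C = (\<Prod>l\<in>UNIV. \<Prod>j\<in>(UNIV::'n set). 1 / \<bar>Im (z l)\<bar>)"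
    show "integrable (lborel \<Otimes>\<^sub>M std_normals) (\<lambda>(x, y). (complex_of_real C * complex_of_real (?p x)) * vdm (\<lambda>l. z l + complex_of_real (y l)))"
      by (rule PS.integrable_prod_mult[OF _ integrable_vdm_shift]) (use p in auto)
    have C: "0 \<le> C" unfolding C_def by (intro prod_nonneg) auto
    show "AE q in lborel \<Otimes>\<^sub>M std_normals. norm (case q of (x, y) \<Rightarrow> complex_of_real (?p x) * W x y) \<le>
        norm (case q of (x, y) \<Rightarrow> (complex_of_real C * complex_of_real (?p x)) * vdm (\<lambda>l. z l + complex_of_real (y l)))"
    proof (rule AE_I2)
      fix q :: "(real^('n::{finite,linorder})) \<times> ('n \<Rightarrow> real)"
      obtain x y where q: "q = (x, y)" by (cases q)
      have "norm (\<Prod>l\<in>UNIV. \<Prod>j\<in>UNIV. 1 / (z l + complex_of_real (y l) - complex_of_real (x $ j))) \<le> C"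
        unfolding C_def prod_norm[symmetric]
        by (intro prod_mono conjI prod_nonneg) (use norm_inverse_diff_real_le[of "z l + complex_of_real (y l)" for l] z in auto)
      then have "norm (W x y) \<le> norm (vdm (\<lambda>l. z l + complex_of_real (y l))) * C"
        unfolding W_def norm_mult by (intro mult_left_mono) auto
      then have "norm (?p x) * norm (W x y) \<le> norm (?p x) * (norm (vdm (\<lambda>l. z l + complex_of_real (y l))) * C)"
        by (intro mult_left_mono) auto
      then show "norm (case q of (x, y) \<Rightarrow> complex_of_real (?p x) * W x y) \<le>
        norm (case q of (x, y) \<Rightarrow> (complex_of_real C * complex_of_real (?p x)) * vdm (\<lambda>l. z l + complex_of_real (y l)))"
        unfolding q using C by (simp add: norm_mult ac_simps)
    qed
  qed (use pm in \<open>simp add: case_prod_unfold\<close>)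
  \<comment> \<open>Shifting the pole by u is the same as shifting the integration variable by -u;
    the symmetry of the normal law absorbs the sign.\<close>
  have a: "(\<integral>t. complex_of_real (gaussian_transform (f k) t) * (1 / (z l - complex_of_real t)) \<partial>lborel) =
      complex_of_real (sqrt (2 * pi)) * (\<integral>u. \<phi> k l u \<partial>std_normal)" for k l
  proof -
    have "(\<integral>t. complex_of_real (gaussian_transform (f k) t) * (1 / (z l - complex_of_real t)) \<partial>lborel) =
      complex_of_real (sqrt (2 * pi)) * (\<integral>u. (\<integral>t. complex_of_real (f k t) * (1 / (z l - complex_of_real (t + u))) \<partial>lborel) \<partial>std_normal)"
      by (rule integral_gaussian_transform[OF f, where B="1 / \<bar>Im (z l)\<bar>"]) (use norm_inverse_diff_real_le z in auto)
    also have "(\<integral>u. (\<integral>t. complex_of_real (f k t) * (1 / (z l - complex_of_real (t + u))) \<partial>lborel) \<partial>std_normal) =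
        (\<integral>u. \<phi> k l (- u) \<partial>std_normal)"
      unfolding \<phi>_def by (simp add: algebra_simps)
    also have "\<dots> = (\<integral>u. \<phi> k l u \<partial>std_normal)" by (rule integral_std_normal_minus) simp
    finally show ?thesis .
  qed
  \<comment> \<open>Factor j carries the shift number \<sigma> j; reindexing lists the factors by
    their shift, so that each coordinate of \<open>y\<close> occurs exactly once.\<close>
  have reidx: "(\<Prod>j\<in>UNIV. h (\<tau> j) (\<sigma> j)) = (\<Prod>l\<in>UNIV. h (\<tau> (inv \<sigma> l)) l)" if "\<sigma> \<in> ?P" for h :: "'n \<Rightarrow> 'n \<Rightarrow> complex" and \<sigma> \<tau>
  proof -
    have "bij \<sigma>" using that by (simp add: permutes_bij)
    then show ?thesis
      using prod.reindex_bij_betw[of \<sigma> UNIV UNIV "\<lambda>l. h (\<tau> (inv \<sigma> l)) l"] by (simp add: bij_is_inj)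
  qed
  have \<phi>prod: "integrable std_normals (\<lambda>y. \<Prod>j\<in>UNIV. \<phi> (\<tau> j) (\<sigma> j) (y (\<sigma> j)))"
    "(\<integral>y. (\<Prod>j\<in>UNIV. \<phi> (\<tau> j) (\<sigma> j) (y (\<sigma> j))) \<partial>std_normals) = (\<Prod>j\<in>UNIV. \<integral>u. \<phi> (\<tau> j) (\<sigma> j) u \<partial>std_normal)"
    if "\<sigma> \<in> ?P" for \<tau> \<sigma>
  proof -
    have eq: "(\<lambda>y. \<Prod>j\<in>UNIV. \<phi> (\<tau> j) (\<sigma> j) (y (\<sigma> j))) = (\<lambda>y. \<Prod>l\<in>UNIV. \<phi> (\<tau> (inv \<sigma> l)) l (y l))"
      using reidx[OF that, of "\<lambda>k l. \<phi> k l (y l)" \<tau> for y] by simp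
    show "integrable std_normals (\<lambda>y. \<Prod>j\<in>UNIV. \<phi> (\<tau> j) (\<sigma> j) (y (\<sigma> j)))"
      unfolding eq by (rule std_normal_prod.product_integrable_prod) (auto intro: \<phi>i)
    show "(\<integral>y. (\<Prod>j\<in>UNIV. \<phi> (\<tau> j) (\<sigma> j) (y (\<sigma> j))) \<partial>std_normals) = (\<Prod>j\<in>UNIV. \<integral>u. \<phi> (\<tau> j) (\<sigma> j) u \<partial>std_normal)"
      unfolding eq reidx[OF that, of "\<lambda>k l. \<integral>u. \<phi> k l u \<partial>std_normal" \<tau>]
      by (rule std_normal_prod.product_integral_prod) (auto intro: \<phi>i)
  qed
  have "(\<integral>x. complex_of_real (?p x) * (\<integral>y. W x y \<partial>std_normals) \<partial>lborel) =
      (\<integral>x. (\<integral>y. complex_of_real (?p x) * W x y \<partial>std_normals) \<partial>lborel)"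
    by simp
  also have "\<dots> = (\<integral>y. (\<integral>x. complex_of_real (?p x) * W x y \<partial>lborel) \<partial>std_normals)"
    by (rule PS.Fubini_integral[OF int, symmetric])
  also have "\<dots> = s / complex_of_real Z * (\<Sum>\<tau>\<in>?P. \<Sum>\<sigma>\<in>?P. of_int (sign \<tau>) * of_int (sign \<sigma>) *
      (\<Prod>j\<in>UNIV. \<integral>u. \<phi> (\<tau> j) (\<sigma> j) u \<partial>std_normal))"
  proof -
    have "(\<integral>y. (\<Sum>\<tau>\<in>?P. \<Sum>\<sigma>\<in>?P. of_int (sign \<tau>) * of_int (sign \<sigma>) * (\<Prod>j\<in>UNIV. \<phi> (\<tau> j) (\<sigma> j) (y (\<sigma> j)))) \<partial>std_normals) =
        (\<Sum>\<tau>\<in>?P. \<Sum>\<sigma>\<in>?P. of_int (sign \<tau>) * of_int (sign \<sigma>) * (\<integral>y. (\<Prod>j\<in>UNIV. \<phi> (\<tau> j) (\<sigma> j) (y (\<sigma> j))) \<partial>std_normals))"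
      by (subst Bochner_Integration.integral_sum, (intro Bochner_Integration.integrable_sum integrable_mult_right \<phi>prod(1), assumption),
        intro sum.cong refl, subst Bochner_Integration.integral_sum, (intro integrable_mult_right \<phi>prod(1), assumption)) simp
    also have "\<dots> = (\<Sum>\<tau>\<in>?P. \<Sum>\<sigma>\<in>?P. of_int (sign \<tau>) * of_int (sign \<sigma>) * (\<Prod>j\<in>UNIV. \<integral>u. \<phi> (\<tau> j) (\<sigma> j) u \<partial>std_normal))"
      by (intro sum.cong refl) (simp only: \<phi>prod(2))
    finally show ?thesis unfolding inner integral_mult_right_zero by (rule arg_cong)
  qed
  also have "\<dots> = s / complex_of_real (Z * sqrt (2 * pi) ^ ?n) *
      (\<Sum>\<tau>\<in>?P. \<Sum>\<sigma>\<in>?P. of_int (sign \<tau>) * of_int (sign \<sigma>) *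
        (\<Prod>j\<in>UNIV. \<integral>t. complex_of_real (gaussian_transform (f (\<tau> j)) t) * (1 / (z (\<sigma> j) - complex_of_real t)) \<partial>lborel))"
  proof -
    have "(\<Prod>j\<in>(UNIV::'n set). complex_of_real (sqrt (2 * pi)) * b j) = complex_of_real (sqrt (2 * pi)) ^ ?n * prod b UNIV" for b
      by (simp add: prod.distrib)
    moreover have "complex_of_real (sqrt (2 * pi)) \<noteq> 0" by simp
    ultimately show ?thesis
      unfolding a by (simp add: sum_distrib_left ac_simps)
  qed
  also have "\<dots> = s / complex_of_real (Z * sqrt (2 * pi) ^ ?n) * (\<integral>y. complex_of_real (det (\<chi> j k. gaussian_transform (f k) (y $ j))) *
           det (\<chi> l j. 1 / (z l - complex_of_real (y $ j))) \<partial>lborel)"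
  proof (subst andreief_expansion(2)[where \<phi>="\<lambda>l t. 1 / (z l - complex_of_real t)" and B="\<lambda>l. 1 / \<bar>Im (z l)\<bar>"])
    show "integrable lborel (gaussian_transform (f k))" for k
      using gaussian_transform_integrable[of 0 "f k"] f by simp
  qed (use norm_inverse_diff_real_le[OF z] in auto)
  also have "\<dots> = (\<integral>y. s / complex_of_real (Z * sqrt (2 * pi) ^ ?n) * (complex_of_real (det (\<chi> j k. gaussian_transform (f k) (y $ j))) *
           det (\<chi> l j. 1 / (z l - complex_of_real (y $ j)))) \<partial>lborel)"
    by simp
  finally show ?thesis
    unfolding W_def s_def polynomial_ensemble_cauchy[OF z] .
qed

text \<open>The factor \<open>vdm z\<close> is carried along for the duality and cancelled at the
  end, which the distinct imaginary parts allow. The averaged test function depends on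
  \<open>X\<close> only through a symmetric function of its eigenvalues.\<close>

lemma (in prob_space) resolvent_expectation_polynomial_ensemble:
  fixes H X :: "'a \<Rightarrow> complex^('n::{finite,linorder})^('n::{finite,linorder})" and z :: "'n \<Rightarrow> complex"
  assumes H: "GUE M H" and X: "\<And>\<omega>. \<omega> \<in> space M \<Longrightarrow> hermitian (X \<omega>)"
    and indep: "indep_var borel H borel X"
    and f: "\<And>k. f k \<in> borel_measurable borel"
    and hd: "has_eigenvalue_density M X (polynomial_ensemble Z f)"
    and z: "\<And>l. Im (z l) \<noteq> 0" "inj (\<lambda>l. Im (z l))"
  shows "(\<integral>\<omega>. (\<Prod>l\<in>UNIV. 1 / det (mat (z l) - (H \<omega> + X \<omega>))) \<partial>M) =
    (\<integral>y. complex_of_real (polynomial_ensemble (Z * sqrt (2 * pi) ^ CARD('n)) (\<lambda>k. gaussian_transform (f k)) y) *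
      (\<Prod>l\<in>UNIV. \<Prod>j\<in>UNIV. 1 / (z l - complex_of_real (y $ j))) \<partial>lborel)"
proof -
  let ?p = "polynomial_ensemble Z f"
  let ?q = "polynomial_ensemble (Z * sqrt (2 * pi) ^ CARD('n)) (\<lambda>k. gaussian_transform (f k))"
  define W where "W x y = vdm (\<lambda>l. z l + complex_of_real (y l)) *
      (\<Prod>l\<in>UNIV. \<Prod>j\<in>UNIV. 1 / (z l + complex_of_real (y l) - complex_of_real (x $ j)))" for x :: "real^('n::{finite,linorder})" and y
  have p: "?p \<in> borel_measurable borel" using f by measurable
  note pint = has_eigenvalue_density_integrable[OF prob_space_axioms hd p]
  have fint: "integrable lborel (f k)" for k
  proof (rule Bochner_Integration.integrable_bound)
    show "integrable lborel (\<lambda>t. (1 + \<bar>t\<bar>) ^ (CARD('n) - 1) * f k t)"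
      by (rule polynomial_ensemble_integrable[OF f pint(1)]) (simp add: pint(2))
    have "1 * \<bar>f k t\<bar> \<le> (1 + \<bar>t\<bar>) ^ (CARD('n) - 1) * \<bar>f k t\<bar>" for t
      by (intro mult_right_mono one_le_power) auto
    then show "AE t in lborel. norm (f k t) \<le> norm ((1 + \<bar>t\<bar>) ^ (CARD('n) - 1) * f k t)"
      by (intro AE_I2) (simp add: abs_mult power_abs)
  qed (use f in simp)
  have vz: "vdm z \<noteq> 0"
    using z(2) by (auto simp: vdm_eq_0_iff inj_def)
  interpret SN: prob_space "std_normals :: ('n \<Rightarrow> real) measure" by (rule prob_space_std_normals)
  have Wm: "(\<lambda>x. \<integral>y. W x y \<partial>std_normals) \<in> borel_measurable borel"
  proof (rule sigma_finite_measure.borel_measurable_lebesgue_integral)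
    show "sigma_finite_measure (std_normals :: ('n \<Rightarrow> real) measure)" ..
    have [measurable]: "(\<lambda>p. snd p l) \<in> borel_measurable ((borel :: (real^('n::{finite,linorder})) measure) \<Otimes>\<^sub>M std_normals)" for l :: 'n
      by (rule measurable_compose[OF measurable_snd]) (simp add: measurable_std_normals_iff)
    have [measurable]: "(\<lambda>p. fst p $ l) \<in> borel_measurable ((borel :: (real^('n::{finite,linorder})) measure) \<Otimes>\<^sub>M (std_normals :: ('n \<Rightarrow> real) measure))" for l :: 'n
      by (rule borel_measurable_vec_nth) simp
    show "(\<lambda>(x, y). W x y) \<in> borel_measurable (borel \<Otimes>\<^sub>M std_normals)"
      unfolding W_def vdm_def case_prod_unfold by measurable
  qed
  have "vdm z * (\<integral>\<omega>. (\<Prod>l\<in>UNIV. 1 / det (mat (z l) - (H \<omega> + X \<omega>))) \<partial>M) =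
      (\<integral>\<omega>. vdm z * (\<Prod>l\<in>UNIV. 1 / det (mat (z l) - (H \<omega> + X \<omega>))) \<partial>M)"
    by simp
  also have "\<dots> = (\<integral>\<omega>. (\<integral>y. vdm (\<lambda>l. z l + complex_of_real (y l)) *
      (\<Prod>l\<in>UNIV. 1 / det (mat (z l + complex_of_real (y l)) - X \<omega>)) \<partial>std_normals) \<partial>M)"
    by (rule resolvent_expectation[OF H X indep z])
  also have "\<dots> = (\<integral>\<omega>. (\<integral>y. W (eigenvalues (X \<omega>)) y \<partial>std_normals) \<partial>M)"
    unfolding W_def
    by (rule Bochner_Integration.integral_cong[OF refl])
       (simp add: eigenvalues_spec(2)[OF X] prod_dividef)
  also have "\<dots> = (\<integral>x. complex_of_real (?p x) * (\<integral>y. W x y \<partial>std_normals) \<partial>lborel)"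
  proof (rule has_eigenvalue_density_integral[OF prob_space_axioms hd p Wm])
    fix \<pi> :: "'n \<Rightarrow> 'n" and x :: "real^('n::{finite,linorder})" assume \<pi>: "\<pi> permutes UNIV"
    have "(\<Prod>j\<in>UNIV. 1 / (w - complex_of_real (x $ \<pi> j))) = (\<Prod>j\<in>UNIV. 1 / (w - complex_of_real (x $ j)))" for w
      using prod.permute[OF \<pi>, of "\<lambda>j. 1 / (w - complex_of_real (x $ j))"] by (simp add: o_def)
    then show "(\<integral>y. W (\<chi> i. x $ \<pi> i) y \<partial>std_normals) = (\<integral>y. W x y \<partial>std_normals)"
      by (simp add: W_def)
  qed
  also have "\<dots> = (\<integral>y. complex_of_real (?q y) * (vdm z * (\<Prod>l\<in>UNIV. \<Prod>j\<in>UNIV. 1 / (z l - complex_of_real (y $ j)))) \<partial>lborel)"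
    unfolding W_def by (rule integral_vdm_cauchy_transform[OF fint pint(1) z(1)])
  also have "\<dots> = (\<integral>y. vdm z * (complex_of_real (?q y) * (\<Prod>l\<in>UNIV. \<Prod>j\<in>UNIV. 1 / (z l - complex_of_real (y $ j)))) \<partial>lborel)"
    by (simp add: ac_simps)
  also have "\<dots> = vdm z * (\<integral>y. complex_of_real (?q y) * (\<Prod>l\<in>UNIV. \<Prod>j\<in>UNIV. 1 / (z l - complex_of_real (y $ j))) \<partial>lborel)"
    by (rule integral_mult_right_zero)
  finally show ?thesis using vz by simp
qed

subsection \<open>Approximation by reciprocals of polynomials\<close>

lemma ex_poly_approx:
  fixes g :: "real \<Rightarrow> real"
  assumes "continuous_on {a..b} g" "0 < e"
  obtains p where "\<And>x. x \<in> {a..b} \<Longrightarrow> \<bar>g x - poly p x\<bar> < e"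
proof -
  obtain h where h: "real_polynomial_function h" "\<And>x. x \<in> {a..b} \<Longrightarrow> \<bar>g x - h x\<bar> < e"
    using Stone_Weierstrass_real_polynomial_function[OF compact_Icc assms] by metis
  obtain c n where "h = (\<lambda>x. \<Sum>i\<le>n. c i * x ^ i)"
    using h(1) real_polynomial_function_iff_sum by metis
  then have "h = poly (\<Sum>i\<le>n. monom (c i) i)"
    by (simp add: fun_eq_iff poly_sum poly_monom)
  with h(2) show thesis using that by metis
qed

text \<open>The squares keep the approximating polynomials away from 0 on the whole line, so that their
  reciprocals are bounded and have no real poles.\<close>

lemma ex_poly_reciprocal_approx:
  fixes u :: "real \<Rightarrow> real"
  assumes u: "continuous_on UNIV u" "\<And>x. 0 \<le> u x" "\<And>x. u x \<le> B"
  shows "\<exists>Q. d \<le> degree Q \<and> (\<forall>x. 1 / (B + 1) \<le> poly Q x) \<and>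
    (\<forall>x. \<bar>x\<bar> \<le> real N \<longrightarrow> \<bar>1 / poly Q x - u x\<bar> \<le> 2 / (real N + 1))"
proof -
  define M where "M = real N + 1"
  define c where "c = 1 / (B + 1)"
  \<comment> \<open>The summand \<open>1 / M\<close> keeps \<open>v\<close> at most \<open>M\<close>
    and costs an error \<open>1 / M\<close> in the reciprocal. Since \<open>v - c\<close> is
    nonnegative it has a square root \<open>h\<close>, so that \<open>c\<close> plus the square of a
    polynomial near \<open>h\<close> is close to \<open>v\<close> and never below
    \<open>c\<close>.\<close>
  define v where "v x = 1 / (u x + 1 / M)" for x
  define h where "h x = sqrt (v x - c)" for x
  \<comment> \<open>The error budget: polynomial and \<open>v\<close> are both at least
    \<open>c\<close>, so a deviation \<delta> changes the reciprocal by at most \<delta> / c^2 = 1 /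
    M. One half is spent on the square through \<epsilon>, using
    \<open>\<bar>h x + poly T x\<bar> \<le> 2 * M + 1\<close>, the other half on the leading
    term.\<close>
  define \<delta> where "\<delta> = c\<^sup>2 / M"
  define \<epsilon> where "\<epsilon> = min 1 (\<delta> / (2 * (2 * M + 1)))"
  have M: "1 \<le> M" by (simp add: M_def)
  have B: "0 \<le> B" using u(2,3) order_trans by blast
  then have c: "0 < c" by (simp add: c_def)
  have \<delta>: "0 < \<delta>" using c M by (simp add: \<delta>_def)
  have \<epsilon>: "0 < \<epsilon>" using \<delta> M by (simp add: \<epsilon>_def)
  have v: "c \<le> v x" "v x \<le> M" for x
  proof -
    have "u x + 1 / M \<le> B + 1" using u(3)[of x] M by (intro add_mono) auto
    moreover have "0 < u x + 1 / M" using u(2)[of x] M by (intro add_nonneg_pos) auto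
    ultimately show "c \<le> v x" unfolding c_def v_def by (intro divide_left_mono) auto
    have "1 / (u x + 1 / M) \<le> 1 / (1 / M)"
      using u(2)[of x] M \<open>0 < u x + 1 / M\<close> by (intro divide_left_mono) (auto intro!: divide_pos_pos)
    then show "v x \<le> M" by (simp add: v_def)
  qed
  have h: "0 \<le> h x" "(h x)\<^sup>2 = v x - c" "h x \<le> M" for x
  proof -
    show "0 \<le> h x" "(h x)\<^sup>2 = v x - c" using v(1)[of x] by (simp_all add: h_def)
    have "h x \<le> sqrt M" unfolding h_def using v(2)[of x] c by simp
    also have "\<dots> \<le> sqrt (M * M)" using M by (intro real_sqrt_le_mono) simp
    finally show "h x \<le> M" using M by simp
  qed
  have "u x + 1 / M \<noteq> 0" for x using u(2)[of x] M by (smt (verit) divide_pos_pos)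
  then have "continuous_on {- real N..real N} h"
    unfolding h_def v_def by (intro continuous_intros continuous_on_subset[OF u(1)]) auto
  from ex_poly_approx[OF this \<epsilon>] obtain T where T: "\<And>x. x \<in> {- real N..real N} \<Longrightarrow> \<bar>h x - poly T x\<bar> < \<epsilon>"
    by metis
  \<comment> \<open>The coefficient of an extra leading term. Its even exponent \<open>m\<close>
    keeps it nonnegative and raises the degree above \<open>d\<close>; on the interval considered it
    contributes at most \<delta> / 2.\<close>
  define e where "e = \<delta> / (2 * M ^ (2 * (d + degree T + 1)))"
  have e: "0 < e" using \<delta> M by (simp add: e_def)
  define m where "m = 2 * (d + degree T + 1)"
  define Q where "Q = monom e m + ([:c:] + T ^ 2)"
  have Qx: "poly Q x = e * x ^ m + (c + (poly T x)\<^sup>2)" for x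
    by (simp add: Q_def poly_monom power2_eq_square)
  have dT: "degree ([:c:] + T ^ 2) < m"
  proof (rule degree_add_less)
    show "degree (T ^ 2) < m" using degree_power_le[of T 2] by (simp add: m_def)
  qed (simp add: m_def)
  have "degree (monom e m) = m" using e by (simp add: degree_monom_eq)
  then have "degree Q = m" unfolding Q_def using dT by (subst degree_add_eq_left) simp_all
  then have deg: "d \<le> degree Q" by (simp add: m_def)
  have xm: "0 \<le> e * x ^ m" for x
    using e by (intro mult_nonneg_nonneg zero_le_even_power) (auto simp: m_def)
  have lower: "c \<le> poly Q x" for x
    unfolding Qx using xm[of x] by simp
  have "\<bar>1 / poly Q x - u x\<bar> \<le> 2 / M" if x: "\<bar>x\<bar> \<le> real N" for x
  proof -
    have Tx: "\<bar>h x - poly T x\<bar> < \<epsilon>" by (rule T) (use x in \<open>simp add: abs_le_iff\<close>)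
    have \<epsilon>1: "\<epsilon> \<le> 1" "\<epsilon> * (2 * M + 1) \<le> \<delta> / 2"
    proof -
      show "\<epsilon> \<le> 1" by (simp add: \<epsilon>_def)
      have "\<epsilon> * (2 * M + 1) \<le> \<delta> / (2 * (2 * M + 1)) * (2 * M + 1)"
        using M by (intro mult_right_mono) (auto simp: \<epsilon>_def)
      also have "\<dots> = \<delta> / 2" using M by (simp add: field_simps)
      finally show "\<epsilon> * (2 * M + 1) \<le> \<delta> / 2" .
    qed
    have "\<bar>(poly T x)\<^sup>2 - (h x)\<^sup>2\<bar> = \<bar>h x - poly T x\<bar> * \<bar>h x + poly T x\<bar>"
      by (simp flip: abs_mult) (simp add: power2_eq_square algebra_simps abs_minus_commute)
    also have "\<dots> \<le> \<epsilon> * (2 * M + 1)"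
    proof (intro mult_mono)
      show "\<bar>h x + poly T x\<bar> \<le> 2 * M + 1" using Tx \<epsilon>1(1) h(1,3)[of x] by linarith
    qed (use Tx \<epsilon> in auto)
    finally have 1: "\<bar>(poly T x)\<^sup>2 - (h x)\<^sup>2\<bar> \<le> \<delta> / 2" using \<epsilon>1(2) by linarith
    have "x ^ m = \<bar>x\<bar> ^ m" by (simp add: m_def power_even_abs)
    also have "\<dots> \<le> M ^ m" using x by (intro power_mono) (auto simp: M_def)
    finally have "e * x ^ m \<le> e * M ^ m" using e by simp
    also have "\<dots> = \<delta> / 2" using M by (simp add: e_def m_def)
    finally have 2: "e * x ^ m \<le> \<delta> / 2" .
    note 3 = xm[of x]
    have "\<bar>poly Q x - v x\<bar> \<le> \<delta>" using 1 2 3 h(2)[of x] unfolding Qx by linarith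
    moreover have pos: "0 < poly Q x" "0 < v x" using lower[of x] v(1)[of x] c by linarith+
    ultimately have "\<bar>1 / poly Q x - 1 / v x\<bar> \<le> \<delta> / (poly Q x * v x)"
      by (simp add: diff_divide_eq_iff divide_diff_eq_iff abs_divide abs_mult divide_right_mono field_simps abs_minus_commute)
    also have "\<dots> \<le> \<delta> / (c * c)"
      using c \<delta> lower[of x] v(1)[of x] by (intro divide_left_mono mult_mono mult_pos_pos pos) auto
    also have "\<dots> = 1 / M" using c by (simp add: \<delta>_def power2_eq_square)
    finally have "\<bar>1 / poly Q x - 1 / v x\<bar> \<le> 1 / M" .
    moreover have "1 / v x = u x + 1 / M" by (simp add: v_def)
    ultimately show ?thesis using M by (simp add: field_simps abs_le_iff)
  qed
  with deg lower show ?thesis unfolding M_def c_def by (intro exI[of _ Q]) auto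
qed

text \<open>Approximation on growing intervals with error \<open>2 / (real N + 1)\<close> gives
  pointwise convergence, while the uniform bound prepares dominated convergence. The degrees are
  kept above \<open>d\<close> because the identities are available only for sufficiently many
  poles.\<close>

lemma ex_poly_reciprocal_limit:
  fixes u :: "nat \<Rightarrow> real \<Rightarrow> real"
  assumes u: "\<And>N. continuous_on UNIV (u N)" "\<And>N x. 0 \<le> u N x" "\<And>N x. u N x \<le> B"
    and lim: "\<And>x. (\<lambda>N. u N x) \<longlonglongrightarrow> r x"
  obtains Q :: "nat \<Rightarrow> real poly" where "\<And>N. d \<le> degree (Q N)" "\<And>N x. 0 < poly (Q N) x"
    "\<And>N x. 1 / poly (Q N) x \<le> B + 1" "\<And>x. (\<lambda>N. 1 / poly (Q N) x) \<longlonglongrightarrow> r x"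
proof -
  have B: "0 \<le> B" using u(2,3) order_trans by blast
  have "\<forall>N. \<exists>Q. d \<le> degree Q \<and> (\<forall>x. 1 / (B + 1) \<le> poly Q x) \<and>
    (\<forall>x. \<bar>x\<bar> \<le> real N \<longrightarrow> \<bar>1 / poly Q x - u N x\<bar> \<le> 2 / (real N + 1))"
    using ex_poly_reciprocal_approx[OF u] by blast
  then obtain Q where Q: "\<And>N. d \<le> degree (Q N)" "\<And>N x. 1 / (B + 1) \<le> poly (Q N) x"
    "\<And>N x. \<bar>x\<bar> \<le> real N \<Longrightarrow> \<bar>1 / poly (Q N) x - u N x\<bar> \<le> 2 / (real N + 1)"
    by metis
  have pos: "0 < poly (Q N) x" for N x
    using Q(2)[of N x] B by (meson add_nonneg_pos divide_pos_pos less_le_trans zero_less_one)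
  show thesis
  proof
    show "1 / poly (Q N) x \<le> B + 1" for N x
      using Q(2)[of N x] pos[of N x] B by (simp add: field_simps)
    fix x
    have "(\<lambda>N. 1 / poly (Q N) x - u N x) \<longlonglongrightarrow> 0"
    proof (rule Lim_null_comparison)
      show "(\<lambda>N. 2 / (real N + 1)) \<longlonglongrightarrow> 0"
        using tendsto_mult_right_zero[OF LIMSEQ_inverse_real_of_nat, of 2] by (simp add: field_simps)
      show "\<forall>\<^sub>F N in sequentially. norm (1 / poly (Q N) x - u N x) \<le> 2 / (real N + 1)"
        using eventually_ge_at_top[of "nat \<lceil>\<bar>x\<bar>\<rceil>"]
      proof eventually_elim
        case (elim N)
        then have "\<bar>x\<bar> \<le> real N" by linarith
        then show ?case using Q(3) by simp
      qed
    qed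
    from tendsto_add[OF this lim[of x]] show "(\<lambda>N. 1 / poly (Q N) x) \<longlonglongrightarrow> r x" by simp
  qed (use Q(1) pos in auto)
qed

text \<open>A positive polynomial has no real roots, so its reciprocal is a constant times a product
  of simple poles off the real axis, listed with multiplicity.\<close>

lemma ex_reciprocal_factorization:
  fixes Q :: "real poly"
  assumes "\<And>x. 0 < poly Q x"
  obtains C zs where "length zs = degree Q" "\<And>z. z \<in> set zs \<Longrightarrow> Im z \<noteq> 0"
    "\<And>x. complex_of_real (1 / poly Q x) = C * (\<Prod>z\<leftarrow>zs. 1 / (z - complex_of_real x))"
proof -
  define q where "q = map_poly complex_of_real Q"
  have deg: "degree q = degree Q" by (simp add: q_def degree_map_poly)
  have eval: "poly q (complex_of_real x) = complex_of_real (poly Q x)" for x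
    by (simp add: poly_altdef deg) (simp add: q_def coeff_map_poly)
  have q0: "q \<noteq> 0" using assms[of 0] eval[of 0] by auto
  obtain A where A: "size A = degree q" "q = smult (lead_coeff q) (\<Prod>x\<in>#A. [:-x, 1:])"
    using alg_closed_imp_factorization[OF q0] by blast
  obtain zs where zs: "mset zs = A" using ex_mset by blast
  have "poly q w = lead_coeff q * (\<Prod>z\<leftarrow>zs. w - z)" for w
    by (subst A(2)) (simp add: zs[symmetric] poly_prod_mset flip: prod_mset_prod_list)
  then have val: "complex_of_real (poly Q x) = lead_coeff q * (\<Prod>z\<leftarrow>zs. complex_of_real x - z)" for x
    unfolding eval[symmetric] .
  show thesis
  proof
    show "length zs = degree Q" using A(1) deg zs by (metis size_mset)
    fix z assume z: "z \<in> set zs"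
    show "Im z \<noteq> 0"
    proof
      assume "Im z = 0"
      then have "z = complex_of_real (Re z)" by (simp add: complex_eq_iff)
      then have "(\<Prod>y\<leftarrow>zs. complex_of_real (Re z) - y) = 0"
        using z by (force simp: prod_list_zero_iff image_iff)
      then show False using val[of "Re z"] assms[of "Re z"] by simp
    qed
  next
    fix x
    have "(\<Prod>z\<leftarrow>zs. 1 / (z - complex_of_real x)) = (- 1) ^ length zs / (\<Prod>z\<leftarrow>zs. complex_of_real x - z)"
    proof (induction zs)
      case (Cons z zs)
      have "1 / (z - complex_of_real x) = - 1 / (complex_of_real x - z)"
        by (metis minus_diff_eq minus_divide_divide)
      then show ?case using Cons by simp
    qed simp
    moreover have "(- 1 :: complex) ^ k * (- 1) ^ k = 1" for k by (simp flip: power_mult_distrib)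
    ultimately show "complex_of_real (1 / poly Q x) = (- 1) ^ length zs / lead_coeff q * (\<Prod>z\<leftarrow>zs. 1 / (z - complex_of_real x))"
      using val[of x] by simp
  qed
qed

text \<open>A sum of half-line indicators that is additive in the set of thresholds. Polarization
  over subsets of thresholds relies on this, and a single threshold serves to count
  eigenvalues.\<close>

definition step_count :: "('k \<Rightarrow> real) \<Rightarrow> 'k set \<Rightarrow> real \<Rightarrow> real" where
  "step_count a S x = (\<Sum>k\<in>S. if x \<le> a k then 1 else 0)"

text \<open>Ramps of slope -N clipped to [0, 1]: each equals 1 up to its threshold and is 0 at
  \<open>x\<close> once N times the distance of \<open>x\<close> beyond the threshold is at least
  1.\<close>

lemma step_count_limit:
  assumes "finite S"
  obtains u :: "nat \<Rightarrow> real \<Rightarrow> real" where "\<And>N. continuous_on UNIV (u N)" "\<And>N x. 0 \<le> u N x"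
    "\<And>N x. u N x \<le> real (card S)" "\<And>x. (\<lambda>N. u N x) \<longlonglongrightarrow> step_count a S x"
proof
  define h where "h N k x = max 0 (min 1 (1 + real N * (a k - x)))" for N k x
  define u where "u N x = (\<Sum>k\<in>S. h N k x)" for N x
  show "continuous_on UNIV (u N)" for N
    unfolding u_def h_def by (intro continuous_intros)
  show "0 \<le> u N x" for N x by (auto simp: u_def h_def intro!: sum_nonneg)
  have "u N x \<le> (\<Sum>k\<in>S. 1)" for N x unfolding u_def by (intro sum_mono) (simp add: h_def)
  then show "u N x \<le> real (card S)" for N x by simp
  fix x
  have "(\<lambda>N. h N k x) \<longlonglongrightarrow> (if x \<le> a k then 1 else 0)" for k
  proof (cases "x \<le> a k")
    case True
    then have "h N k x = 1" for N by (simp add: h_def)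
    then show ?thesis using True by simp
  next
    case False
    have "\<forall>\<^sub>F N in sequentially. h N k x = 0"
      using eventually_ge_at_top[of "nat \<lceil>1 / (x - a k)\<rceil>"]
    proof eventually_elim
      case (elim N)
      then have "1 / (x - a k) \<le> real N" by linarith
      then have "1 \<le> real N * (x - a k)" using False by (simp add: field_simps)
      then show ?case by (simp add: h_def algebra_simps)
    qed
    then show ?thesis using False by (simp add: tendsto_eventually)
  qed
  then show "(\<lambda>N. u N x) \<longlonglongrightarrow> step_count a S x"
    unfolding u_def step_count_def by (intro tendsto_sum)
qed

lemma prod_prod_list_swap: "(\<Prod>j\<in>J. \<Prod>z\<leftarrow>zs. f z j) = (\<Prod>z\<leftarrow>zs. \<Prod>j\<in>J. f z j :: 'a::comm_monoid_mult)"
  by (induction zs) (simp_all add: prod.distrib)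

lemma borel_measurable_prod_list:
  fixes f :: "'k \<Rightarrow> 'b \<Rightarrow> complex"
  assumes "\<And>z. z \<in> set zs \<Longrightarrow> f z \<in> borel_measurable M"
  shows "(\<lambda>x. \<Prod>z\<leftarrow>zs. f z x) \<in> borel_measurable M"
  using assms by (induction zs) (auto intro: borel_measurable_times)

text \<open>Products over the eigenvalues of reciprocals of positive polynomials are rational in the
  entries of the matrix, hence measurable. Their limits include 2 to the number of eigenvalues at
  most \<open>a\<close>, and this count decides each ordered eigenvalue.\<close>

lemma borel_measurable_eigenvalues:
  fixes A :: "'a \<Rightarrow> complex^('n::{finite,linorder})^('n::{finite,linorder})"
  assumes A: "A \<in> borel_measurable M" and h: "\<And>\<omega>. \<omega> \<in> space M \<Longrightarrow> hermitian (A \<omega>)"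
  shows "(\<lambda>\<omega>. eigenvalues (A \<omega>) $ i) \<in> borel_measurable M"
proof -
  define x where "x \<omega> j = eigenvalues (A \<omega>) $ j" for \<omega> j
  have rational: "(\<lambda>\<omega>. \<Prod>j\<in>UNIV. 1 / poly Q (x \<omega> j)) \<in> borel_measurable M" if Q: "\<And>t. 0 < poly Q t" for Q
  proof -
    obtain C zs where zs: "\<And>z. z \<in> set zs \<Longrightarrow> Im z \<noteq> 0"
      "\<And>t. complex_of_real (1 / poly Q t) = C * (\<Prod>z\<leftarrow>zs. 1 / (z - complex_of_real t))"
      using ex_reciprocal_factorization[OF Q] by metis
    have "complex_of_real (\<Prod>j\<in>UNIV. 1 / poly Q (x \<omega> j)) = C ^ CARD('n) * (\<Prod>z\<leftarrow>zs. 1 / det (mat z - A \<omega>))"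
      if "\<omega> \<in> space M" for \<omega>
    proof -
      have "complex_of_real (\<Prod>j\<in>UNIV. 1 / poly Q (x \<omega> j)) = (\<Prod>j\<in>UNIV. complex_of_real (1 / poly Q (x \<omega> j)))"
        by (rule of_real_prod)
      also have "\<dots> = C ^ CARD('n) * (\<Prod>j\<in>UNIV. \<Prod>z\<leftarrow>zs. 1 / (z - complex_of_real (x \<omega> j)))"
        unfolding zs(2) by (simp only: prod.distrib prod_constant)
      also have "(\<Prod>j\<in>UNIV. \<Prod>z\<leftarrow>zs. 1 / (z - complex_of_real (x \<omega> j))) = (\<Prod>z\<leftarrow>zs. 1 / det (mat z - A \<omega>))"
        unfolding prod_prod_list_swap eigenvalues_spec(2)[OF h[OF that]] x_def by (simp add: prod_dividef)
      finally show ?thesis .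
    qed
    moreover have "(\<lambda>\<omega>. C ^ CARD('n) * (\<Prod>z\<leftarrow>zs. 1 / det (mat z - A \<omega>))) \<in> borel_measurable M"
    proof (intro borel_measurable_times borel_measurable_const borel_measurable_prod_list borel_measurable_divide)
      show "(\<lambda>\<omega>. det (mat z - A \<omega>)) \<in> borel_measurable M" for z
        by (rule borel_measurable_det) (use A in simp)
    qed
    ultimately have "(\<lambda>\<omega>. complex_of_real (\<Prod>j\<in>UNIV. 1 / poly Q (x \<omega> j))) \<in> borel_measurable M"
      by (simp cong: measurable_cong)
    then have "(\<lambda>\<omega>. Re (complex_of_real (\<Prod>j\<in>UNIV. 1 / poly Q (x \<omega> j)))) \<in> borel_measurable M"
      by (rule borel_measurable_Re[THEN measurable_compose[rotated]])
    then show ?thesis by (simp only: Re_complex_of_real)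
  qed
  have count: "(\<lambda>\<omega>. \<Prod>j\<in>UNIV. 1 + step_count (\<lambda>_. a) {()} (x \<omega> j)) \<in> borel_measurable M" for a
  proof -
    obtain u :: "nat \<Rightarrow> real \<Rightarrow> real" where u: "\<And>N. continuous_on UNIV (u N)" "\<And>N x. 0 \<le> u N x"
      "\<And>N x. u N x \<le> real (card {()})" "\<And>x. (\<lambda>N. u N x) \<longlonglongrightarrow> step_count (\<lambda>_. a) {()} x"
      using step_count_limit[of "{()}" "\<lambda>_. a"] by (metis finite.emptyI finite_insert)
    have "continuous_on UNIV (\<lambda>x. 1 + u N x)" "0 \<le> 1 + u N x" "1 + u N x \<le> 2"
      "(\<lambda>N. 1 + u N x) \<longlonglongrightarrow> 1 + step_count (\<lambda>_. a) {()} x" for N x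
      using u(1)[of N] u(2,3)[of N x] u(4)[of x] by (auto intro!: continuous_intros tendsto_intros)
    then obtain Q where Q: "\<And>N x. 0 < poly (Q N) x" "\<And>x. (\<lambda>N. 1 / poly (Q N) x) \<longlonglongrightarrow> 1 + step_count (\<lambda>_. a) {()} x"
      using ex_poly_reciprocal_limit[of "\<lambda>N x. 1 + u N x" 2 "\<lambda>x. 1 + step_count (\<lambda>_. a) {()} x"] by metis
    show ?thesis
    proof (rule borel_measurable_LIMSEQ_real)
      show "(\<lambda>N. \<Prod>j\<in>UNIV. 1 / poly (Q N) (x \<omega> j)) \<longlonglongrightarrow> (\<Prod>j\<in>UNIV. 1 + step_count (\<lambda>_. a) {()} (x \<omega> j))" for \<omega>
        by (intro tendsto_prod Q(2))
    qed (rule rational[OF Q(1)])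
  qed
  \<comment> \<open>Ranks start at 0: the eigenvalue at \<open>i\<close> is at most \<open>a\<close>
    exactly when at least \<open>card {..<i} + 1\<close> eigenvalues are.\<close>
  have iff: "eigenvalues (A \<omega>) $ i \<le> a \<longleftrightarrow> 2 ^ (card {..<i} + 1) \<le> (\<Prod>j\<in>UNIV. 1 + step_count (\<lambda>_. a) {()} (x \<omega> j))"
    if \<omega>: "\<omega> \<in> space M" for \<omega> a
  proof -
    have mono: "mono (x \<omega>)" unfolding x_def by (rule eigenvalues_spec(1)[OF h[OF \<omega>]])
    have "(\<Prod>j\<in>UNIV. 1 + step_count (\<lambda>_. a) {()} (x \<omega> j)) = (\<Prod>j\<in>UNIV. if x \<omega> j \<le> a then 2 else 1)"
      by (intro prod.cong refl) (simp add: step_count_def)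
    also have "\<dots> = (\<Prod>j\<in>{j. x \<omega> j \<le> a}. 2)"
      by (rule prod.mono_neutral_cong_right) auto
    finally have "(\<Prod>j\<in>UNIV. 1 + step_count (\<lambda>_. a) {()} (x \<omega> j)) = 2 ^ card {j. x \<omega> j \<le> a}"
      by simp
    moreover have "x \<omega> i \<le> a \<longleftrightarrow> card {..<i} + 1 \<le> card {j. x \<omega> j \<le> a}"
    proof
      assume le: "x \<omega> i \<le> a"
      have "x \<omega> j \<le> a" if "j \<le> i" for j using monoD[OF mono that] le by simp
      then have "insert i {..<i} \<subseteq> {j. x \<omega> j \<le> a}" using le by auto
      then have "card (insert i {..<i}) \<le> card {j. x \<omega> j \<le> a}" by (intro card_mono) auto
      then show "card {..<i} + 1 \<le> card {j. x \<omega> j \<le> a}" by simp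
    next
      assume c: "card {..<i} + 1 \<le> card {j. x \<omega> j \<le> a}"
      show "x \<omega> i \<le> a"
      proof (rule ccontr)
        assume "\<not> x \<omega> i \<le> a"
        then have "{j. x \<omega> j \<le> a} \<subseteq> {..<i}" using monoD[OF mono, of i] by (force simp: not_less[symmetric])
        then have "card {j. x \<omega> j \<le> a} \<le> card {..<i}" by (intro card_mono) auto
        with c show False by simp
      qed
    qed
    ultimately show ?thesis
      using power_increasing_iff[of "2::real" "card {..<i} + 1" "card {j. x \<omega> j \<le> a}"] by (simp add: x_def)
  qed
  show ?thesis
  proof (rule borel_measurable_iff_le[THEN iffD2], rule allI)
    fix a
    have "{\<omega> \<in> space M. eigenvalues (A \<omega>) $ i \<le> a} =
        {\<omega> \<in> space M. 2 ^ (card {..<i} + 1) \<le> (\<Prod>j\<in>UNIV. 1 + step_count (\<lambda>_. a) {()} (x \<omega> j))}"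
      using iff by auto
    also have "\<dots> \<in> sets M"
      using count[of a] by (intro borel_measurable_le) auto
    finally show "{\<omega> \<in> space M. eigenvalues (A \<omega>) $ i \<le> a} \<in> sets M" .
  qed
qed

subsection \<open>Resolvent expectations determine the symmetric law\<close>

text \<open>The leading coefficient of the Lagrange interpolant of a monic polynomial of degree n at
  n + 1 nodes.\<close>

lemma lagrange_leading_coefficient:
  fixes p :: "complex poly" and z :: "'k \<Rightarrow> complex"
  assumes T: "finite T" "inj_on z T" "card T = Suc n" and p: "degree p = n" "lead_coeff p = 1"
  shows "(\<Sum>i\<in>T. poly p (z i) / (\<Prod>k\<in>T - {i}. z i - z k)) = 1"
proof -
  define L where "L = (\<Sum>i\<in>T. smult (poly p (z i) / (\<Prod>k\<in>T - {i}. z i - z k)) (\<Prod>k\<in>T - {i}. [:- z k, 1:]))"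
  have card: "card (T - {i}) = n" if "i \<in> T" for i using T that by simp
  have "poly L (z j) = poly p (z j)" if j: "j \<in> T" for j
  proof -
    have "poly L (z j) = (\<Sum>i\<in>T. if i = j then poly p (z j) else 0)"
      unfolding L_def poly_sum
    proof (rule sum.cong[OF refl])
      fix i assume i: "i \<in> T"
      show "poly (smult (poly p (z i) / (\<Prod>k\<in>T - {i}. z i - z k)) (\<Prod>k\<in>T - {i}. [:- z k, 1:])) (z j) =
          (if i = j then poly p (z j) else 0)"
      proof (cases "i = j")
        case True
        have "(\<Prod>k\<in>T - {i}. z i - z k) \<noteq> 0" using T i by (auto simp: inj_on_def)
        then show ?thesis using True by (simp add: poly_prod)
      next
        case False
        then have "(\<Prod>k\<in>T - {i}. z j - z k) = 0" using j T by (intro prod_zero) auto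
        then show ?thesis using False by (simp add: poly_prod)
      qed
    qed
    then show ?thesis using j T by simp
  qed
  then have "L = p"
  proof (intro poly_eqI_degree[where A="z ` T"])
    have "degree L \<le> n" unfolding L_def
    proof (rule degree_sum_le[OF T(1)])
      fix i assume i: "i \<in> T"
      have "degree (\<Prod>k\<in>T - {i}. [:- z k, 1:]) = n"
        using lead_coeff_prod_linear(1)[of "T - {i}" z] T card[OF i] by simp
      then show "degree (smult (poly p (z i) / (\<Prod>k\<in>T - {i}. z i - z k)) (\<Prod>k\<in>T - {i}. [:- z k, 1:])) \<le> n"
        using degree_smult_le le_trans by metis
    qed
    then show "degree L < card (z ` T)" using T by (simp add: card_image)
    show "degree p < card (z ` T)" using T p by (simp add: card_image)
  qed auto
  then have "1 = coeff L n" using p by simp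
  also have "\<dots> = (\<Sum>i\<in>T. poly p (z i) / (\<Prod>k\<in>T - {i}. z i - z k))"
    unfolding L_def coeff_sum
  proof (rule sum.cong[OF refl])
    fix i assume i: "i \<in> T"
    have "coeff (\<Prod>k\<in>T - {i}. [:- z k, 1:]) n = 1"
      using lead_coeff_prod_linear(2)[of "T - {i}" z] T card[OF i] by simp
    then show "coeff (smult (poly p (z i) / (\<Prod>k\<in>T - {i}. z i - z k)) (\<Prod>k\<in>T - {i}. [:- z k, 1:])) n =
        poly p (z i) / (\<Prod>k\<in>T - {i}. z i - z k)" by simp
  qed
  finally show ?thesis by simp
qed

text \<open>Binomial expansion of (-1 + 1) over the complement of \<open>R\<close>.\<close>

lemma sum_signed_supersets:
  fixes R :: "'n::finite set"
  shows "(\<Sum>S\<in>UNIV. if R \<subseteq> S then (- 1 :: complex) ^ card (- S) else 0) = (if R = UNIV then 1 else 0)"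
proof -
  have "(\<Sum>S\<in>UNIV. if R \<subseteq> S then (- 1 :: complex) ^ card (- S) else 0) = (\<Sum>S\<in>{S. R \<subseteq> S}. (- 1) ^ card (- S))"
    by (rule sum.mono_neutral_cong_right) auto
  also have "\<dots> = (\<Sum>U\<in>Pow (- R). (- 1) ^ card U)"
    by (rule sum.reindex_bij_witness[of _ uminus uminus]) auto
  also have "\<dots> = (\<Prod>k\<in>- R. - 1 + 1)"
    by (subst prod_add) auto
  also have "\<dots> = (if R = UNIV then 1 else 0)"
  proof (cases "R = UNIV")
    case False
    then have "0 < card (- R)" by (subst card_gt_0_iff) auto
    with False show ?thesis by simp
  qed simp
  finally show ?thesis .
qed

text \<open>Ryser's formula for the permanent. Expanding the products gives a sum over maps;
  inclusion and exclusion over the allowed range \<open>S\<close> keeps the surjective maps, which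
  on a finite set are the permutations.\<close>

lemma polarization:
  fixes b :: "'n::finite \<Rightarrow> 'n \<Rightarrow> complex"
  shows "(\<Sum>S\<in>UNIV. (- 1) ^ card (- S) * (\<Prod>j\<in>UNIV. \<Sum>k\<in>S. b k j)) = (\<Sum>\<sigma>\<in>{p. p permutes UNIV}. \<Prod>j\<in>UNIV. b (\<sigma> j) j)"
proof -
  have "(\<Prod>j\<in>UNIV. \<Sum>k\<in>S. b k j) = (\<Sum>\<phi>\<in>UNIV. if range \<phi> \<subseteq> S then \<Prod>j\<in>UNIV. b (\<phi> j) j else 0)" for S
  proof -
    have "(\<Prod>j\<in>UNIV. \<Sum>k\<in>S. b k j) = (\<Sum>\<phi>\<in>Pi\<^sub>E UNIV (\<lambda>_. S). \<Prod>j\<in>UNIV. b (\<phi> j) j)"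
      by (rule prod_sum_PiE) auto
    also have "\<dots> = (\<Sum>\<phi>\<in>UNIV. if range \<phi> \<subseteq> S then \<Prod>j\<in>UNIV. b (\<phi> j) j else 0)"
      by (rule sum.mono_neutral_cong_left) (auto simp: PiE_UNIV_domain)
    finally show ?thesis .
  qed
  then have "(\<Sum>S\<in>UNIV. (- 1) ^ card (- S) * (\<Prod>j\<in>UNIV. \<Sum>k\<in>S. b k j)) =
      (\<Sum>S\<in>UNIV. \<Sum>\<phi>\<in>UNIV. (if range \<phi> \<subseteq> S then (- 1) ^ card (- S) else 0) * (\<Prod>j\<in>UNIV. b (\<phi> j) j))"
    by (simp add: sum_distrib_left if_distrib if_distribR cong: if_cong)
  also have "\<dots> = (\<Sum>\<phi>\<in>UNIV. (\<Sum>S\<in>UNIV. if range \<phi> \<subseteq> S then (- 1) ^ card (- S) else 0) * (\<Prod>j\<in>UNIV. b (\<phi> j) j))"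
    by (subst sum.swap) (simp only: sum_distrib_right)
  also have "\<dots> = (\<Sum>\<phi>\<in>UNIV. if surj \<phi> then \<Prod>j\<in>UNIV. b (\<phi> j) j else 0)"
    unfolding sum_signed_supersets by (intro sum.cong refl) simp
  also have "\<dots> = (\<Sum>\<sigma>\<in>{p. p permutes UNIV}. \<Prod>j\<in>UNIV. b (\<sigma> j) j)"
  proof (rule sum.mono_neutral_cong_right)
    have "surj \<phi> \<longleftrightarrow> \<phi> permutes UNIV" for \<phi> :: "'n \<Rightarrow> 'n"
    proof
      assume "surj \<phi>"
      then have "bij \<phi>" using finite_UNIV_surj_inj[of \<phi>] by (simp add: bij_def)
      then show "\<phi> permutes UNIV" by (intro bij_imp_permutes) auto
    qed (rule permutes_surj)
    then show "\<forall>i\<in>UNIV - {p. p permutes UNIV}. (if surj i then \<Prod>j\<in>UNIV. b (i j) j else 0) = 0"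
      "\<And>x. x \<in> {p. p permutes UNIV} \<Longrightarrow> (if surj x then \<Prod>j\<in>UNIV. b (x j) j else 0) = (\<Prod>j\<in>UNIV. b (x j) j)"
      by auto
  qed auto
  finally show ?thesis .
qed

section \<open>Test functions on which a law and a candidate density agree\<close>

locale density_candidate =
  fixes \<mu> :: "(real^'n::finite) measure" and q :: "real^'n::finite \<Rightarrow> real"
  assumes prob: "prob_space \<mu>" and sets: "sets \<mu> = sets borel" and q: "integrable lborel q"
begin

text \<open>Here \<open>q\<close> is merely integrable, of unknown sign. Including measurability and
  boundedness in the notion makes it stable under linear combinations and bounded pointwise
  limits.\<close>

definition agree :: "(real^'n \<Rightarrow> complex) \<Rightarrow> bool" where
  "agree \<phi> \<longleftrightarrow> \<phi> \<in> borel_measurable borel \<and> (\<exists>B. \<forall>x. norm (\<phi> x) \<le> B) \<and>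
     (\<integral>x. \<phi> x \<partial>\<mu>) = (\<integral>x. complex_of_real (q x) * \<phi> x \<partial>lborel)"

lemma agree_integrable:
  assumes "agree \<phi>"
  shows "integrable \<mu> \<phi>" "integrable lborel (\<lambda>x. complex_of_real (q x) * \<phi> x)"
proof -
  interpret prob_space \<mu> by (rule prob)
  obtain B where B: "\<phi> \<in> borel_measurable borel" "\<And>x. norm (\<phi> x) \<le> B" using assms by (auto simp: agree_def)
  show "integrable \<mu> \<phi>"
    by (rule integrable_const_bound[of _ B]) (use B measurable_cong_sets[OF sets refl] in auto)
  show "integrable lborel (\<lambda>x. complex_of_real (q x) * \<phi> x)"
    by (rule integrable_mult_bounded[OF q _ B(2)]) (use B in simp)
qed

lemma agree_mult:
  assumes "agree \<phi>"
  shows "agree (\<lambda>x. c * \<phi> x)"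
proof -
  obtain B where B: "\<And>x. norm (\<phi> x) \<le> B" using assms by (auto simp: agree_def)
  have "norm (c * \<phi> x) \<le> norm c * B" for x unfolding norm_mult by (intro mult_left_mono B) simp
  moreover have "(\<integral>x. complex_of_real (q x) * (c * \<phi> x) \<partial>lborel) = c * (\<integral>x. complex_of_real (q x) * \<phi> x \<partial>lborel)"
    by (simp only: mult.left_commute[of _ c] integral_mult_right_zero)
  ultimately show ?thesis using assms by (auto simp: agree_def)
qed

lemma agree_sum:
  assumes "\<And>i. i \<in> I \<Longrightarrow> agree (\<phi> i)"
  shows "agree (\<lambda>x. \<Sum>i\<in>I. \<phi> i x)"
proof (cases "finite I")
  case True
  have "\<forall>i\<in>I. \<exists>B. \<forall>x. norm (\<phi> i x) \<le> B" using assms by (auto simp: agree_def)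
  then obtain B where B: "\<And>i x. i \<in> I \<Longrightarrow> norm (\<phi> i x) \<le> B i" by metis
  have "norm (\<Sum>i\<in>I. \<phi> i x) \<le> (\<Sum>i\<in>I. B i)" for x
    by (intro order_trans[OF norm_sum] sum_mono B)
  moreover have "(\<integral>x. (\<Sum>i\<in>I. \<phi> i x) \<partial>\<mu>) = (\<Sum>i\<in>I. \<integral>x. \<phi> i x \<partial>\<mu>)"
    by (rule Bochner_Integration.integral_sum) (use assms agree_integrable in auto)
  moreover have "(\<integral>x. (\<Sum>i\<in>I. complex_of_real (q x) * \<phi> i x) \<partial>lborel) = (\<Sum>i\<in>I. \<integral>x. complex_of_real (q x) * \<phi> i x \<partial>lborel)"
    by (rule Bochner_Integration.integral_sum) (use assms agree_integrable in auto)
  moreover have "(\<lambda>x. \<Sum>i\<in>I. \<phi> i x) \<in> borel_measurable borel"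
    using assms by (intro borel_measurable_sum) (auto simp: agree_def)
  ultimately show ?thesis using assms unfolding agree_def
    by (auto simp: sum_distrib_left)
qed (auto simp: agree_def)

lemma agree_limit:
  assumes \<phi>: "\<And>m. agree (\<phi> m)" and B: "\<And>m x. norm (\<phi> m x) \<le> B" and lim: "\<And>x. (\<lambda>m. \<phi> m x) \<longlonglongrightarrow> \<psi> x"
  shows "agree \<psi>"
proof -
  interpret prob_space \<mu> by (rule prob)
  have m: "\<phi> m \<in> borel_measurable borel" for m using \<phi> by (simp add: agree_def)
  have \<psi>m: "\<psi> \<in> borel_measurable borel" by (rule borel_measurable_LIMSEQ_metric[OF m lim])
  have \<psi>B: "norm (\<psi> x) \<le> B" for x
    using tendsto_norm[OF lim[of x]] by (rule tendsto_upperbound) (use B in auto)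
  have mm: "borel_measurable \<mu> = (borel_measurable borel :: (real^'n \<Rightarrow> complex) set)"
    by (rule measurable_cong_sets[OF sets refl])
  have 1: "(\<lambda>m. \<integral>x. \<phi> m x \<partial>\<mu>) \<longlonglongrightarrow> (\<integral>x. \<psi> x \<partial>\<mu>)"
    by (rule integral_dominated_convergence[where w="\<lambda>_. B"]) (use m \<psi>m B lim mm in auto)
  have qm: "q \<in> borel_measurable borel" using q by auto
  have 2: "(\<lambda>m. \<integral>x. complex_of_real (q x) * \<phi> m x \<partial>lborel) \<longlonglongrightarrow> (\<integral>x. complex_of_real (q x) * \<psi> x \<partial>lborel)"
  proof (rule integral_dominated_convergence[where w="\<lambda>x. \<bar>q x\<bar> * B"])
    show "integrable lborel (\<lambda>x. \<bar>q x\<bar> * B)" using q by simp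
    show "AE x in lborel. norm (complex_of_real (q x) * \<phi> m x) \<le> \<bar>q x\<bar> * B" for m
      unfolding norm_mult using B by (intro AE_I2) (simp add: mult_left_mono)
  qed (use m \<psi>m qm lim in \<open>auto intro!: tendsto_intros\<close>)
  have "(\<integral>x. \<phi> m x \<partial>\<mu>) = (\<integral>x. complex_of_real (q x) * \<phi> m x \<partial>lborel)" for m
    using \<phi> by (simp add: agree_def)
  with 1 2 have "(\<integral>x. \<psi> x \<partial>\<mu>) = (\<integral>x. complex_of_real (q x) * \<psi> x \<partial>lborel)"
    by (metis (no_types, lifting) LIMSEQ_unique ext)
  with \<psi>m \<psi>B show ?thesis by (auto simp: agree_def)
qed

text \<open>For perturbed poles, which are known to be admissible only far out in the
  sequence.\<close>

lemma agree_eventually_limit: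
  assumes \<phi>: "\<forall>\<^sub>F m in sequentially. agree (\<phi> m) \<and> (\<forall>x. norm (\<phi> m x) \<le> B)" and lim: "\<And>x. (\<lambda>m. \<phi> m x) \<longlonglongrightarrow> \<psi> x"
  shows "agree \<psi>"
proof -
  obtain N where N: "\<And>m. N \<le> m \<Longrightarrow> agree (\<phi> m) \<and> (\<forall>x. norm (\<phi> m x) \<le> B)"
    using \<phi> by (auto simp: eventually_sequentially)
  show ?thesis
  proof (rule agree_limit)
    show "agree (\<phi> (m + N))" for m using N[of "m + N"] by simp
    show "norm (\<phi> (m + N) x) \<le> B" for m x using N[of "m + N"] by simp
    show "(\<lambda>m. \<phi> (m + N) x) \<longlonglongrightarrow> \<psi> x" for x by (rule LIMSEQ_ignore_initial_segment[OF lim])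
  qed
qed

end

locale resolvent_candidate = density_candidate \<mu> q
  for \<mu> :: "(real^'n::finite) measure" and q +
  assumes resolvents: "\<And>z :: 'n \<Rightarrow> complex. (\<And>l. Im (z l) \<noteq> 0) \<Longrightarrow> inj (\<lambda>l. Im (z l)) \<Longrightarrow>
    agree (\<lambda>y. \<Prod>l\<in>UNIV. \<Prod>j\<in>UNIV. 1 / (z l - complex_of_real (y $ j)))"
begin

text \<open>Induction on the number of poles. With \<open>p\<close> the polynomial whose roots are
  the particles, removing a pole multiplies the product by the value of \<open>p\<close> there. The
  Lagrange identity at n + 1 of the poles therefore writes the full product as a combination of
  products with one pole fewer, the coefficients \<open>c i\<close> being independent of the
  particles.\<close>

lemma agree_resolvents_distinct:
  fixes z :: "nat \<Rightarrow> complex"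
  assumes "finite S" "\<And>k. k \<in> S \<Longrightarrow> Im (z k) \<noteq> 0" "inj_on (\<lambda>k. Im (z k)) S" "CARD('n) \<le> card S"
  shows "agree (\<lambda>y. \<Prod>k\<in>S. \<Prod>j\<in>UNIV. 1 / (z k - complex_of_real (y $ j)))"
  using assms
proof (induction "card S" arbitrary: S rule: less_induct)
  case less
  show ?case
  proof (cases "card S = CARD('n)")
    case True
    then obtain h where h: "bij_betw h (UNIV :: 'n set) S"
      using less.prems(1) finite_same_card_bij[of "UNIV :: 'n set" S] by auto
    have "agree (\<lambda>y. \<Prod>l\<in>UNIV. \<Prod>j\<in>UNIV. 1 / (z (h l) - complex_of_real (y $ j)))"
    proof (rule resolvents)
      show "Im (z (h l)) \<noteq> 0" for l using h less.prems(2) by (auto simp: bij_betw_def)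
      show "inj (\<lambda>l. Im (z (h l)))"
        using comp_inj_on[of h UNIV "\<lambda>k. Im (z k)"] h less.prems(3) by (simp add: bij_betw_def o_def)
    qed
    moreover have "(\<Prod>l\<in>UNIV. \<Prod>j\<in>UNIV. 1 / (z (h l) - complex_of_real (y $ j))) =
        (\<Prod>k\<in>S. \<Prod>j\<in>UNIV. 1 / (z k - complex_of_real (y $ j)))" for y :: "real^'n"
      by (rule prod.reindex_bij_betw[OF h])
    ultimately show ?thesis by simp
  next
    case False
    then have "Suc (CARD('n)) \<le> card S" using less.prems(4) by simp
    then obtain T where T: "T \<subseteq> S" "card T = Suc CARD('n)" "finite T"
      using obtain_subset_with_card_n by metis
    define c where "c i = 1 / (\<Prod>k\<in>T - {i}. z i - z k)" for i
    have inj: "inj_on z T" 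
    proof (rule inj_onI)
      fix x y assume "x \<in> T" "y \<in> T" "z x = z y"
      then show "x = y" using inj_onD[OF less.prems(3), of x y] T(1) by auto
    qed
    have "agree (\<lambda>y. \<Prod>k\<in>S - {i}. \<Prod>j\<in>UNIV. 1 / (z k - complex_of_real (y $ j)))" if "i \<in> T" for i
    proof (rule less.hyps)
      have i: "i \<in> S" using that T by auto
      show "card (S - {i}) < card S" using i less.prems(1) by (intro psubset_card_mono) auto
      show "CARD('n) \<le> card (S - {i})" using i less.prems(1,4) False by simp
      show "inj_on (\<lambda>k. Im (z k)) (S - {i})" using less.prems(3) by (rule inj_on_subset) auto
    qed (use less.prems in auto)
    then have "agree (\<lambda>y. \<Sum>i\<in>T. c i * (\<Prod>k\<in>S - {i}. \<Prod>j\<in>UNIV. 1 / (z k - complex_of_real (y $ j))))"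
      by (intro agree_sum agree_mult)
    moreover have "(\<Sum>i\<in>T. c i * (\<Prod>k\<in>S - {i}. \<Prod>j\<in>UNIV. 1 / (z k - complex_of_real (y $ j)))) =
        (\<Prod>k\<in>S. \<Prod>j\<in>UNIV. 1 / (z k - complex_of_real (y $ j)))" for y :: "real^'n"
    proof -
      define p where "p = (\<Prod>j\<in>UNIV. [:- complex_of_real (y $ j), 1:])"
      have pz: "poly p w = (\<Prod>j\<in>UNIV. w - complex_of_real (y $ j))" for w by (simp add: p_def poly_prod)
      have deg: "degree p = CARD('n)" "lead_coeff p = 1"
        using lead_coeff_prod_linear[of UNIV "\<lambda>j. complex_of_real (y $ j)"] by (simp_all add: p_def)
      have nz: "poly p (z k) \<noteq> 0" if "k \<in> S" for k
        using less.prems(2)[OF that] by (auto simp: pz)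
      have inv: "(\<Prod>j\<in>UNIV. 1 / (w - complex_of_real (y $ j))) = 1 / poly p w" for w
        by (simp add: pz prod_dividef)
      have "(\<Prod>k\<in>S - {i}. 1 / poly p (z k)) = poly p (z i) * (\<Prod>k\<in>S. 1 / poly p (z k))" if "i \<in> T" for i
        using prod.remove[of S i "\<lambda>k. 1 / poly p (z k)"] nz[of i] that T(1) less.prems(1) by auto
      then have "(\<Sum>i\<in>T. c i * (\<Prod>k\<in>S - {i}. 1 / poly p (z k))) =
          (\<Sum>i\<in>T. poly p (z i) / (\<Prod>k\<in>T - {i}. z i - z k)) * (\<Prod>k\<in>S. 1 / poly p (z k))"
        unfolding sum_distrib_right by (intro sum.cong refl) (simp add: c_def)
      also have "\<dots> = (\<Prod>k\<in>S. 1 / poly p (z k))"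
        by (subst lagrange_leading_coefficient[OF T(3) inj T(2) deg]) simp
      finally show ?thesis by (simp only: inv)
    qed
    ultimately show ?thesis by simp
  qed
qed

text \<open>Coinciding imaginary parts, and coinciding poles, are separated by a small vertical
  shift that is then sent to 0; the bounds survive because every imaginary part eventually exceeds
  half its limit.\<close>

lemma agree_resolvents:
  fixes z :: "nat \<Rightarrow> complex"
  assumes Im: "\<And>k. k < N \<Longrightarrow> Im (z k) \<noteq> 0" and N: "CARD('n) \<le> N"
  shows "agree (\<lambda>y. \<Prod>k<N. \<Prod>j\<in>UNIV. 1 / (z k - complex_of_real (y $ j)))"
proof -
  define \<epsilon> where "\<epsilon> m = inverse (real (Suc m))" for m
  have \<epsilon>: "\<epsilon> \<longlonglongrightarrow> 0" unfolding \<epsilon>_def by (rule LIMSEQ_inverse_real_of_nat)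
  have \<epsilon>pos: "0 < \<epsilon> m" for m by (simp add: \<epsilon>_def)
  \<comment> \<open>The shift is proportional to the index, so equal imaginary parts separate at
    once; different ones stay apart for large \<open>m\<close> by convergence.\<close>
  define w where "w m k = z k + \<i> * complex_of_real (\<epsilon> m * real k)" for m k
  have Imw: "Im (w m k) = Im (z k) + \<epsilon> m * real k" for m k by (simp add: w_def)
  have Imlim: "(\<lambda>m. Im (w m k)) \<longlonglongrightarrow> Im (z k)" for k
    unfolding Imw using tendsto_add[OF tendsto_const tendsto_mult[OF \<epsilon> tendsto_const], of "Im (z k)" "real k"] by simp
  have wlim: "(\<lambda>m. w m k) \<longlonglongrightarrow> z k" for k
    unfolding w_def using tendsto_add[OF tendsto_const tendsto_mult[OF tendsto_const tendsto_of_real[OF tendsto_mult[OF \<epsilon> tendsto_const]]], of "z k" \<i> "real k"] by simp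
  have big: "\<forall>\<^sub>F m in sequentially. \<bar>Im (z k)\<bar> / 2 < \<bar>Im (w m k)\<bar>" if "k < N" for k
    using order_tendstoD(1)[OF tendsto_rabs[OF Imlim[of k]], of "\<bar>Im (z k)\<bar> / 2"] Im[OF that] by simp
  have distinct: "\<forall>\<^sub>F m in sequentially. Im (w m k) \<noteq> Im (w m l)" if "k \<noteq> l" for k l
  proof (cases "Im (z k) = Im (z l)")
    case True
    then show ?thesis using \<epsilon>pos that by (auto simp: Imw less_imp_neq[THEN not_sym])
  next
    case False
    then have "Im (z k) - Im (z l) \<noteq> 0" by simp
    from tendsto_imp_eventually_ne[OF tendsto_diff[OF Imlim Imlim] this] show ?thesis by simp
  qed
  define B where "B = (\<Prod>k<N. \<Prod>j\<in>(UNIV::'n set). 2 / \<bar>Im (z k)\<bar>)"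
  have "\<forall>\<^sub>F m in sequentially. (\<forall>k\<in>{..<N}. \<bar>Im (z k)\<bar> / 2 < \<bar>Im (w m k)\<bar>) \<and>
      (\<forall>k\<in>{..<N}. \<forall>l\<in>{..<N}. k \<noteq> l \<longrightarrow> Im (w m k) \<noteq> Im (w m l))"
    by (intro eventually_conj eventually_ball_finite ballI) (use big distinct in auto)
  then have "\<forall>\<^sub>F m in sequentially. agree (\<lambda>y. \<Prod>k<N. \<Prod>j\<in>UNIV. 1 / (w m k - complex_of_real (y $ j))) \<and>
      (\<forall>y. norm (\<Prod>k<N. \<Prod>j\<in>UNIV. 1 / (w m k - complex_of_real ((y::real^'n) $ j))) \<le> B)"
  proof eventually_elim
    case (elim m)
    then have big: "\<bar>Im (z k)\<bar> / 2 < \<bar>Im (w m k)\<bar>" if "k < N" for k using that by auto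
    then have nz: "Im (w m k) \<noteq> 0" if "k < N" for k using that by fastforce
    have "norm (1 / (w m k - complex_of_real t)) \<le> 2 / \<bar>Im (z k)\<bar>" if "k < N" for k t
    proof -
      have "1 / \<bar>Im (w m k)\<bar> \<le> 1 / (\<bar>Im (z k)\<bar> / 2)"
        using big[OF that] Im[OF that] nz[OF that] by (intro divide_left_mono) auto
      then show ?thesis using norm_inverse_diff_real_le[OF nz[OF that], of t] by simp
    qed
    then have "norm (\<Prod>k<N. \<Prod>j\<in>UNIV. 1 / (w m k - complex_of_real (y $ j))) \<le> B" for y :: "real^'n"
      unfolding B_def prod_norm[symmetric] by (intro prod_mono conjI prod_nonneg) auto
    moreover have "agree (\<lambda>y. \<Prod>k<N. \<Prod>j\<in>UNIV. 1 / (w m k - complex_of_real (y $ j)))"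
      by (rule agree_resolvents_distinct) (use elim nz N in \<open>auto simp: inj_on_def\<close>)
    ultimately show ?case by blast
  qed
  then show ?thesis
  proof (rule agree_eventually_limit)
    fix y :: "real^'n"
    show "(\<lambda>m. \<Prod>k<N. \<Prod>j\<in>UNIV. 1 / (w m k - complex_of_real (y $ j))) \<longlonglongrightarrow>
        (\<Prod>k<N. \<Prod>j\<in>UNIV. 1 / (z k - complex_of_real (y $ j)))"
    proof (intro tendsto_prod tendsto_divide tendsto_diff tendsto_const wlim)
      fix k j assume "k \<in> {..<N}"
      then have "Im (z k - complex_of_real (y $ j)) \<noteq> 0" using Im by simp
      then show "z k - complex_of_real (y $ j) \<noteq> 0" by fastforce
    qed
  qed
qed

lemma agree_reciprocal_poly:
  assumes Q: "\<And>x. 0 < poly Q x" "CARD('n) \<le> degree Q"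
  shows "agree (\<lambda>y. complex_of_real (\<Prod>j\<in>UNIV. 1 / poly Q (y $ j)))"
proof -
  obtain C zs where zs: "length zs = degree Q" "\<And>z. z \<in> set zs \<Longrightarrow> Im z \<noteq> 0"
    "\<And>t. complex_of_real (1 / poly Q t) = C * (\<Prod>z\<leftarrow>zs. 1 / (z - complex_of_real t))"
    using ex_reciprocal_factorization[OF Q(1)] by metis
  have "complex_of_real (\<Prod>j\<in>UNIV. 1 / poly Q (y $ j)) =
      C ^ CARD('n) * (\<Prod>k<length zs. \<Prod>j\<in>UNIV. 1 / (zs ! k - complex_of_real (y $ j)))" for y :: "real^'n"
  proof -
    have "complex_of_real (\<Prod>j\<in>UNIV. 1 / poly Q (y $ j)) = (\<Prod>j\<in>UNIV. complex_of_real (1 / poly Q (y $ j)))"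
      by (rule of_real_prod)
    also have "\<dots> = C ^ CARD('n) * (\<Prod>z\<leftarrow>zs. \<Prod>j\<in>UNIV. 1 / (z - complex_of_real (y $ j)))"
      unfolding zs(3) by (simp only: prod.distrib prod_constant prod_prod_list_swap)
    finally show ?thesis by (simp add: prod.list_conv_set_nth atLeast0LessThan)
  qed
  moreover have "agree (\<lambda>y. C ^ CARD('n) * (\<Prod>k<length zs. \<Prod>j\<in>UNIV. 1 / (zs ! k - complex_of_real (y $ j))))"
    by (intro agree_mult agree_resolvents) (use zs Q in auto)
  ultimately show ?thesis by simp
qed

text \<open>Degree at least n is requested from the approximating polynomials so that their
  reciprocals have enough poles.\<close>

lemma agree_step_count:
  fixes a :: "'n \<Rightarrow> real"
  shows "agree (\<lambda>y. complex_of_real (\<Prod>j\<in>UNIV. step_count a S (y $ j)))"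
proof -
  obtain u :: "nat \<Rightarrow> real \<Rightarrow> real" where u: "\<And>N. continuous_on UNIV (u N)" "\<And>N x. 0 \<le> u N x"
    "\<And>N x. u N x \<le> real (card S)" "\<And>x. (\<lambda>N. u N x) \<longlonglongrightarrow> step_count a S x"
    using step_count_limit[of S a] by (metis finite)
  obtain Q where Q: "\<And>N. CARD('n) \<le> degree (Q N)" "\<And>N x. 0 < poly (Q N) x"
    "\<And>N x. 1 / poly (Q N) x \<le> real (card S) + 1" "\<And>x. (\<lambda>N. 1 / poly (Q N) x) \<longlonglongrightarrow> step_count a S x"
    using ex_poly_reciprocal_limit[OF u] by metis
  show ?thesis
  proof (rule agree_limit)
    show "agree (\<lambda>y. complex_of_real (\<Prod>j\<in>UNIV. 1 / poly (Q N) (y $ j)))" for N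
      by (rule agree_reciprocal_poly) (use Q in auto)
    show "norm (complex_of_real (\<Prod>j\<in>UNIV. 1 / poly (Q N) (y $ j))) \<le> (\<Prod>j\<in>(UNIV::'n set). real (card S) + 1)" for N and y :: "real^'n"
      unfolding norm_of_real abs_prod by (intro prod_mono) (use Q(2,3) in \<open>simp add: less_imp_le\<close>)
    show "(\<lambda>N. complex_of_real (\<Prod>j\<in>UNIV. 1 / poly (Q N) (y $ j))) \<longlonglongrightarrow> complex_of_real (\<Prod>j\<in>UNIV. step_count a S (y $ j))" for y :: "real^'n"
      by (intro tendsto_of_real tendsto_prod Q(4))
  qed
qed

text \<open>Only products of one and the same function over all particles are available so far;
  polarization over the set of thresholds produces distinct thresholds, at the price of
  symmetrization.\<close>

lemma agree_permuted_boxes: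
  "agree (\<lambda>y. \<Sum>\<sigma>\<in>{p. p permutes UNIV}. \<Prod>j\<in>UNIV. if y $ j \<le> a (\<sigma> j) then 1 else 0)"
proof -
  have "agree (\<lambda>y. \<Sum>S\<in>UNIV. (- 1) ^ card (- S) * complex_of_real (\<Prod>j\<in>UNIV. step_count a S (y $ j)))"
    by (intro agree_sum agree_mult agree_step_count)
  moreover have "complex_of_real (\<Prod>j\<in>UNIV. step_count a S (y $ j)) = (\<Prod>j\<in>UNIV. \<Sum>k\<in>S. if y $ j \<le> a k then 1 else 0)"
    for S and y :: "real^'n"
    unfolding of_real_prod step_count_def of_real_sum by (intro prod.cong sum.cong refl) auto
  ultimately show ?thesis
    using polarization[of "\<lambda>k j. if y $ j \<le> a k then 1 else 0" for y :: "real^'n"] by simp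
qed

end

context density_candidate
begin

text \<open>The lower orthants are stable under intersection and generate the Borel sets, so
  Dynkin's induction applies.\<close>

lemma agree_indicator:
  assumes box: "\<And>a. agree (indicator {..a})" and A: "A \<in> sets borel"
  shows "agree (indicator A)"
proof -
  have ind: "norm (indicator B x :: complex) \<le> 1" for B and x :: "real^'n"
    by (simp add: indicator_def)
  have UNIV: "agree (indicator UNIV)"
  proof (rule agree_limit[where B=1, OF box ind])
    fix x :: "real^'n"
    have "\<forall>\<^sub>F m in sequentially. x \<in> {..(\<chi> i. real m)}"
      using eventually_ge_at_top[of "nat \<lceil>norm x\<rceil>"]
    proof eventually_elim
      case (elim m)
      have "x $ i \<le> real m" for i
        using component_le_norm_cart[of x i] elim by linarith
      then show ?case by (simp add: less_eq_vec_def)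
    qed
    then have "\<forall>\<^sub>F m in sequentially. (indicator {..(\<chi> i. real m)} x :: complex) = indicator UNIV x"
      by (auto elim!: eventually_mono simp: indicator_def)
    then show "(\<lambda>m. indicator {..(\<chi> i. real m)} x :: complex) \<longlonglongrightarrow> indicator UNIV x"
      by (rule tendsto_eventually)
  qed
  have "Int_stable (range (\<lambda>a::real^'n. {..a}))"
  proof (rule Int_stableI)
    fix B C assume "B \<in> range (\<lambda>a::real^'n. {..a})" "C \<in> range (\<lambda>a::real^'n. {..a})"
    then obtain b c :: "real^'n" where "B = {..b}" "C = {..c}" by auto
    then have "B \<inter> C = {..(\<chi> i. min (b $ i) (c $ i))}" by (auto simp: less_eq_vec_def)
    then show "B \<inter> C \<in> range (\<lambda>a::real^'n. {..a})" by auto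
  qed
  moreover have "range (\<lambda>a::real^'n. {..a}) \<subseteq> Pow UNIV" by simp
  moreover have "A \<in> sigma_sets UNIV (range (\<lambda>a::real^'n. {..a}))"
    using A by (subst (asm) borel_eq_atMost) simp
  ultimately show ?thesis
  proof (induction rule: sigma_sets_induct_disjoint)
    case (basic A)
    then show ?case using box by auto
  next
    case empty
    then show ?case using agree_mult[OF UNIV, of 0] by (simp add: indicator_def[abs_def])
  next
    case (compl A)
    \<comment> \<open>A difference expressed as a sum over the two Booleans, to fit the closure
      under finite sums.\<close>
    have "agree (\<lambda>x. \<Sum>b\<in>UNIV. if b then indicator UNIV x else (- 1) * indicator A x)"
    proof (rule agree_sum)
      fix b :: bool
      show "agree (\<lambda>x. if b then indicator UNIV x else (- 1) * indicator A x)"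
        by (cases b) (use UNIV agree_mult[OF compl(2), of "- 1"] in simp_all)
    qed
    moreover have "(\<lambda>x. \<Sum>b\<in>UNIV. if b then indicator UNIV x else (- 1) * indicator A x :: complex) = indicator (UNIV - A)"
      by (auto simp: UNIV_bool indicator_def fun_eq_iff)
    ultimately show ?case by simp
  next
    case (union A)
    have fin: "(\<lambda>x. \<Sum>i<m. indicator (A i) x :: complex) = indicator (\<Union>i<m. A i)" for m
      using union(1) by (auto simp: indicator_UN_disjoint fun_eq_iff disjoint_family_on_def)
    show ?case
    proof (rule agree_limit[where B=1])
      show "agree (indicator (\<Union>i<m. A i))" for m
        unfolding fin[symmetric] by (intro agree_sum union)
      show "(\<lambda>m. indicator (\<Union>i<m. A i) x :: complex) \<longlonglongrightarrow> indicator (\<Union>i. A i) x" for x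
        by (rule LIMSEQ_indicator_UN)
    qed (rule ind)
  qed
qed

text \<open>The integral of \<open>q\<close> over the set where it is negative equals the measure of
  that set, hence is nonnegative, so the set is null. With the sign settled, equality on Borel sets
  is equality with the density measure.\<close>

lemma density_of_agree:
  assumes box: "\<And>a. agree (indicator {..a})"
  shows "AE x in lborel. 0 \<le> q x" "\<mu> = density lborel (\<lambda>x. ennreal (q x))"
proof -
  interpret prob_space \<mu> by (rule prob)
  have qm[measurable]: "q \<in> borel_measurable borel" using q by auto
  have eq: "measure \<mu> A = (\<integral>x. indicator A x * q x \<partial>lborel)" if A: "A \<in> sets borel" for A
  proof -
    have "measure \<mu> A = (\<integral>x. indicator A x \<partial>\<mu>)"
      using sets_eq_imp_space_eq[OF sets] by simp
    then have "complex_of_real (measure \<mu> A) = (\<integral>x. complex_of_real (indicator A x) \<partial>\<mu>)"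
      by (simp only: integral_complex_of_real)
    also have "\<dots> = (\<integral>x. indicator A x \<partial>\<mu>)"
      by (rule Bochner_Integration.integral_cong) (auto simp: indicator_def)
    also have "\<dots> = (\<integral>x. complex_of_real (q x) * indicator A x \<partial>lborel)"
      using agree_indicator[OF box A] by (simp add: agree_def)
    also have "\<dots> = (\<integral>x. complex_of_real (indicator A x * q x) \<partial>lborel)"
      by (rule Bochner_Integration.integral_cong) (auto simp: indicator_def)
    also have "\<dots> = complex_of_real (\<integral>x. indicator A x * q x \<partial>lborel)"
      by (rule integral_complex_of_real)
    finally show ?thesis by (simp only: of_real_eq_iff)
  qed
  have int: "integrable lborel (\<lambda>x. indicator A x * q x)" if "A \<in> sets borel" for A
    using integrable_real_mult_indicator[of A lborel q] that q by (simp add: mult.commute)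
  define N where "N = {x. q x < 0}"
  have N: "N \<in> sets borel"
  proof -
    have "{x \<in> space borel. q x < 0} \<in> sets borel" by measurable
    then show ?thesis by (simp add: N_def)
  qed
  have "0 \<le> (\<integral>x. indicator N x * q x \<partial>lborel)" using eq[OF N] by (metis measure_nonneg)
  moreover have "(\<integral>x. indicator N x * q x \<partial>lborel) = - (\<integral>x. \<bar>indicator N x * q x\<bar> \<partial>lborel)"
    by (subst Bochner_Integration.integral_minus[symmetric], rule Bochner_Integration.integral_cong)
       (auto simp: N_def indicator_def)
  moreover have "0 \<le> (\<integral>x. \<bar>indicator N x * q x\<bar> \<partial>lborel)" by simp
  ultimately have "(\<integral>x. \<bar>indicator N x * q x\<bar> \<partial>lborel) = 0" by linarith
  then have "AE x in lborel. \<bar>indicator N x * q x\<bar> = 0"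
    using integral_nonneg_eq_0_iff_AE[OF integrable_abs[OF int[OF N]]] by simp
  then show nn: "AE x in lborel. 0 \<le> q x"
    by (auto elim!: eventually_mono simp: N_def indicator_def split: if_splits)
  show "\<mu> = density lborel (\<lambda>x. ennreal (q x))"
  proof (rule measure_eqI)
    fix A assume "A \<in> sets \<mu>"
    then have A: "A \<in> sets borel" by (simp add: sets)
    have "emeasure \<mu> A = ennreal (\<integral>x. indicator A x * q x \<partial>lborel)"
      by (simp add: emeasure_eq_measure eq[OF A])
    also have "\<dots> = (\<integral>\<^sup>+x. ennreal (indicator A x * q x) \<partial>lborel)"
      by (rule nn_integral_eq_integral[symmetric, OF int[OF A]])
         (use nn in \<open>auto elim!: eventually_mono\<close>)
    also have "\<dots> = (\<integral>\<^sup>+x. ennreal (q x) * indicator A x \<partial>lborel)"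
      by (rule nn_integral_cong) (auto simp: indicator_def)
    also have "\<dots> = emeasure (density lborel (\<lambda>x. ennreal (q x))) A"
      by (rule emeasure_density[symmetric]) (use A in auto)
    finally show "emeasure \<mu> A = emeasure (density lborel (\<lambda>x. ennreal (q x))) A" .
  qed (simp add: sets)
qed

end

text \<open>Both sides are invariant under permutations, so all n! summands of the symmetrized box
  have the same integral, and n! can be divided out.\<close>

lemma (in resolvent_candidate) agree_box:
  assumes sym\<mu>: "\<And>\<pi> \<phi>. \<pi> permutes UNIV \<Longrightarrow> \<phi> \<in> borel_measurable borel \<Longrightarrow> (\<And>x. norm (\<phi> x :: complex) \<le> 1) \<Longrightarrow>
      (\<integral>y. \<phi> (\<chi> i. y $ \<pi> i) \<partial>\<mu>) = (\<integral>y. \<phi> y \<partial>\<mu>)"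
    and symq: "\<And>\<pi> \<phi>. \<pi> permutes UNIV \<Longrightarrow> \<phi> \<in> borel_measurable borel \<Longrightarrow>
      (\<integral>y. complex_of_real (q y) * \<phi> (\<chi> i. y $ \<pi> i) \<partial>lborel) = (\<integral>y. complex_of_real (q y) * \<phi> y \<partial>lborel)"
  shows "agree (indicator {..a})"
proof -
  interpret prob_space \<mu> by (rule prob)
  let ?P = "{p. p permutes (UNIV :: 'n set)}"
  define I where "I = (indicator {..a} :: real^'n \<Rightarrow> complex)"
  have Im: "I \<in> borel_measurable borel" by (simp add: I_def)
  have Ib: "norm (I x) \<le> 1" for x by (simp add: I_def indicator_def)
  have mm: "borel_measurable \<mu> = (borel_measurable borel :: (real^'n \<Rightarrow> complex) set)"
    by (rule measurable_cong_sets[OF sets refl])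
  \<comment> \<open>Permuting the thresholds is the same as permuting the particles by the
    inverse.\<close>
  have t: "(\<Prod>j\<in>UNIV. if y $ j \<le> a $ \<sigma> j then 1 else 0) = I (\<chi> i. y $ inv \<sigma> i)" if \<sigma>: "\<sigma> \<in> ?P" for \<sigma> and y :: "real^'n"
  proof -
    have inv: "inv \<sigma> (\<sigma> j) = j" "\<sigma> (inv \<sigma> j) = j" for j
      using \<sigma> permutes_inverses[of \<sigma> UNIV] by auto
    have "(\<forall>j. y $ j \<le> a $ \<sigma> j) \<longleftrightarrow> (\<forall>i. y $ inv \<sigma> i \<le> a $ i)" by (metis inv)
    then show ?thesis
      by (cases "\<forall>j. y $ j \<le> a $ \<sigma> j") (auto simp: I_def indicator_def less_eq_vec_def intro!: prod_zero)
  qed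
  have perm_meas: "(\<lambda>y. I (\<chi> i. y $ \<pi> i)) \<in> borel_measurable borel" for \<pi>
    by (rule measurable_compose[OF borel_measurable_vec_lambda Im]) simp
  have inv: "inv \<sigma> permutes UNIV" if "\<sigma> \<in> ?P" for \<sigma> using that by (simp add: permutes_inv)
  have A: "agree (\<lambda>y. \<Sum>\<sigma>\<in>?P. I (\<chi> i. y $ inv \<sigma> i))"
    using agree_permuted_boxes[of "($) a"] by (simp add: t)
  have "(\<integral>y. (\<Sum>\<sigma>\<in>?P. I (\<chi> i. y $ inv \<sigma> i)) \<partial>\<mu>) = (\<Sum>\<sigma>\<in>?P. \<integral>y. I (\<chi> i. y $ inv \<sigma> i) \<partial>\<mu>)"
    by (rule Bochner_Integration.integral_sum, rule integrable_const_bound[of _ 1]) (use Ib perm_meas mm in auto)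
  also have "\<dots> = (\<Sum>\<sigma>\<in>?P. \<integral>y. I y \<partial>\<mu>)"
    by (intro sum.cong refl sym\<mu> inv Im Ib)
  finally have 1: "(\<integral>y. (\<Sum>\<sigma>\<in>?P. I (\<chi> i. y $ inv \<sigma> i)) \<partial>\<mu>) = of_nat (card ?P) * (\<integral>y. I y \<partial>\<mu>)" by simp
  have "(\<integral>y. complex_of_real (q y) * (\<Sum>\<sigma>\<in>?P. I (\<chi> i. y $ inv \<sigma> i)) \<partial>lborel) =
      (\<Sum>\<sigma>\<in>?P. \<integral>y. complex_of_real (q y) * I (\<chi> i. y $ inv \<sigma> i) \<partial>lborel)"
    unfolding sum_distrib_left
    by (rule Bochner_Integration.integral_sum, rule integrable_mult_bounded[OF q, of _ 1]) (use Ib perm_meas in auto)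
  also have "\<dots> = (\<Sum>\<sigma>\<in>?P. \<integral>y. complex_of_real (q y) * I y \<partial>lborel)"
    by (intro sum.cong refl symq inv Im)
  finally have 2: "(\<integral>y. complex_of_real (q y) * (\<Sum>\<sigma>\<in>?P. I (\<chi> i. y $ inv \<sigma> i)) \<partial>lborel) =
      of_nat (card ?P) * (\<integral>y. complex_of_real (q y) * I y \<partial>lborel)" by simp
  have "id \<in> ?P" by (simp add: permutes_id)
  then have "card ?P \<noteq> 0" by (metis card_eq_0_iff empty_iff finite)
  moreover have "of_nat (card ?P) * (\<integral>y. I y \<partial>\<mu>) = of_nat (card ?P) * (\<integral>y. complex_of_real (q y) * I y \<partial>lborel)"
    unfolding 1[symmetric] 2[symmetric] using A unfolding agree_def by (elim conjE)
  ultimately have "(\<integral>y. I y \<partial>\<mu>) = (\<integral>y. complex_of_real (q y) * I y \<partial>lborel)"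
    by (simp only: mult_cancel_left of_nat_eq_0_iff simp_thms)
  with Im Ib show ?thesis unfolding I_def[symmetric] agree_def by blast
qed

subsection \<open>Permutation invariance\<close>

lemma vdm_permute:
  fixes x :: "'n::{finite,linorder} \<Rightarrow> 'a::idom"
  assumes "\<pi> permutes UNIV"
  shows "vdm (\<lambda>i. x (\<pi> i)) = of_int (sign \<pi>) * vdm x"
  using det_permute_rows[OF assms, of "\<chi> j m. x j ^ card {..<m}"]
  by (simp flip: det_vandermonde)

text \<open>Both determinants pick up the sign of the permutation.\<close>

lemma polynomial_ensemble_permute:
  fixes f :: "'n::{finite,linorder} \<Rightarrow> real \<Rightarrow> real"
  assumes \<pi>: "\<pi> permutes UNIV"
  shows "polynomial_ensemble Z f (\<chi> i. y $ \<pi> i) = polynomial_ensemble Z f y"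
proof -
  have "det (\<chi> j k. f k (y $ \<pi> j)) = of_int (sign \<pi>) * det (\<chi> j k. f k (y $ j))"
    using det_permute_rows[OF \<pi>, of "\<chi> j k. f k (y $ j)"] by simp
  moreover have "vandermonde (\<chi> i. y $ \<pi> i) = of_int (sign \<pi>) * vandermonde y"
    unfolding vandermonde_eq_vdm vdm_permute[OF \<pi>, symmetric] by (rule arg_cong[of _ _ vdm]) (simp add: fun_eq_iff)
  moreover have "real_of_int (sign \<pi>) * real_of_int (sign \<pi>) = 1"
    by (simp add: sign_def)
  ultimately show ?thesis by (simp add: polynomial_ensemble_def)
qed

lemma integral_lborel_permute:
  fixes g :: "real^'n \<Rightarrow> complex"
  assumes g: "g \<in> borel_measurable borel" and \<pi>: "\<pi> permutes UNIV"
  shows "(\<integral>y. g (\<chi> i. y $ \<pi> i) \<partial>lborel) = (\<integral>y. g y \<partial>lborel)"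
proof -
  have inv: "inv \<pi> (\<pi> j) = j" "\<pi> (inv \<pi> j) = j" for j
    using \<pi> permutes_inverses[of \<pi> UNIV] by auto
  have m: "(\<lambda>x i. x (\<pi> i)) \<in> (lborels :: ('n \<Rightarrow> real) measure) \<rightarrow>\<^sub>M lborels"
    by (rule measurable_PiM_single') auto
  have distr: "distr lborels lborels (\<lambda>x i. x (\<pi> i)) = (lborels :: ('n \<Rightarrow> real) measure)"
  proof (rule lborel_prod.PiM_eqI)
    fix A :: "'n \<Rightarrow> real set" assume A: "\<And>i. i \<in> UNIV \<Longrightarrow> A i \<in> sets lborel"
    have "emeasure (distr lborels lborels (\<lambda>x i. x (\<pi> i))) (Pi\<^sub>E UNIV A) =
        emeasure lborels ((\<lambda>x i. x (\<pi> i)) -` Pi\<^sub>E UNIV A \<inter> space (lborels :: ('n \<Rightarrow> real) measure))"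
      by (rule emeasure_distr[OF m]) (use A in \<open>auto intro!: sets_PiM_I_finite\<close>)
    also have "(\<lambda>x i. x (\<pi> i)) -` Pi\<^sub>E UNIV A \<inter> space (lborels :: ('n \<Rightarrow> real) measure) = Pi\<^sub>E UNIV (\<lambda>i. A (inv \<pi> i))"
    proof (rule set_eqI)
      fix x :: "'n \<Rightarrow> real"
      have "(\<forall>i. x (\<pi> i) \<in> A i) \<longleftrightarrow> (\<forall>i. x i \<in> A (inv \<pi> i))"
      proof (intro iffI allI)
        show "x i \<in> A (inv \<pi> i)" if "\<forall>i. x (\<pi> i) \<in> A i" for i using that[rule_format, of "inv \<pi> i"] by (simp add: inv)
        show "x (\<pi> i) \<in> A i" if "\<forall>i. x i \<in> A (inv \<pi> i)" for i using that[rule_format, of "\<pi> i"] by (simp add: inv)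
      qed
      then show "x \<in> (\<lambda>x i. x (\<pi> i)) -` Pi\<^sub>E UNIV A \<inter> space (lborels :: ('n \<Rightarrow> real) measure) \<longleftrightarrow>
          x \<in> Pi\<^sub>E UNIV (\<lambda>i. A (inv \<pi> i))"
        by (simp add: space_PiM PiE_iff)
    qed
    also have "emeasure lborels \<dots> = (\<Prod>i\<in>UNIV. emeasure lborel (A (inv \<pi> i)))"
      by (rule lborel_prod.emeasure_PiM) (use A in auto)
    also have "\<dots> = (\<Prod>i\<in>UNIV. emeasure lborel (A i))"
      using prod.permute[OF permutes_inv[OF \<pi>], of "\<lambda>i. emeasure lborel (A i)"] by (simp add: o_def)
    finally show "emeasure (distr lborels lborels (\<lambda>x i. x (\<pi> i))) (Pi\<^sub>E UNIV A) = (\<Prod>i\<in>UNIV. emeasure lborel (A i))" .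
  qed auto
  have gm: "(\<lambda>x. g (\<chi> i. x i)) \<in> borel_measurable lborels"
    by (rule measurable_compose[OF measurable_vec_lborels g])
  have gp: "(\<lambda>y. g (\<chi> i. y $ \<pi> i)) \<in> borel_measurable borel"
    by (rule measurable_compose[OF borel_measurable_vec_lambda g]) simp
  have "(\<integral>y. g y \<partial>lborel) = (\<integral>x. g (\<chi> i. x i) \<partial>distr lborels lborels (\<lambda>x i. x (\<pi> i)))"
    unfolding distr by (rule integral_lborel_vec[OF g])
  also have "\<dots> = (\<integral>x. g (\<chi> i. x (\<pi> i)) \<partial>lborels)"
    by (rule integral_distr[OF m gm])
  also have "\<dots> = (\<integral>y. g (\<chi> i. y $ \<pi> i) \<partial>lborel)"
    unfolding integral_lborel_vec[OF gp] by simp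
  finally show ?thesis by simp
qed

text \<open>Each difference is at most the product of the two weights, and each particle occurs in n
  - 1 pairs. This is the weight preserved by the Gaussian transform.\<close>

lemma vandermonde_le:
  fixes y :: "real^('n::{finite,linorder})"
  shows "\<bar>vandermonde y\<bar> \<le> (\<Prod>i\<in>UNIV. (1 + \<bar>y $ i\<bar>) ^ (CARD('n) - 1))"
proof -
  let ?D = "{(j, k). j < (k::'n)}"
  define h where "h i = 1 + \<bar>y $ i\<bar>" for i
  have "\<bar>vandermonde y\<bar> = (\<Prod>p\<in>?D. \<bar>case p of (j, k) \<Rightarrow> y $ k - y $ j\<bar>)"
    by (simp add: vandermonde_def abs_prod)
  also have "\<dots> \<le> (\<Prod>p\<in>?D. \<Prod>i\<in>UNIV. h i ^ (if fst p = i \<or> snd p = i then 1 else 0))"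
  proof (rule prod_mono)
    fix p assume "p \<in> ?D"
    then obtain j k where p: "p = (j, k)" "j < k" by auto
    then have "j \<noteq> k" by simp
    have "(\<Prod>i\<in>UNIV. h i ^ (if j = i \<or> k = i then 1 else 0)) = (\<Prod>i\<in>{j, k}. h i)"
      by (rule prod.mono_neutral_cong_right) auto
    also have "\<dots> = h j * h k" using \<open>j \<noteq> k\<close> by simp
    also have "\<bar>y $ k - y $ j\<bar> \<le> \<dots>"
    proof -
      have "\<bar>y $ k - y $ j\<bar> \<le> \<bar>y $ k\<bar> + \<bar>y $ j\<bar>" by linarith
      also have "\<dots> \<le> h j * h k" by (simp add: h_def algebra_simps)
      finally show ?thesis .
    qed
    finally show "0 \<le> \<bar>case p of (j, k) \<Rightarrow> y $ k - y $ j\<bar> \<and> \<bar>case p of (j, k) \<Rightarrow> y $ k - y $ j\<bar> \<le>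
        (\<Prod>i\<in>UNIV. h i ^ (if fst p = i \<or> snd p = i then 1 else 0))"
      by (simp add: p)
  qed
  also have "\<dots> = (\<Prod>i\<in>UNIV. h i ^ (\<Sum>p\<in>?D. if fst p = i \<or> snd p = i then 1 else 0))"
    by (subst prod.swap) (simp add: power_sum)
  also have "\<dots> = (\<Prod>i\<in>UNIV. h i ^ (CARD('n) - 1))"
    using card_pairs_through[where 'n='n] by (simp add: case_prod_unfold)
  finally show ?thesis by (simp add: h_def)
qed

text \<open>The Vandermonde factor distributes its growth over the particles, leaving for each
  permutation a product of one-dimensional weighted functions.\<close>

lemma integrable_polynomial_ensemble:
  fixes g :: "'n::{finite,linorder} \<Rightarrow> real \<Rightarrow> real"
  assumes g: "\<And>k. integrable lborel (\<lambda>t. (1 + \<bar>t\<bar>) ^ (CARD('n) - 1) * g k t)" and gm: "\<And>k. g k \<in> borel_measurable borel"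
  shows "integrable lborel (polynomial_ensemble Z g)"
proof (rule Bochner_Integration.integrable_bound)
  let ?P = "{p. p permutes (UNIV :: 'n set)}"
  define G where "G k t = (1 + \<bar>t\<bar>) ^ (CARD('n) - 1) * g k t" for k t
  have G: "integrable lborel (\<lambda>t. complex_of_real (G k t))" for k
    unfolding G_def by (rule integrable_of_real[OF g])
  have "integrable lborel (\<lambda>y::real^('n::{finite,linorder}). norm (\<Prod>j\<in>UNIV. complex_of_real (G (\<tau> j) (y $ j))))" for \<tau>
    by (rule integrable_norm[OF integral_lborel_vec_prod(1)[OF G]])
  then show "integrable lborel (\<lambda>y. \<Sum>\<tau>\<in>?P. \<bar>1 / Z\<bar> * (\<Prod>j\<in>UNIV. \<bar>G (\<tau> j) (y $ j)\<bar>))"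
    by (intro Bochner_Integration.integrable_sum integrable_mult_right) (simp flip: prod_norm)
  show "polynomial_ensemble Z g \<in> borel_measurable lborel"
    using borel_measurable_polynomial_ensemble[OF gm, of Z] by simp
  show "AE y in lborel. norm (polynomial_ensemble Z g y) \<le> norm (\<Sum>\<tau>\<in>?P. \<bar>1 / Z\<bar> * (\<Prod>j\<in>UNIV. \<bar>G (\<tau> j) (y $ j)\<bar>))"
  proof (rule AE_I2)
    fix y :: "real^('n::{finite,linorder})"
    let ?W = "\<Prod>i\<in>UNIV. (1 + \<bar>y $ i\<bar>) ^ (CARD('n) - 1)"
    have "\<bar>det (\<chi> j k. g k (y $ j))\<bar> \<le> (\<Sum>\<tau>\<in>?P. \<bar>of_int (sign \<tau>) * (\<Prod>j\<in>UNIV. g (\<tau> j) (y $ j))\<bar>)"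
      unfolding det_def by (simp add: sum_abs)
    also have "\<dots> = (\<Sum>\<tau>\<in>?P. \<Prod>j\<in>UNIV. \<bar>g (\<tau> j) (y $ j)\<bar>)"
      by (intro sum.cong refl) (simp add: abs_mult abs_prod sign_def)
    finally have d: "\<bar>det (\<chi> j k. g k (y $ j))\<bar> \<le> (\<Sum>\<tau>\<in>?P. \<Prod>j\<in>UNIV. \<bar>g (\<tau> j) (y $ j)\<bar>)" .
    have "\<bar>polynomial_ensemble Z g y\<bar> = \<bar>1 / Z\<bar> * (\<bar>vandermonde y\<bar> * \<bar>det (\<chi> j k. g k (y $ j))\<bar>)"
      by (simp add: polynomial_ensemble_def abs_mult)
    also have "\<dots> \<le> \<bar>1 / Z\<bar> * (?W * (\<Sum>\<tau>\<in>?P. \<Prod>j\<in>UNIV. \<bar>g (\<tau> j) (y $ j)\<bar>))"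
      by (intro mult_left_mono mult_mono vandermonde_le d prod_nonneg) auto
    also have "\<dots> = (\<Sum>\<tau>\<in>?P. \<bar>1 / Z\<bar> * (\<Prod>j\<in>UNIV. \<bar>G (\<tau> j) (y $ j)\<bar>))"
      unfolding sum_distrib_left
      by (intro sum.cong refl arg_cong[of _ _ "times \<bar>1 / Z\<bar>"]) (simp add: G_def abs_mult prod.distrib)
    finally show "norm (polynomial_ensemble Z g y) \<le> norm (\<Sum>\<tau>\<in>?P. \<bar>1 / Z\<bar> * (\<Prod>j\<in>UNIV. \<bar>G (\<tau> j) (y $ j)\<bar>))"
      by (auto intro: order_trans[OF _ abs_ge_self])
  qed
qed

lemma uniform_permutation_invariance:
  fixes g :: "('n::finite \<Rightarrow> 'n) \<Rightarrow> complex"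
  assumes "\<sigma> permutes UNIV"
  shows "(\<integral>\<pi>. g (\<lambda>i. \<pi> (\<sigma> i)) \<partial>uniform_count_measure {\<pi>. \<pi> permutes UNIV}) =
    (\<integral>\<pi>. g \<pi> \<partial>uniform_count_measure {\<pi>. \<pi> permutes UNIV})"
proof -
  let ?P = "{p. p permutes (UNIV :: 'n set)}"
  have fin: "finite ?P" by simp
  have "(\<Sum>\<pi>\<in>?P. c *\<^sub>R g (\<pi> \<circ> \<sigma>)) = (\<Sum>\<pi>\<in>?P. c *\<^sub>R g \<pi>)" for c
    by (rule sum.reindex_bij_witness[of _ "\<lambda>p. p \<circ> inv \<sigma>" "\<lambda>p. p \<circ> \<sigma>"])
       (use assms in \<open>auto simp: permutes_compose permutes_inv comp_assoc permutes_inv_o\<close>)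
  then show ?thesis
    unfolding uniform_count_measure_def by (simp add: lebesgue_integral_point_measure_finite fin o_def)
qed

theorem theorem2p1:
  fixes P :: "'a measure"
    and H M :: "'a \<Rightarrow> complex ^ ('n::{finite,linorder}) ^ ('n::{finite,linorder})"
    and f :: "'n \<Rightarrow> real \<Rightarrow> real"
    and Z :: real
  assumes "prob_space P"
    and "GUE P H"
    and "\<And>\<omega>. \<omega> \<in> space P \<Longrightarrow> hermitian (M \<omega>)"
    and "prob_space.indep_var P borel H borel M"
    and "\<And>k. f k \<in> borel_measurable borel"
    and "has_eigenvalue_density P M (polynomial_ensemble Z f)"
  shows "\<exists>Z'. Z' \<noteq> 0 \<and> has_eigenvalue_density P (\<lambda>\<omega>. H \<omega> + M \<omega>)
           (polynomial_ensemble Z' (\<lambda>k y. LINT t|lborel. f k t * exp (- (1/2) * (y - t)\<^sup>2)))"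
proof -
  interpret P: prob_space P by fact
  let ?U = "uniform_count_measure {\<pi>. \<pi> permutes (UNIV :: 'n set)}"
  have U: "prob_space ?U"
    by (rule prob_space_uniform_count_measure) (auto intro: exI[of _ id] permutes_id)
  interpret U: prob_space ?U by fact
  interpret PU: pair_prob_space P ?U ..
  \<comment> \<open>One factor \<open>sqrt (2 * pi)\<close> for each of the n Gaussian
    kernels.\<close>
  define Z' where "Z' = Z * sqrt (2 * pi) ^ CARD('n)"
  define F where "F k = gaussian_transform (f k)" for k
  define q where "q = polynomial_ensemble Z' F"
  define A where "A \<omega> = H \<omega> + M \<omega>" for \<omega>
  define X :: "'a \<times> ('n \<Rightarrow> 'n) \<Rightarrow> real^('n::{finite,linorder})" where "X = (\<lambda>(\<omega>, \<pi>). \<chi> i. eigenvalues (A \<omega>) $ \<pi> i)"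
  have pm: "polynomial_ensemble Z f \<in> borel_measurable borel"
    using borel_measurable_polynomial_ensemble[OF assms(5)] .
  note pint = has_eigenvalue_density_integrable[OF assms(1,6) pm]
  have Z: "Z \<noteq> 0"
  proof
    assume "Z = 0"
    then have "polynomial_ensemble Z f = (\<lambda>_. 0)" by (simp add: polynomial_ensemble_def fun_eq_iff)
    with pint(2) show False by simp
  qed
  have fint: "integrable lborel (\<lambda>t. (1 + \<bar>t\<bar>) ^ (CARD('n) - 1) * f k t)" for k
    by (rule polynomial_ensemble_integrable[OF assms(5) pint(1)]) (simp add: pint(2))
  have Fm: "F k \<in> borel_measurable borel" for k
    unfolding F_def gaussian_transform_def[abs_def] using assms(5)
    by (intro lborel.borel_measurable_lebesgue_integral) simp
  have q: "integrable lborel q"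
    unfolding q_def using integrable_polynomial_ensemble[of F, OF _ Fm] gaussian_transform_integrable[OF fint]
    by (simp add: F_def)
  then have qm: "q \<in> borel_measurable borel" by auto
  have rv: "H \<in> borel_measurable P" "M \<in> borel_measurable P"
    using assms(4) P.indep_var_rv1 P.indep_var_rv2 by auto
  have hA: "hermitian (A \<omega>)" if "\<omega> \<in> space P" for \<omega>
  proof -
    have "hermitian (H \<omega>)" "hermitian (M \<omega>)" using assms(2) assms(3)[OF that] that by (auto simp: GUE_def)
    then have "A \<omega> $ i $ j = cnj (A \<omega> $ j $ i)" for i j
      unfolding A_def vector_add_component complex_cnj_add hermitian_def by metis
    then show ?thesis unfolding hermitian_def by blast
  qed
  have eig: "(\<lambda>\<omega>. eigenvalues (A \<omega>) $ i) \<in> borel_measurable P" for i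
    by (rule borel_measurable_eigenvalues[OF _ hA]) (use rv in \<open>simp add: A_def[abs_def]\<close>)
  have Xm: "X \<in> P \<Otimes>\<^sub>M ?U \<rightarrow>\<^sub>M borel"
    unfolding X_def case_prod_unfold
  proof (rule borel_measurable_vec_lambda)
    fix i
    \<comment> \<open>The randomly relabelled eigenvalue is written as a finite sum over its
      possible labels, so that the dependence on the permutation and on the matrix separate.\<close>
    have "(\<lambda>p. \<Sum>k\<in>UNIV. (if snd p i = k then 1 else 0) * eigenvalues (A (fst p)) $ k) \<in> borel_measurable (P \<Otimes>\<^sub>M ?U)"
    proof (intro borel_measurable_sum borel_measurable_times)
      fix k
      show "(\<lambda>p. eigenvalues (A (fst p)) $ k) \<in> borel_measurable (P \<Otimes>\<^sub>M ?U)"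
        by (rule measurable_compose[OF measurable_fst eig])
      have "(\<lambda>\<pi>. if \<pi> i = k then 1 else 0 :: real) \<in> borel_measurable ?U"
        by (rule measurableI) (auto simp: sets_uniform_count_measure space_uniform_count_measure)
      from measurable_compose[OF measurable_snd this]
      show "(\<lambda>p. if snd p i = k then 1 else 0 :: real) \<in> borel_measurable (P \<Otimes>\<^sub>M ?U)" .
    qed
    moreover have "(\<Sum>k\<in>UNIV. (if l = k then 1 else 0) * v $ k) = v $ l" for l and v :: "real^('n::{finite,linorder})"
      by (simp add: if_distrib if_distribR cong: if_cong)
    ultimately show "(\<lambda>p. eigenvalues (A (fst p)) $ snd p i) \<in> borel_measurable (P \<Otimes>\<^sub>M ?U)" by simp
  qed
  \<comment> \<open>The law of the unordered eigenvalues of the sum. It remains to show that the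
    resolvent expectations under \<open>\<mu>\<close> are those of \<open>q\<close> and that both
    are symmetric.\<close>
  define \<mu> where "\<mu> = distr (P \<Otimes>\<^sub>M ?U) borel X"
  have \<mu>int: "(\<integral>y. \<phi> y \<partial>\<mu>) = (\<integral>p. \<phi> (X p) \<partial>(P \<Otimes>\<^sub>M ?U))" if "\<phi> \<in> borel_measurable borel" for \<phi> :: "real^('n::{finite,linorder}) \<Rightarrow> complex"
    unfolding \<mu>_def by (rule integral_distr[OF Xm that])
  interpret density_candidate \<mu> q
  proof (rule density_candidate.intro)
    show "prob_space \<mu>" unfolding \<mu>_def by (rule PU.prob_space_distr[OF Xm])
  qed (simp_all add: \<mu>_def q)
  interpret resolvent_candidate \<mu> q
  proof
    fix z :: "'n \<Rightarrow> complex" assume z: "\<And>l. Im (z l) \<noteq> 0" "inj (\<lambda>l. Im (z l))"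
    define g where "g y = (\<Prod>l\<in>UNIV. \<Prod>j\<in>UNIV. 1 / (z l - complex_of_real (y $ j)))" for y :: "real^('n::{finite,linorder})"
    have gm: "g \<in> borel_measurable borel" unfolding g_def by measurable
    have gb: "norm (g y) \<le> (\<Prod>l\<in>UNIV. \<Prod>j\<in>(UNIV::'n set). 1 / \<bar>Im (z l)\<bar>)" for y
      unfolding g_def prod_norm[symmetric]
      by (intro prod_mono conjI prod_nonneg) (use norm_inverse_diff_real_le[OF z(1)] in auto)
    have "g (X p) = (\<Prod>l\<in>UNIV. 1 / det (mat (z l) - A (fst p)))" if "p \<in> space (P \<Otimes>\<^sub>M ?U)" for p
    proof -
      define \<omega> \<pi> where "\<omega> = fst p" "\<pi> = snd p"
      then have p: "p = (\<omega>, \<pi>)" "\<omega> \<in> space P" "\<pi> permutes UNIV"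
        using that by (auto simp: space_pair_measure space_uniform_count_measure)
      have "(\<Prod>j\<in>UNIV. 1 / (w - complex_of_real (eigenvalues (A \<omega>) $ \<pi> j))) = 1 / det (mat w - A \<omega>)" for w
        using prod.permute[OF p(3), of "\<lambda>j. 1 / (w - complex_of_real (eigenvalues (A \<omega>) $ j))"]
        by (simp add: o_def eigenvalues_spec(2)[OF hA[OF p(2)]] prod_dividef)
      then show ?thesis by (simp add: g_def X_def p(1))
    qed
    then have "(\<integral>y. g y \<partial>\<mu>) = (\<integral>p. (\<Prod>l\<in>UNIV. 1 / det (mat (z l) - A (fst p))) \<partial>(P \<Otimes>\<^sub>M ?U))"
      unfolding \<mu>int[OF gm] by (intro Bochner_Integration.integral_cong refl)
    also have "\<dots> = (\<integral>\<omega>. (\<Prod>l\<in>UNIV. 1 / det (mat (z l) - A \<omega>)) \<partial>distr (P \<Otimes>\<^sub>M ?U) P fst)"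
    proof (rule integral_distr[symmetric])
      have "(\<lambda>\<omega>. det (mat (z l) - A \<omega>)) \<in> borel_measurable P" for l
        by (rule borel_measurable_det) (use rv in \<open>simp add: A_def\<close>)
      then show "(\<lambda>\<omega>. \<Prod>l\<in>UNIV. 1 / det (mat (z l) - A \<omega>)) \<in> borel_measurable P" by measurable
    qed simp
    also have "\<dots> = (\<integral>\<omega>. (\<Prod>l\<in>UNIV. 1 / det (mat (z l) - A \<omega>)) \<partial>P)"
      by (simp add: U.distr_pair_fst)
    also have "\<dots> = (\<integral>y. complex_of_real (q y) * g y \<partial>lborel)"
      unfolding q_def Z'_def F_def g_def A_def
      by (rule P.resolvent_expectation_polynomial_ensemble[OF assms(2,3,4,5,6) z])
    finally show "agree (\<lambda>y. \<Prod>l\<in>UNIV. \<Prod>j\<in>UNIV. 1 / (z l - complex_of_real (y $ j)))"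
      using gm gb unfolding agree_def g_def[symmetric] by blast
  qed
  have box: "agree (indicator {..a})" for a
  proof (rule agree_box)
    fix \<sigma> :: "'n \<Rightarrow> 'n" and \<phi> :: "real^('n::{finite,linorder}) \<Rightarrow> complex"
    assume \<sigma>: "\<sigma> permutes UNIV" and \<phi>: "\<phi> \<in> borel_measurable borel"
    have perm: "(\<lambda>y::real^('n::{finite,linorder}). \<chi> i. y $ \<sigma> i) \<in> borel \<rightarrow>\<^sub>M borel"
      by (rule borel_measurable_vec_lambda) simp
    note \<phi>\<sigma> = measurable_compose[OF perm \<phi>]
    {
      assume b: "\<And>x. norm (\<phi> x) \<le> 1"
      have int: "integrable (P \<Otimes>\<^sub>M ?U) (\<lambda>p. \<psi> (X p))"
        if "\<psi> \<in> borel_measurable borel" "\<And>x. norm (\<psi> x) \<le> 1" for \<psi> :: "real^('n::{finite,linorder}) \<Rightarrow> complex"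
        by (rule PU.P.integrable_const_bound[of _ 1]) (use that measurable_compose[OF Xm] in simp_all)
      \<comment> \<open>The law is symmetric because composing a uniform random permutation with a
        fixed one leaves it uniform.\<close>
      have "(\<integral>y. \<phi> (\<chi> i. y $ \<sigma> i) \<partial>\<mu>) = (\<integral>\<omega>. (\<integral>\<pi>. \<phi> (\<chi> i. X (\<omega>, \<pi>) $ \<sigma> i) \<partial>?U) \<partial>P)"
        unfolding \<mu>int[OF \<phi>\<sigma>] by (rule PU.integral_fst'[symmetric]) (use int[OF \<phi>\<sigma>] b in simp)
      also have "\<dots> = (\<integral>\<omega>. (\<integral>\<pi>. \<phi> (X (\<omega>, \<pi>)) \<partial>?U) \<partial>P)"
      proof (rule Bochner_Integration.integral_cong[OF refl])
        fix \<omega>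
        show "(\<integral>\<pi>. \<phi> (\<chi> i. X (\<omega>, \<pi>) $ \<sigma> i) \<partial>?U) = (\<integral>\<pi>. \<phi> (X (\<omega>, \<pi>)) \<partial>?U)"
          using uniform_permutation_invariance[OF \<sigma>, of "\<lambda>\<pi>. \<phi> (\<chi> i. eigenvalues (A \<omega>) $ \<pi> i)"]
          by (simp add: X_def)
      qed
      also have "\<dots> = (\<integral>y. \<phi> y \<partial>\<mu>)"
        unfolding \<mu>int[OF \<phi>] by (rule PU.integral_fst') (use int[OF \<phi>] b in simp)
      finally show "(\<integral>y. \<phi> (\<chi> i. y $ \<sigma> i) \<partial>\<mu>) = (\<integral>y. \<phi> y \<partial>\<mu>)" .
    }
    \<comment> \<open>The candidate is symmetric as a polynomial ensemble, and Lebesgue measure is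
      invariant under permuting coordinates.\<close>
    have "(\<integral>y. complex_of_real (q y) * \<phi> (\<chi> i. y $ \<sigma> i) \<partial>lborel) =
        (\<integral>y. complex_of_real (q (\<chi> i. y $ \<sigma> i)) * \<phi> (\<chi> i. y $ \<sigma> i) \<partial>lborel)"
      by (simp add: q_def polynomial_ensemble_permute[OF \<sigma>])
    also have "\<dots> = (\<integral>y. complex_of_real (q y) * \<phi> y \<partial>lborel)"
      by (rule integral_lborel_permute[OF _ \<sigma>, of "\<lambda>y. complex_of_real (q y) * \<phi> y"]) (use qm \<phi> in simp)
    finally show "(\<integral>y. complex_of_real (q y) * \<phi> (\<chi> i. y $ \<sigma> i) \<partial>lborel) = (\<integral>y. complex_of_real (q y) * \<phi> y \<partial>lborel)" .
  qed
  have "distr (P \<Otimes>\<^sub>M ?U) lborel X = \<mu>" unfolding \<mu>_def by (rule distr_cong) auto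
  then have "distributed (P \<Otimes>\<^sub>M ?U) lborel X (\<lambda>x. ennreal (q x))"
    using density_of_agree(2)[OF box] Xm qm by (simp add: distributed_def)
  then have "has_eigenvalue_density P A q"
    using density_of_agree(1)[OF box] by (simp add: has_eigenvalue_density_def X_def)
  moreover have "Z' \<noteq> 0" using Z by (simp add: Z'_def)
  ultimately show ?thesis
    unfolding q_def A_def[abs_def] F_def[abs_def] gaussian_transform_def[abs_def] by blast
qed

end
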